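(* Let $X=(\omega_{i,i}^R,\omega_{i,j}^R,\omega_{i,j}^I)_{1\le i<j\le N}$ be a random vector in $\mathbb{R}^{N^2}$ with law $\mathbb{P}^N\sim ID(\beta,0,\nu)$ such that $\mathbb{E}^N[e^{t\|X\|}]<+\infty$ for some $t>0$. Let $T=\sup\{t>0:\mathbb{E}^N[e^{t\|X\|}]<+\infty\}$ and let $h^{-1}$ be the inverse of $h(s)=\int_{\mathbb{R}^{N^2}}\|u\|(e^{s\|u\|}-1)\nu(du)$, $0<s<T$. Let $\hat\mu_A^N$ be the empirical spectral measure of the associated random Hermitian matrix $\mathbf{X_A}$, $(\mathbf{X_A})_{i,j}=\frac1{\sqrt N}A_{i,j}\omega_{i,j}$, with $|A_{i,j}|\le a$. Then, for any probability measure $\mu$ on $\mathbb{R}$, $$\mathbb{P}^N\big(d_W(\hat\mu_A^N,\mu)-\mathbb{E}^N[d_W(\hat\mu_A^N,\mu)]\ge\delta\big)\le\exp\Big\{-\int_0^{\frac{N\delta}{\sqrt2 a}}h^{-1}(s)\,ds\Big\},$$ for all $0<\delta<\sqrt2 a\,h(T^-)/N$.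
   Context: Matrix model. $N\ge1$; $\mathbf{A}=(A_{i,j})_{1\le i,j\le N}$ is a non-random Hermitian matrix with $|A_{i,j}|\le a$ for all $i,j$, where $a>0$. The complex random variables $\omega_{i,j}=\omega_{i,j}^R+\sqrt{-1}\,\omega_{i,j}^I$ satisfy $\omega_{i,j}=\overline{\omega_{j,i}}$ and $\omega_{i,i}^I=0$. $\mathbf{X_A}$ is the $N\times N$ Hermitian matrix with entries $(\mathbf{X_A})_{i,j}=\frac1{\sqrt N}A_{i,j}\omega_{i,j}$. $X=(\omega_{i,i}^R,\omega_{i,j}^R,\omega_{i,j}^I)_{1\le i<j\le N}$ (with $1\le i\le N$ for $\omega_{i,i}^R$) is the vector in $\mathbb{R}^{N^2}$ of real parameters, $\mathbb{P}^N$ its law and $\mathbb{E}^N$ the expectation. $\|\cdot\|$ is the Euclidean norm. $\hat\mu_A^N=\frac1N\sum_{i=1}^N\delta_{\lambda_i}$, where $\lambda_1,\dots,\lambda_N$ are the eigenvalues of $\mathbf{X_A}$. $X\sim ID(\beta,0,\nu)$ in $\mathbb{R}^d$ means $\mathbb{E}e^{i\langle t,X\rangle}=\exp\{i\langle t,\beta\rangle+\int_{\mathbb{R}^d}(e^{i\langle t,u\rangle}-1-i\langle t,u\rangle\mathbf{1}_{\|u\|\le1})\nu(du)\}$, where $\beta\in\mathbb{R}^d$ and the Lévy measure $\nu\not\equiv0$ is a positive Borel measure without atom at the origin with $\int(1\wedge\|u\|^2)\nu(du)<\infty$. With $b>0$ fixed and $Lip_b(1)=\{f:\mathbb{R}\to\mathbb{R}:|f(x)-f(y)|\le|x-y|\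 \forall x,y,\ \|f\|_\infty\le b\}$, the Wasserstein distance between probability measures $\mu_1,\mu_2$ on $\mathbb{R}$ is here $d_W(\mu_1,\mu_2)=\sup_{f\in Lip_b(1)}\big|\int f\,d\mu_1-\int f\,d\mu_2\big|$. $h(T^-)$ is the left limit of $h$ at $T$. *)

theory Defs
  imports "HOL-Probability.Probability" "HOL-Computational_Algebra.Computational_Algebra"
begin

definition levy_measure :: "'a::euclidean_space measure \<Rightarrow> bool" where
  "levy_measure \<nu> \<longleftrightarrow>
     sets \<nu> = sets borel \<and> emeasure \<nu> (space \<nu>) \<noteq> 0 \<and> emeasure \<nu> {0} = 0 \<and>
     (\<integral>\<^sup>+ u. ennreal (min 1 ((norm u)\<^sup>2)) \<partial>\<nu>) < \<infinity>"

text \<open>A law without Gaussian component, the drift \<open>\<beta>\<close> being relative to the truncation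
  at the closed unit ball.\<close>

definition infinitely_divisible_law ::
  "'a::euclidean_space measure \<Rightarrow> 'a \<Rightarrow> 'a measure \<Rightarrow> bool" where
  "infinitely_divisible_law P \<beta> \<nu> \<longleftrightarrow>
     prob_space P \<and> sets P = sets borel \<and> levy_measure \<nu> \<and>
     (\<forall>t. (CLINT x|P. iexp (t \<bullet> x)) =
        exp (\<i> * complex_of_real (t \<bullet> \<beta>) +
             (CLINT u|\<nu>. iexp (t \<bullet> u) - 1
                - \<i> * complex_of_real (t \<bullet> u) * indicator (cball 0 1) u)))"

definition exp_moment_sup :: "'s measure \<Rightarrow> ('s \<Rightarrow> 'a::real_normed_vector) \<Rightarrow> ereal" where
  "exp_moment_sup M X = Sup {ereal t | t. t > 0 \<and> integrable M (\<lambda>w. exp (t * norm (X w)))}"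

text \<open>The values are meaningful for \<open>0 < s < T\<close>, where the integral converges.\<close>

definition levy_h :: "'a::euclidean_space measure \<Rightarrow> real \<Rightarrow> real" where
  "levy_h \<nu> s = (LINT u|\<nu>. norm u * (exp (s * norm u) - 1))"

definition levy_h_inv :: "'a::euclidean_space measure \<Rightarrow> ereal \<Rightarrow> real \<Rightarrow> real" where
  "levy_h_inv \<nu> T = inv_into {s. 0 < s \<and> ereal s < T} (levy_h \<nu>)"

text \<open>Both \<open>T\<close> and the left limit may be infinite, hence the limit is taken in \<open>ereal\<close>.\<close>

definition levy_h_left_limit :: "'a::euclidean_space measure \<Rightarrow> ereal \<Rightarrow> ereal" where
  "levy_h_left_limit \<nu> T = Lim (at_left T) (\<lambda>s. ereal (levy_h \<nu> (real_of_ereal s)))"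

definition Lip1 :: "real \<Rightarrow> (real \<Rightarrow> real) set" where
  "Lip1 b = {f. (\<forall>x y. \<bar>f x - f y\<bar> \<le> \<bar>x - y\<bar>) \<and> (\<forall>x. \<bar>f x\<bar> \<le> b)}"

definition wasserstein :: "real \<Rightarrow> real measure \<Rightarrow> real measure \<Rightarrow> real" where
  "wasserstein b \<mu>1 \<mu>2 = (SUP f\<in>Lip1 b. \<bar>(LINT x|\<mu>1. f x) - (LINT x|\<mu>2. f x)\<bar>)"

definition hermitian_matrix :: "complex ^ 'n ^ 'n \<Rightarrow> bool" where
  "hermitian_matrix A \<longleftrightarrow> (\<forall>i j. A $ i $ j = cnj (A $ j $ i))"

definition charpoly :: "complex ^ 'n ^ 'n \<Rightarrow> complex poly" where
  "charpoly A = det (mat [:0, 1:] - (\<chi> i j. [:A $ i $ j:]))"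

text \<open>With algebraic multiplicity.\<close>

definition eigenvalues :: "complex ^ 'n ^ 'n \<Rightarrow> complex multiset" where
  "eigenvalues A = proots (charpoly A)"

text \<open>The uniform distribution on the \<open>CARD('n)\<close> eigenvalues, counted with multiplicity,
  as a Borel measure on the line.  It is meant for Hermitian matrices, where \<open>Re\<close> only
  changes the type of the (real) eigenvalues.\<close>

definition empirical_spectral_measure :: "complex ^ 'n ^ 'n \<Rightarrow> real measure" where
  "empirical_spectral_measure A =
     distr (measure_pmf (pmf_of_multiset (eigenvalues A))) borel Re"

definition weighted_matrix ::
  "complex ^ 'n ^ 'n \<Rightarrow> ('n \<Rightarrow> 'n \<Rightarrow> complex) \<Rightarrow> complex ^ 'n ^ 'n" where
  "weighted_matrix A z =
     (\<chi> i j. complex_of_real (1 / sqrt (real CARD('n))) * A $ i $ j * z i j)"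

text \<open>The real parameters of a Hermitian family of entries.  The coordinate \<open>(i, j)\<close> holds
  the real part of the entry \<open>(i, j)\<close> if \<open>i \<le> j\<close>, and the imaginary part of the
  entry \<open>(j, i)\<close> above the diagonal if \<open>j < i\<close>; this indexes the
  \<open>CARD('n)\<^sup>2\<close> parameters without repetition.\<close>

definition real_params ::
  "('n::{finite,linorder} \<Rightarrow> 'n \<Rightarrow> complex) \<Rightarrow> real ^ ('n \<times> 'n)" where
  "real_params z = (\<chi> p. case p of (i, j) \<Rightarrow> if i \<le> j then Re (z i j) else Im (z j i))"

end

theory Submission
  imports Defs
begin

text \<open>The distance, as a function of the parameter vector, is Lipschitz with constant
  \<open>sqrt 2 * a / N\<close>: the squared overlaps of two orthonormal eigenbases form a coupling of the two
  spectral measures, whose quadratic cost is the squared Frobenius distance divided by \<open>N\<close>.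

  For bounded 1-Lipschitz \<open>G\<close> and \<open>X\<close> infinitely divisible,
  \<open>E exp (s (G X - E G X)) \<le> exp (\<integral> exp (s \<parallel>u\<parallel>) - 1 - s \<parallel>u\<parallel> d\<nu>)\<close>. Instead of a covariance
  representation, the bound is checked for a single variable that vanishes with probability
  \<open>1 - p\<close>, where it is just \<open>1 + x \<le> exp x\<close>; it is stable under convolution (the exponents add),
  and it passes to weak limits, hence to \<open>X\<close>, which is a limit of sums of such variables.
  The exponential moments of \<open>\<nu>\<close> come from those of \<open>X\<close> by isolating one big jump in the same sums.
  Chernoff's bound and the Legendre transform of the exponent, a primitive of the inverse of \<open>h\<close>,
  conclude.\<close>

subsection \<open>Spectral measures of Hermitian matrices\<close>

text \<open>The Laplace bound is stated for all bounded 1-Lipschitz \<open>G\<close> at once: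
  averaging such a function over one summand of a convolution yields such a function again, and this
  is what makes the bound stable under convolution. Weak limits preserve it because
  \<open>exp (s * G x)\<close> is itself bounded and Lipschitz in \<open>x\<close>.

  Exponential moments are assumed of \<open>X\<close> but needed for \<open>\<nu>\<close>. Since
  \<open>\<nu>\<close> may have infinite mass near the origin, only jumps of norm above 1 / (n + 1)
  are kept, and the mean of those of norm at most 1 is subtracted from the drift. Jumps of norm
  above 1 form a separate factor: that none occurs has a probability bounded below uniformly in
  \<open>n\<close>, and a single one contributes a fixed multiple of a
  \<open>\<nu>\<close>-integral.

  In the Lipschitz constant, sqrt 2 appears because an off-diagonal parameter enters two matrix
  entries; one factor 1 / sqrt N is the scaling of the matrix, the other comes from Cauchy-Schwarz
  for the coupling.\<close>

lemma selfadjoint_eigenvector_exists: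
  fixes f :: "'a::euclidean_space \<Rightarrow> 'a"
  assumes f: "linear f" and adj: "\<And>x y. f x \<bullet> y = x \<bullet> f y"
    and W: "subspace W" and fW: "\<And>x. x \<in> W \<Longrightarrow> f x \<in> W" and ne: "w \<in> W" "w \<noteq> 0"
  obtains x l where "x \<in> W" "norm x = 1" "f x = l *\<^sub>R x"
proof -
  have "compact (W \<inter> sphere 0 1)"
    by (intro closed_Int_compact closed_subspace W compact_sphere)
  moreover have "(1 / norm w) *\<^sub>R w \<in> W \<inter> sphere 0 1"
    using ne W by (auto simp: subspace_scale)
  moreover have "continuous_on (W \<inter> sphere 0 1) (\<lambda>x. f x \<bullet> x)"
    by (intro continuous_intros linear_continuous_on linear_conv_bounded_linear[THEN iffD1] f)
  ultimately obtain x where x: "x \<in> W" "norm x = 1"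
    and max: "\<And>y. y \<in> W \<Longrightarrow> norm y = 1 \<Longrightarrow> f y \<bullet> y \<le> f x \<bullet> x"
    using continuous_attains_sup[of "W \<inter> sphere 0 1" "\<lambda>x. f x \<bullet> x"] by fastforce
  define l where "l = f x \<bullet> x"
  have max': "f y \<bullet> y \<le> l * (norm y)\<^sup>2" if "y \<in> W" for y
  proof (cases "y = 0")
    case False
    have "f ((1 / norm y) *\<^sub>R y) \<bullet> ((1 / norm y) *\<^sub>R y) \<le> l"
      unfolding l_def using False that W by (intro max) (auto simp: subspace_scale)
    then show ?thesis using False
      by (simp add: linear_cmul[OF f] field_simps power2_eq_square)
  qed (simp add: linear_0[OF f])
  \<comment> \<open>The residual of the eigenvector equation. It lies in \<open>W\<close> and is
    orthogonal to \<open>x\<close>, so it is an admissible direction for testing the maximality of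
    \<open>x\<close>.\<close>
  define y where "y = f x - l *\<^sub>R x"
  have yW: "y \<in> W" unfolding y_def using x fW W by (auto intro: subspace_diff subspace_scale)
  have xx: "x \<bullet> x = 1" using x by (simp add: norm_eq_1)
  have xy: "x \<bullet> y = 0" by (simp add: y_def inner_diff_right l_def xx inner_commute)
  have fxy: "f x \<bullet> y = (norm y)\<^sup>2"
  proof -
    have "f x \<bullet> y = (y + l *\<^sub>R x) \<bullet> y" by (simp add: y_def)
    then show ?thesis by (simp add: inner_add_left xy power2_norm_eq_inner)
  qed
  \<comment> \<open>Along \<open>x + t *\<^sub>R y\<close> the quadratic form gains
    \<open>2 * t * (norm y)\<^sup>2\<close> while every other change is of order t squared, so
    maximality leaves no room for a nonzero residual.\<close>
  have ineq: "2 * t * (norm y)\<^sup>2 \<le> t\<^sup>2 * (l * (norm y)\<^sup>2 - f y \<bullet> y)" for t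
  proof -
    have "f (x + t *\<^sub>R y) \<bullet> (x + t *\<^sub>R y) \<le> l * (norm (x + t *\<^sub>R y))\<^sup>2"
      using x yW W by (intro max') (auto intro: subspace_add subspace_scale)
    moreover have "f (x + t *\<^sub>R y) \<bullet> (x + t *\<^sub>R y) = l + 2 * t * (norm y)\<^sup>2 + t\<^sup>2 * (f y \<bullet> y)"
      using adj[of y x] fxy inner_commute[of y "f x"] l_def
      by (simp add: linear_add[OF f] linear_cmul[OF f] inner_add_left inner_add_right power2_eq_square
          distrib_left mult.assoc)
    moreover have "(norm (x + t *\<^sub>R y))\<^sup>2 = 1 + t\<^sup>2 * (norm y)\<^sup>2"
      unfolding power2_norm_eq_inner
      by (simp add: inner_add_left inner_add_right xx xy inner_commute[of y x] power2_eq_square)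
    ultimately show ?thesis by (simp add: algebra_simps)
  qed
  have "y = 0"
  proof (rule ccontr)
    assume "y \<noteq> 0"
    then have pos: "(norm y)\<^sup>2 > 0" by simp
    \<comment> \<open>\<open>c\<close> bounds the quadratic coefficient, and the added 1 keeps it
      positive; \<open>t\<close> is chosen so that \<open>t * c\<close> is the squared norm of the
      residual.\<close>
    define c where "c = \<bar>l * (norm y)\<^sup>2 - f y \<bullet> y\<bar> + 1"
    have c: "c > 0" by (simp add: c_def)
    define t where "t = (norm y)\<^sup>2 / c"
    have t: "t > 0" using pos c by (simp add: t_def)
    have "2 * t * (norm y)\<^sup>2 \<le> t\<^sup>2 * c"
      by (rule order_trans[OF ineq[of t] mult_left_mono]) (auto simp: c_def)
    also have "\<dots> = t * (norm y)\<^sup>2" using c by (simp add: t_def power2_eq_square)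
    finally show False using t pos by simp
  qed
  then show ?thesis using that[of x l] x by (simp add: y_def)
qed

section \<open>Complex inner product and orthonormal eigenvectors\<close>

definition cinner :: "complex ^ 'n \<Rightarrow> complex ^ 'n \<Rightarrow> complex" where
  "cinner x y = (\<Sum>k\<in>UNIV. x $ k * cnj (y $ k))"

lemma inner_eq_Re_cinner: "x \<bullet> y = Re (cinner x y)"
  by (simp add: cinner_def inner_vec_def inner_complex_def)

lemma cinner_commute: "cinner x y = cnj (cinner y x)"
  by (simp add: cinner_def mult.commute)

text \<open>Complex orthogonality to \<open>y\<close> is thus real orthogonality to both
  \<open>y\<close> and \<open>\<i> *s y\<close>, so that real subspace theory applies.\<close>

lemma cinner_eq_inner: "cinner x y = Complex (x \<bullet> y) (x \<bullet> (\<i> *s y))"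
  by (simp add: complex_eq_iff cinner_def inner_vec_def inner_complex_def algebra_simps)

lemma cinner_scaleR_left: "cinner (r *\<^sub>R x) y = of_real r * cinner x y"
  unfolding cinner_def sum_distrib_left by (intro sum.cong) (simp_all add: scaleR_conv_of_real[where 'a = complex])

lemma cinner_scaleR_right: "cinner x (r *\<^sub>R y) = of_real r * cinner x y"
  unfolding cinner_def sum_distrib_left by (intro sum.cong) (simp_all add: scaleR_conv_of_real[where 'a = complex])

lemma cinner_add_left: "cinner (x + y) z = cinner x z + cinner y z"
  by (simp add: cinner_def algebra_simps sum.distrib)

lemma cinner_self: "cinner x x = of_real ((norm x)\<^sup>2)"
proof -
  have "(norm x)\<^sup>2 = (\<Sum>k\<in>UNIV. (cmod (x $ k))\<^sup>2)"
    by (simp add: norm_vec_def L2_set_def sum_nonneg)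
  then show ?thesis by (simp only: cinner_def complex_norm_square of_real_sum)
qed

lemma hermitian_cinner:
  assumes "hermitian_matrix A"
  shows "cinner (A *v x) y = cinner x (A *v y)"
proof -
  have A: "A $ k $ j * x $ j * cnj (y $ k) = x $ j * cnj (A $ j $ k * y $ k)" for k j
    using assms[unfolded hermitian_matrix_def, rule_format, of k j] by simp
  have "cinner (A *v x) y = (\<Sum>k\<in>UNIV. \<Sum>j\<in>UNIV. A $ k $ j * x $ j * cnj (y $ k))"
    by (simp add: cinner_def matrix_vector_mult_def sum_distrib_right)
  also have "\<dots> = (\<Sum>j\<in>UNIV. \<Sum>k\<in>UNIV. A $ k $ j * x $ j * cnj (y $ k))" by (rule sum.swap)
  also have "\<dots> = (\<Sum>j\<in>UNIV. \<Sum>k\<in>UNIV. x $ j * cnj (A $ j $ k * y $ k))"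
    by (simp only: A)
  also have "\<dots> = cinner x (A *v y)"
    by (simp add: cinner_def matrix_vector_mult_def sum_distrib_left)
  finally show ?thesis .
qed

text \<open>Induction adds one index at a time: the complex orthogonal complement of the
  eigenvectors found so far is invariant because \<open>A\<close> is Hermitian, so it contains a
  further eigenvector. At \<open>S = UNIV\<close> the vectors are the columns of a unitary
  matrix.\<close>

lemma hermitian_orthonormal_eigenvectors:
  fixes A :: "complex ^ 'n ^ 'n" and S :: "'n set"
  assumes A: "hermitian_matrix A"
  shows "\<exists>u d. (\<forall>i\<in>S. A *v u i = (d i :: real) *\<^sub>R u i) \<and>
    (\<forall>i\<in>S. \<forall>j\<in>S. cinner (u i) (u j) = (if i = j then 1 else 0))"
proof -
  have "finite S" by simp
  then show ?thesis
  proof (induction S rule: finite_induct)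
    case (insert k S)
    then obtain u d where e: "\<And>i. i \<in> S \<Longrightarrow> A *v u i = (d i :: real) *\<^sub>R u i"
      and o: "\<And>i j. i \<in> S \<Longrightarrow> j \<in> S \<Longrightarrow> cinner (u i) (u j) = (if i = j then 1 else 0)" by blast
    define W where "W = {x. \<forall>i\<in>S. cinner x (u i) = 0}"
    \<comment> \<open>The complement is cut out by at most \<open>2 * card S\<close> real equations
      in a space of real dimension \<open>2 * CARD('n)\<close>, so it contains a nonzero vector as
      long as an index is left.\<close>
    define B where "B = u ` S \<union> (\<lambda>i. \<i> *s u i) ` S"
    have "card B \<le> 2 * card S" unfolding B_def
      using card_Un_le[of "u ` S" "(\<lambda>i. \<i> *s u i) ` S"] card_image_le[OF insert(1), of u]
        card_image_le[OF insert(1), of "\<lambda>i. \<i> *s u i"] by linarith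
    moreover have "card S < CARD('n)" using insert(1,2) by (intro psubset_card_mono) auto
    moreover have "finite B" using insert(1) by (simp add: B_def)
    ultimately have "dim B < DIM(complex ^ 'n)" using dim_le_card'[of B] by simp
    from orthogonal_to_subspace_exists[OF this] obtain w
      where w: "w \<noteq> 0" "\<And>y. y \<in> span B \<Longrightarrow> orthogonal w y" by blast
    have "w \<in> W"
      using w(2) by (auto simp: W_def cinner_eq_inner B_def orthogonal_def span_base Complex_eq_0)
    have "subspace W"
      by (auto simp: subspace_def W_def cinner_add_left cinner_scaleR_left) (simp add: cinner_def)
    have AW: "A *v x \<in> W" if "x \<in> W" for x
      using that e by (auto simp: W_def hermitian_cinner[OF A] cinner_scaleR_right)
    have inn: "(A *v x) \<bullet> y = x \<bullet> (A *v y)" for x y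
      by (simp add: inner_eq_Re_cinner hermitian_cinner[OF A])
    have lin: "linear ((*v) A)" by (simp add: linear_conv_bounded_linear matrix_vector_mul_bounded_linear)
    from selfadjoint_eigenvector_exists[OF lin inn \<open>subspace W\<close> AW \<open>w \<in> W\<close> w(1)]
    obtain x l where x: "x \<in> W" "norm x = 1" "A *v x = l *\<^sub>R x" by blast
    have x0: "cinner x (u i) = 0" "cinner (u i) x = 0" if "i \<in> S" for i
      using x(1) that cinner_commute[of "u i" x] by (auto simp: W_def)
    have "cinner x x = 1" by (simp add: cinner_self x)
    then have "(\<forall>i\<in>insert k S. A *v (u(k := x)) i = (d(k := l)) i *\<^sub>R (u(k := x)) i) \<and>
      (\<forall>i\<in>insert k S. \<forall>j\<in>insert k S.
        cinner ((u(k := x)) i) ((u(k := x)) j) = (if i = j then 1 else 0))"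
      using e o x(3) x0 insert(2) by simp
    then show ?case by blast
  qed simp
qed

definition adjoint_matrix :: "complex ^ 'n ^ 'm \<Rightarrow> complex ^ 'm ^ 'n" where
  "adjoint_matrix A = (\<chi> i j. cnj (A $ j $ i))"

definition unitary_matrix :: "complex ^ 'n ^ 'n \<Rightarrow> bool" where
  "unitary_matrix U \<longleftrightarrow> U ** adjoint_matrix U = mat 1"

lemma unitary_matrix_adjoint: "unitary_matrix U \<longleftrightarrow> adjoint_matrix U ** U = mat 1"
  unfolding unitary_matrix_def by (rule matrix_left_right_inverse)

definition diag_matrix :: "('n \<Rightarrow> 'a::zero) \<Rightarrow> 'a ^ 'n ^ 'n" where
  "diag_matrix d = (\<chi> i j. if i = j then d i else 0)"

theorem hermitian_diagonalization:
  fixes A :: "complex ^ 'n ^ 'n"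
  assumes A: "hermitian_matrix A"
  obtains U and d :: "'n \<Rightarrow> real"
  where "unitary_matrix U" "A ** U = U ** diag_matrix (\<lambda>i. of_real (d i))"
proof -
  obtain u and d :: "'n \<Rightarrow> real" where e: "\<And>i. A *v u i = d i *\<^sub>R u i"
      and o: "\<And>i j. cinner (u i) (u j) = (if i = j then 1 else 0)"
    using hermitian_orthonormal_eigenvectors[OF A, of UNIV] by blast
  define U :: "complex ^ 'n ^ 'n" where "U = (\<chi> k i. u i $ k)"
  have "(adjoint_matrix U ** U) $ i $ j = cinner (u j) (u i)" for i j
    by (simp add: matrix_matrix_mult_def adjoint_matrix_def U_def cinner_def mult.commute)
  then have "adjoint_matrix U ** U = mat 1"
    by (simp add: vec_eq_iff o mat_def)
  then have "unitary_matrix U" by (simp add: unitary_matrix_adjoint)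
  moreover have "A ** U = U ** diag_matrix (\<lambda>i. of_real (d i))"
  proof -
    have "(A ** U) $ k $ i = (U ** diag_matrix (\<lambda>i. of_real (d i))) $ k $ i" for k i
    proof -
      have "(A ** U) $ k $ i = (A *v u i) $ k"
        by (simp add: matrix_matrix_mult_def matrix_vector_mult_def U_def)
      also have "\<dots> = u i $ k * of_real (d i)" by (simp add: e scaleR_conv_of_real[where 'a = complex])
      finally show ?thesis
        by (simp add: matrix_matrix_mult_def diag_matrix_def U_def if_distrib cong: if_cong)
    qed
    then show ?thesis by (simp add: vec_eq_iff)
  qed
  ultimately show ?thesis using that by blast
qed

section \<open>Characteristic polynomial and spectral measure from a diagonalization\<close>

definition const_poly_matrix :: "complex ^ 'n ^ 'n \<Rightarrow> complex poly ^ 'n ^ 'n" where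
  "const_poly_matrix A = (\<chi> i j. [:A $ i $ j:])"

lemma const_poly_matrix_mult: "const_poly_matrix (A ** B) = const_poly_matrix A ** const_poly_matrix B"
proof -
  have sum: "(\<Sum>k\<in>S. [:h k :: complex:]) = [:\<Sum>k\<in>S. h k:]" for h and S :: "'n set"
    by (induction S rule: infinite_finite_induct) auto
  have "[:f * g:] = [:f:] * [:g:]" for f g :: complex by simp
  then show ?thesis
    by (simp only: vec_eq_iff const_poly_matrix_def matrix_matrix_mult_def vec_lambda_beta sum[symmetric]) simp
qed

text \<open>Over the polynomial ring, \<open>U\<close> conjugates \<open>?x - ?P A\<close> into a
  diagonal matrix. The determinant of \<open>U\<close> cancels, being nonzero: its product with that
  of the adjoint is 1.\<close>

lemma charpoly_diagonalization:
  fixes A :: "complex ^ 'n ^ 'n"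
  assumes U: "unitary_matrix U" and AU: "A ** U = U ** diag_matrix d"
  shows "charpoly A = (\<Prod>i\<in>UNIV. [:- d i, 1:])"
proof -
  let ?P = const_poly_matrix and ?x = "mat [:0, 1:] :: complex poly ^ 'n ^ 'n"
  have P1: "?P (mat 1) = mat 1" by (simp add: vec_eq_iff const_poly_matrix_def mat_def)
  have comm: "?x ** ?P U = ?P U ** ?x"
    by (simp add: vec_eq_iff matrix_matrix_mult_def mat_def if_distrib if_distribR mult.commute cong: if_cong)
  have ldistrib: "M ** (N - N') = M ** N - M ** N'"
    and rdistrib: "(N - N') ** M = N ** M - N' ** M" for M N N' :: "complex poly ^ 'n ^ 'n"
    by (simp_all add: vec_eq_iff matrix_matrix_mult_def algebra_simps sum_subtractf)
  have "(?x - ?P A) ** ?P U = ?P U ** (?x - ?P (diag_matrix d))"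
    by (simp add: ldistrib rdistrib comm const_poly_matrix_mult[symmetric] AU)
  then have "det (?x - ?P A) * det (?P U) = det (?P U) * det (?x - ?P (diag_matrix d))"
    by (metis det_mul)
  moreover have "det (?P U) * det (?P (adjoint_matrix U)) = 1"
    using U by (simp add: det_mul[symmetric] const_poly_matrix_mult[symmetric] unitary_matrix_def P1)
  then have "det (?P U) \<noteq> 0" by auto
  ultimately have "det (?x - ?P A) = det (?x - ?P (diag_matrix d))" by simp
  also have "\<dots> = (\<Prod>i\<in>UNIV. (?x - ?P (diag_matrix d)) $ i $ i)"
    by (rule det_diagonal) (simp add: mat_def const_poly_matrix_def diag_matrix_def)
  also have "\<dots> = (\<Prod>i\<in>UNIV. [:- d i, 1:])"
    by (simp add: mat_def const_poly_matrix_def diag_matrix_def)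
  finally show ?thesis by (simp add: charpoly_def const_poly_matrix_def)
qed

lemma eigenvalues_diagonalization:
  fixes A :: "complex ^ 'n ^ 'n"
  assumes "unitary_matrix U" and "A ** U = U ** diag_matrix d"
  shows "eigenvalues A = image_mset d (mset_set UNIV)"
proof -
  have "proots (\<Prod>i\<in>S. [:- d i, 1:]) = image_mset d (mset_set S)" if "finite S" for S :: "'n set"
    using that
  proof (induction S rule: finite_induct)
    case (insert x F)
    have "(\<Prod>i\<in>F. [:- d i, 1:]) \<noteq> 0" using insert by (simp add: prod_zero_iff)
    then show ?case using insert by (simp add: proots_mult del: mult_pCons_left mult_pCons_right)
  qed simp
  then show ?thesis by (simp add: eigenvalues_def charpoly_diagonalization[OF assms])
qed

text \<open>Indexing the eigenvalues by \<open>'n\<close> instead of a multiset lets two spectra be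
  coupled through a matrix of weights.\<close>

lemma empirical_spectral_measure_eq:
  fixes A :: "complex ^ 'n ^ 'n" and d :: "'n \<Rightarrow> real"
  assumes "unitary_matrix U" and "A ** U = U ** diag_matrix (\<lambda>i. of_real (d i))"
  shows "empirical_spectral_measure A = distr (measure_pmf (pmf_of_set UNIV)) borel d"
proof -
  have e: "eigenvalues A = image_mset (\<lambda>i. of_real (d i)) (mset_set UNIV)"
    by (rule eigenvalues_diagonalization[OF assms])
  then have ne: "eigenvalues A \<noteq> {#}" by (simp add: mset_set_empty_iff)
  have "pmf_of_multiset (eigenvalues A) = map_pmf (\<lambda>i. of_real (d i)) (pmf_of_set UNIV)"
  proof (rule pmf_eqI)
    fix x
    show "pmf (pmf_of_multiset (eigenvalues A)) x = pmf (map_pmf (\<lambda>i. of_real (d i)) (pmf_of_set UNIV)) x"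
      by (subst pmf_of_multiset[OF ne])
        (simp add: pmf_map measure_pmf_of_set e count_image_mset vimage_def)
  qed
  then show ?thesis
    by (simp add: empirical_spectral_measure_def map_pmf_rep_eq distr_distr comp_def)
qed

lemma integral_empirical_spectral_measure:
  fixes A :: "complex ^ 'n ^ 'n" and d :: "'n \<Rightarrow> real" and f :: "real \<Rightarrow> real"
  assumes "unitary_matrix U" and "A ** U = U ** diag_matrix (\<lambda>i. of_real (d i))"
    and f: "f \<in> borel_measurable borel"
  shows "(LINT x|empirical_spectral_measure A. f x) = (\<Sum>i\<in>UNIV. f (d i)) / CARD('n)"
  unfolding empirical_spectral_measure_eq[OF assms(1,2)]
  by (subst integral_distr) (auto simp: f integral_pmf_of_set)

section \<open>Unitary invariance of the Frobenius norm\<close>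

lemma adjoint_matrix_mult: "adjoint_matrix (A ** B) = adjoint_matrix B ** adjoint_matrix A"
  by (simp add: vec_eq_iff adjoint_matrix_def matrix_matrix_mult_def mult.commute)

lemma adjoint_matrix_adjoint [simp]: "adjoint_matrix (adjoint_matrix A) = A"
  by (simp add: vec_eq_iff adjoint_matrix_def)

lemma norm_matrix_power2:
  fixes A :: "complex ^ 'n ^ 'm"
  shows "(norm A)\<^sup>2 = (\<Sum>i\<in>UNIV. \<Sum>j\<in>UNIV. (cmod (A $ i $ j))\<^sup>2)"
  by (simp add: norm_vec_def L2_set_def sum_nonneg)

lemma norm_adjoint_matrix: "norm (adjoint_matrix A) = norm A"
proof -
  have "(norm (adjoint_matrix A))\<^sup>2 = (norm A)\<^sup>2"
    unfolding norm_matrix_power2 by (subst sum.swap) (simp add: adjoint_matrix_def)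
  then show ?thesis by simp
qed

lemma unitary_matrix_row:
  fixes U :: "complex ^ 'n ^ 'n"
  assumes "unitary_matrix U"
  shows "(\<Sum>j\<in>UNIV. U $ k $ j * cnj (U $ l $ j)) = (if k = l then 1 else 0)"
proof -
  have "(U ** adjoint_matrix U) $ k $ l = (mat 1 :: complex ^ 'n ^ 'n) $ k $ l"
    using assms by (simp add: unitary_matrix_def)
  then show ?thesis by (simp add: matrix_matrix_mult_def adjoint_matrix_def mat_def)
qed

lemma unitary_matrix_adjointI: "unitary_matrix U \<Longrightarrow> unitary_matrix (adjoint_matrix U)"
  by (subst unitary_matrix_adjoint) (simp add: unitary_matrix_def)

lemma unitary_matrix_mult: "unitary_matrix U \<Longrightarrow> unitary_matrix V \<Longrightarrow> unitary_matrix (U ** V)"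
  unfolding unitary_matrix_def adjoint_matrix_mult by (metis matrix_mul_assoc matrix_mul_rid)

text \<open>Each row of \<open>M\<close> keeps its Euclidean length under right multiplication by
  \<open>U\<close>: exchanging sums brings out the inner products of the rows of \<open>U\<close>.
  The norm of nested vectors is the Frobenius norm.\<close>

lemma norm_mult_unitary:
  fixes U M :: "complex ^ 'n ^ 'n"
  assumes U: "unitary_matrix U"
  shows "norm (M ** U) = norm M"
proof -
  have "(\<Sum>j\<in>UNIV. (cmod ((M ** U) $ i $ j))\<^sup>2) = (\<Sum>j\<in>UNIV. (cmod (M $ i $ j))\<^sup>2)" for i
  proof -
    have "complex_of_real (\<Sum>j\<in>UNIV. (cmod ((M ** U) $ i $ j))\<^sup>2) =
        (\<Sum>j\<in>UNIV. (\<Sum>k\<in>UNIV. M $ i $ k * U $ k $ j) * (\<Sum>l\<in>UNIV. cnj (M $ i $ l * U $ l $ j)))"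
      by (simp only: of_real_sum complex_norm_square matrix_matrix_mult_def vec_lambda_beta cnj_sum)
    also have "\<dots> = (\<Sum>j\<in>UNIV. \<Sum>k\<in>UNIV. \<Sum>l\<in>UNIV. M $ i $ k * cnj (M $ i $ l) * (U $ k $ j * cnj (U $ l $ j)))"
      by (simp add: sum_product mult_ac)
    also have "\<dots> = (\<Sum>k\<in>UNIV. \<Sum>j\<in>UNIV. \<Sum>l\<in>UNIV. M $ i $ k * cnj (M $ i $ l) * (U $ k $ j * cnj (U $ l $ j)))"
      by (rule sum.swap)
    also have "\<dots> = (\<Sum>k\<in>UNIV. \<Sum>l\<in>UNIV. \<Sum>j\<in>UNIV. M $ i $ k * cnj (M $ i $ l) * (U $ k $ j * cnj (U $ l $ j)))"
      by (intro sum.cong refl sum.swap)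
    also have "\<dots> = (\<Sum>k\<in>UNIV. \<Sum>l\<in>UNIV. M $ i $ k * cnj (M $ i $ l) * (if k = l then 1 else 0))"
      by (simp only: sum_distrib_left[symmetric] unitary_matrix_row[OF U])
    also have "\<dots> = (\<Sum>k\<in>UNIV. M $ i $ k * cnj (M $ i $ k))"
      by (simp add: if_distrib cong: if_cong)
    also have "\<dots> = complex_of_real (\<Sum>j\<in>UNIV. (cmod (M $ i $ j))\<^sup>2)"
      by (simp only: of_real_sum complex_norm_square)
    finally show ?thesis by (simp only: of_real_eq_iff)
  qed
  then have "(norm (M ** U))\<^sup>2 = (norm M)\<^sup>2" by (simp add: norm_matrix_power2)
  then show ?thesis by simp
qed

lemma norm_unitary_mult:
  fixes U M :: "complex ^ 'n ^ 'n"
  assumes "unitary_matrix U"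
  shows "norm (U ** M) = norm M"
  using norm_mult_unitary[OF unitary_matrix_adjointI[OF assms], of "adjoint_matrix M"]
  by (simp add: adjoint_matrix_mult[symmetric] norm_adjoint_matrix)

text \<open>The squared moduli of the overlaps of two orthonormal eigenbases couple the two spectral
  measures; this replaces the permutation in the Hoffman--Wielandt inequality.\<close>

lemma empirical_spectral_measure_lipschitz:
  fixes A B :: "complex ^ 'n ^ 'n" and f :: "real \<Rightarrow> real"
  assumes A: "hermitian_matrix A" and B: "hermitian_matrix B"
    and f: "\<And>x y. \<bar>f x - f y\<bar> \<le> \<bar>x - y\<bar>"
  shows "\<bar>(LINT x|empirical_spectral_measure A. f x) - (LINT x|empirical_spectral_measure B. f x)\<bar>
    \<le> norm (A - B) / sqrt CARD('n)"
proof -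
  obtain U and d :: "'n \<Rightarrow> real" where U: "unitary_matrix U" "A ** U = U ** diag_matrix (\<lambda>i. of_real (d i))"
    using hermitian_diagonalization[OF A] by blast
  obtain V and e :: "'n \<Rightarrow> real" where V: "unitary_matrix V" "B ** V = V ** diag_matrix (\<lambda>i. of_real (e i))"
    using hermitian_diagonalization[OF B] by blast
  let ?D = "diag_matrix (\<lambda>i. of_real (d i)) :: complex ^ 'n ^ 'n"
  let ?E = "diag_matrix (\<lambda>i. of_real (e i)) :: complex ^ 'n ^ 'n"
  have "continuous_on UNIV f"
    by (rule lipschitz_on_continuous_on[of 1]) (auto simp: lipschitz_on_def dist_real_def f)
  then have fm: "f \<in> borel_measurable borel" by (rule borel_measurable_continuous_onI)
  define W where "W = adjoint_matrix U ** V"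
  have W: "unitary_matrix W" unfolding W_def by (intro unitary_matrix_mult unitary_matrix_adjointI U V)
  \<comment> \<open>Rows and columns sum to 1, so \<open>p\<close> divided by
    \<open>CARD('n)\<close> is a coupling of the two spectral measures.\<close>
  define p where "p i j = (cmod (W $ i $ j))\<^sup>2" for i j
  have row: "(\<Sum>j\<in>UNIV. p i j) = 1" for i
  proof -
    have "complex_of_real (\<Sum>j\<in>UNIV. p i j) = 1"
      using unitary_matrix_row[OF W, of i i] by (simp only: p_def of_real_sum complex_norm_square) simp
    then show ?thesis by (simp only: of_real_eq_1_iff)
  qed
  have col: "(\<Sum>i\<in>UNIV. p i j) = 1" for j
  proof -
    have "complex_of_real (\<Sum>i\<in>UNIV. p i j) = 1"
      using unitary_matrix_row[OF unitary_matrix_adjointI[OF W], of j j]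
      by (simp only: p_def of_real_sum complex_norm_square) (simp add: adjoint_matrix_def mult.commute)
    then show ?thesis by (simp only: of_real_eq_1_iff)
  qed
  have ldistrib: "M ** (N - N') = M ** N - M ** N'"
    and rdistrib: "(N - N') ** M = N ** M - N' ** M" for M N N' :: "complex ^ 'n ^ 'n"
    by (simp_all add: vec_eq_iff matrix_matrix_mult_def algebra_simps sum_subtractf)
  have "adjoint_matrix U ** A = adjoint_matrix U ** (A ** U) ** adjoint_matrix U"
    using U(1) by (simp add: unitary_matrix_def matrix_mul_assoc[symmetric])
  also have "\<dots> = ?D ** adjoint_matrix U"
    using U(1) by (simp add: U(2) unitary_matrix_adjoint matrix_mul_assoc)
  finally have UA: "adjoint_matrix U ** A = ?D ** adjoint_matrix U" .
  have "adjoint_matrix U ** (A - B) ** V = (adjoint_matrix U ** A) ** V - adjoint_matrix U ** (B ** V)"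
    by (simp add: ldistrib rdistrib matrix_mul_assoc)
  also have "\<dots> = ?D ** W - W ** ?E"
    by (simp add: UA V(2) W_def matrix_mul_assoc)
  finally have "norm (?D ** W - W ** ?E) = norm (adjoint_matrix U ** (A - B) ** V)" by simp
  also have "norm (adjoint_matrix U ** (A - B) ** V) = norm (A - B)"
    by (simp add: norm_mult_unitary norm_unitary_mult unitary_matrix_adjointI U V)
  finally have nrm: "(norm (A - B))\<^sup>2 = (norm (?D ** W - W ** ?E))\<^sup>2" by simp
  \<comment> \<open>Hence the squared Frobenius distance is the sum of
    \<open>p i j * (d i - e j)\<^sup>2\<close>, the quadratic cost of the coupling up to
    normalization.\<close>
  have entry: "(?D ** W - W ** ?E) $ i $ j = of_real (d i - e j) * W $ i $ j" for i j
    by (simp add: matrix_matrix_mult_def diag_matrix_def if_distrib if_distribR algebra_simps cong: if_cong)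
  have nAB: "(norm (A - B))\<^sup>2 = (\<Sum>i\<in>UNIV. \<Sum>j\<in>UNIV. (\<bar>d i - e j\<bar> * cmod (W $ i $ j))\<^sup>2)"
    unfolding nrm by (simp only: norm_matrix_power2 entry norm_mult norm_of_real)
  have sumA: "(\<Sum>i\<in>UNIV. f (d i)) = (\<Sum>i\<in>UNIV. \<Sum>j\<in>UNIV. p i j * f (d i))"
    by (simp add: sum_distrib_right[symmetric] row)
  have sumB: "(\<Sum>j\<in>UNIV. f (e j)) = (\<Sum>i\<in>UNIV. \<Sum>j\<in>UNIV. p i j * f (e j))"
    by (subst sum.swap) (simp add: sum_distrib_right[symmetric] col)
  have "\<bar>(\<Sum>i\<in>UNIV. f (d i)) - (\<Sum>j\<in>UNIV. f (e j))\<bar>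
      = \<bar>\<Sum>i\<in>UNIV. \<Sum>j\<in>UNIV. p i j * (f (d i) - f (e j))\<bar>"
    by (simp add: sumA sumB sum_subtractf right_diff_distrib)
  also have "\<dots> \<le> (\<Sum>i\<in>UNIV. \<Sum>j\<in>UNIV. p i j * \<bar>d i - e j\<bar>)"
    by (intro order_trans[OF sum_abs] sum_mono) (auto simp: abs_mult p_def intro!: mult_left_mono f)
  \<comment> \<open>Splitting \<open>p i j\<close> into two equal factors prepares Cauchy-Schwarz:
    one has norm \<open>sqrt CARD('n)\<close> because the rows sum to 1, the other carries the
    cost.\<close>
  also have "\<dots> = (\<Sum>(i, j)\<in>UNIV. \<bar>cmod (W $ i $ j)\<bar> * \<bar>\<bar>d i - e j\<bar> * cmod (W $ i $ j)\<bar>)"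
    by (simp add: sum.cartesian_product p_def power2_eq_square mult_ac abs_mult)
  also have "\<dots> \<le> L2_set (\<lambda>(i, j). cmod (W $ i $ j)) UNIV *
      L2_set (\<lambda>(i, j). \<bar>d i - e j\<bar> * cmod (W $ i $ j)) UNIV"
    using L2_set_mult_ineq[of "\<lambda>(i, j). cmod (W $ i $ j)" "\<lambda>(i, j). \<bar>d i - e j\<bar> * cmod (W $ i $ j)" UNIV]
    by (simp add: case_prod_unfold)
  also have "L2_set (\<lambda>(i, j). cmod (W $ i $ j)) UNIV = sqrt CARD('n)"
    using row by (simp add: L2_set_def case_prod_unfold p_def sum.cartesian_product'
        UNIV_Times_UNIV[symmetric] del: UNIV_Times_UNIV)
  also have "L2_set (\<lambda>(i, j). \<bar>d i - e j\<bar> * cmod (W $ i $ j)) UNIV = norm (A - B)"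
  proof -
    have "(norm (A - B))\<^sup>2 = (\<Sum>(i, j)\<in>UNIV. (\<bar>d i - e j\<bar> * cmod (W $ i $ j))\<^sup>2)"
      by (simp only: nAB sum.cartesian_product UNIV_Times_UNIV)
    then show ?thesis by (simp add: L2_set_def case_prod_unfold real_sqrt_unique)
  qed
  finally have "\<bar>(\<Sum>i\<in>UNIV. f (d i)) - (\<Sum>j\<in>UNIV. f (e j))\<bar> / CARD('n) \<le> sqrt CARD('n) * norm (A - B) / CARD('n)"
    by (rule divide_right_mono) simp
  also have "\<dots> = norm (A - B) / sqrt CARD('n)" by (simp add: field_simps)
  finally show ?thesis
    by (simp add: integral_empirical_spectral_measure[OF U fm] integral_empirical_spectral_measure[OF V fm]
        diff_divide_distrib[symmetric])
qed

lemma prob_space_empirical_spectral_measure: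
  assumes "hermitian_matrix A"
  shows "prob_space (empirical_spectral_measure A)"
    and "sets (empirical_spectral_measure A) = sets borel"
  unfolding empirical_spectral_measure_def
  by (auto intro!: prob_space.prob_space_distr measure_pmf.prob_space_axioms)

section \<open>Hermitian matrices as functions of real parameters\<close>

definition hermitian_of_params :: "real ^ ('n \<times> 'n) \<Rightarrow> 'n::{finite,linorder} \<Rightarrow> 'n \<Rightarrow> complex" where
  "hermitian_of_params x i j =
     (if i < j then Complex (x $ (i, j)) (x $ (j, i))
      else if j < i then Complex (x $ (j, i)) (- x $ (i, j))
      else of_real (x $ (i, i)))"

text \<open>This makes the spectral distance a function of the parameter vector, defined on the
  whole Euclidean space.\<close>

lemma hermitian_of_params_real_params:
  assumes "\<And>i j. z i j = cnj (z j i)" and "\<And>i. Im (z i i) = 0"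
  shows "hermitian_of_params (real_params z) i j = z i j"
proof (cases i j rule: linorder_cases)
  case greater
  then have "hermitian_of_params (real_params z) i j = cnj (z j i)"
    by (auto simp: hermitian_of_params_def real_params_def complex_eq_iff)
  then show ?thesis using assms(1)[of i j] by simp
qed (use assms(2) in \<open>auto simp: hermitian_of_params_def real_params_def complex_eq_iff\<close>)

lemma hermitian_weighted_matrix:
  assumes "hermitian_matrix A"
  shows "hermitian_matrix (weighted_matrix A (hermitian_of_params x))"
proof -
  have "weighted_matrix A (hermitian_of_params x) $ i $ j =
      cnj (weighted_matrix A (hermitian_of_params x) $ j $ i)" for i j
  proof -
    have "A $ i $ j = cnj (A $ j $ i)" using assms unfolding hermitian_matrix_def by blast
    moreover have "hermitian_of_params x i j = cnj (hermitian_of_params x j i)"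
      by (auto simp: hermitian_of_params_def complex_eq_iff)
    ultimately show ?thesis
      unfolding weighted_matrix_def by (simp only: vec_lambda_beta) simp
  qed
  then show ?thesis unfolding hermitian_matrix_def by blast
qed

lemma norm_weighted_matrix_diff:
  fixes A :: "((complex, 'n::{finite,linorder}) vec, 'n) vec" and x y :: "real ^ ('n \<times> 'n)"
  assumes a: "\<And>i j. cmod (A $ i $ j) \<le> a" and "a > 0"
  shows "norm (weighted_matrix A (hermitian_of_params x) - weighted_matrix A (hermitian_of_params y))
    \<le> a * sqrt (2 / CARD('n)) * norm (x - y)"
proof -
  let ?H = hermitian_of_params
  \<comment> \<open>Off the diagonal this is an equality; on the diagonal the right-hand side counts
    the single real parameter twice.\<close>
  have H: "(cmod (?H x i j - ?H y i j))\<^sup>2 \<le> ((x - y) $ (i, j))\<^sup>2 + ((x - y) $ (j, i))\<^sup>2" for i j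
    by (auto simp: hermitian_of_params_def cmod_power2 simp del: of_real_diff)
      (simp add: power2_commute flip: of_real_diff)
  have entry: "(cmod ((weighted_matrix A (?H x) - weighted_matrix A (?H y)) $ i $ j))\<^sup>2
      \<le> a\<^sup>2 / CARD('n) * (((x - y) $ (i, j))\<^sup>2 + ((x - y) $ (j, i))\<^sup>2)" for i j
  proof -
    have "(weighted_matrix A (?H x) - weighted_matrix A (?H y)) $ i $ j =
        complex_of_real (1 / sqrt (real CARD('n))) * A $ i $ j * (?H x i j - ?H y i j)"
      by (simp add: weighted_matrix_def right_diff_distrib)
    then have "(cmod ((weighted_matrix A (?H x) - weighted_matrix A (?H y)) $ i $ j))\<^sup>2 =
        1 / CARD('n) * (cmod (A $ i $ j))\<^sup>2 * (cmod (?H x i j - ?H y i j))\<^sup>2"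
      by (simp only: norm_mult norm_of_real power_mult_distrib) (simp add: power_divide)
    also have "\<dots> \<le> 1 / CARD('n) * a\<^sup>2 * (((x - y) $ (i, j))\<^sup>2 + ((x - y) $ (j, i))\<^sup>2)"
      using a[of i j] \<open>a > 0\<close> by (intro mult_mono mult_left_mono power_mono H) auto
    finally show ?thesis by simp
  qed
  have nrm: "(norm v)\<^sup>2 = (\<Sum>i\<in>UNIV. \<Sum>j\<in>UNIV. (v $ (i, j))\<^sup>2)" for v :: "real ^ ('n \<times> 'n)"
    by (simp add: norm_vec_def L2_set_def sum_nonneg sum.cartesian_product)
  have "(norm (weighted_matrix A (?H x) - weighted_matrix A (?H y)))\<^sup>2
      \<le> (\<Sum>i\<in>UNIV. \<Sum>j\<in>UNIV. a\<^sup>2 / CARD('n) * (((x - y) $ (i, j))\<^sup>2 + ((x - y) $ (j, i))\<^sup>2))"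
    unfolding norm_matrix_power2 by (intro sum_mono entry)
  also have "\<dots> = a\<^sup>2 / CARD('n) * ((norm (x - y))\<^sup>2 + (\<Sum>i\<in>UNIV. \<Sum>j\<in>UNIV. ((x - y) $ (j, i))\<^sup>2))"
    by (simp only: sum_distrib_left[symmetric] sum.distrib nrm)
  \<comment> \<open>The transposed sum is again the full squared norm; here the factor 2
    arises.\<close>
  also have "(\<Sum>i\<in>UNIV. \<Sum>j\<in>UNIV. ((x - y) $ (j, i))\<^sup>2) = (norm (x - y))\<^sup>2"
    unfolding nrm by (rule sum.swap)
  also have "a\<^sup>2 / CARD('n) * ((norm (x - y))\<^sup>2 + (norm (x - y))\<^sup>2) = (a * sqrt (2 / CARD('n)) * norm (x - y))\<^sup>2"
    by (simp add: power_mult_distrib)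
  finally show ?thesis
    by (rule power2_le_imp_le) (use \<open>a > 0\<close> in simp)
qed

section \<open>Wasserstein distance with bounded test functions\<close>

lemma Lip1_integrable:
  assumes "f \<in> Lip1 b" "prob_space P" "sets P = sets borel"
  shows "integrable P f" "\<bar>LINT x|P. f x\<bar> \<le> b"
proof -
  interpret prob_space P by fact
  have "continuous_on UNIV f"
    using assms(1) by (intro lipschitz_on_continuous_on[of 1]) (auto simp: lipschitz_on_def dist_real_def Lip1_def)
  then have "f \<in> borel_measurable P"
    using measurable_cong_sets[OF assms(3) refl] borel_measurable_continuous_onI by blast
  then show i: "integrable P f"
    using assms(1) by (intro integrable_const_bound[of _ b]) (auto simp: Lip1_def)
  have "norm (LINT x|P. f x) \<le> (LINT x|P. b)"
    using i assms(1) by (intro Bochner_Integration.integral_norm_bound_integral) (auto simp: Lip1_def)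
  then show "\<bar>LINT x|P. f x\<bar> \<le> b" by (simp add: prob_space)
qed

text \<open>A supremum of reals is informative only on a set bounded above, and the bound on the
  test functions provides this. It also makes the distance a bounded function of the matrix, as the
  concentration argument requires.\<close>

lemma wasserstein_bounded:
  assumes "b > 0" "prob_space P" "sets P = sets borel" "prob_space Q" "sets Q = sets borel"
  shows "f \<in> Lip1 b \<Longrightarrow> \<bar>(LINT x|P. f x) - (LINT x|Q. f x)\<bar> \<le> 2 * b"
    and "0 \<le> wasserstein b P Q" and "wasserstein b P Q \<le> 2 * b"
    and "bdd_above ((\<lambda>f. \<bar>(LINT x|P. f x) - (LINT x|Q. f x)\<bar>) ` Lip1 b)"
proof -
  have *: "\<bar>(LINT x|P. f x) - (LINT x|Q. f x)\<bar> \<le> 2 * b" if "f \<in> Lip1 b" for f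
    using Lip1_integrable(2)[OF that assms(2,3)] Lip1_integrable(2)[OF that assms(4,5)] by linarith
  then show "f \<in> Lip1 b \<Longrightarrow> \<bar>(LINT x|P. f x) - (LINT x|Q. f x)\<bar> \<le> 2 * b" .
  show bdd: "bdd_above ((\<lambda>f. \<bar>(LINT x|P. f x) - (LINT x|Q. f x)\<bar>) ` Lip1 b)"
    using * by (intro bdd_aboveI2[of _ _ "2 * b"]) auto
  have 0: "(\<lambda>_. 0) \<in> Lip1 b" using \<open>b > 0\<close> by (auto simp: Lip1_def)
  show "0 \<le> wasserstein b P Q" unfolding wasserstein_def by (rule cSUP_upper2[OF bdd 0]) simp
  show "wasserstein b P Q \<le> 2 * b" unfolding wasserstein_def using 0 * by (intro cSUP_least) auto
qed

lemma wasserstein_diff_le: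
  assumes "b > 0" "prob_space P" "sets P = sets borel" "prob_space P'" "sets P' = sets borel"
    "prob_space Q" "sets Q = sets borel"
    and K: "\<And>f. f \<in> Lip1 b \<Longrightarrow> \<bar>(LINT x|P. f x) - (LINT x|P'. f x)\<bar> \<le> K"
  shows "wasserstein b P Q \<le> wasserstein b P' Q + K"
proof -
  have "(\<lambda>_. 0) \<in> Lip1 b" using \<open>b > 0\<close> by (auto simp: Lip1_def)
  moreover have "\<bar>(LINT x|P. f x) - (LINT x|Q. f x)\<bar> \<le> wasserstein b P' Q + K" if "f \<in> Lip1 b" for f
  proof -
    have "\<bar>(LINT x|P'. f x) - (LINT x|Q. f x)\<bar> \<le> wasserstein b P' Q"
      unfolding wasserstein_def by (rule cSUP_upper[OF that wasserstein_bounded(4)[OF assms(1,4,5,6,7)]])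
    then show ?thesis using K[OF that] by linarith
  qed
  ultimately show ?thesis unfolding wasserstein_def[of b P] by (intro cSUP_least) auto
qed

lemma wasserstein_empirical_spectral_measure_lipschitz:
  fixes A :: "((complex, 'n::{finite,linorder}) vec, 'n) vec" and x y :: "real ^ ('n \<times> 'n)"
  defines "F \<equiv> \<lambda>x. empirical_spectral_measure (weighted_matrix A (hermitian_of_params x))"
  assumes A: "hermitian_matrix A" and a: "\<And>i j. cmod (A $ i $ j) \<le> a" "a > 0"
    and b: "b > 0" and mu: "prob_space \<mu>" "sets \<mu> = sets borel"
  shows "\<bar>wasserstein b (F x) \<mu> - wasserstein b (F y) \<mu>\<bar> \<le> sqrt 2 * a / CARD('n) * norm (x - y)"
proof -
  have F: "prob_space (F x)" "sets (F x) = sets borel" for x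
    unfolding F_def by (intro prob_space_empirical_spectral_measure hermitian_weighted_matrix A)+
  have *: "wasserstein b (F x) \<mu> \<le> wasserstein b (F y) \<mu> + sqrt 2 * a / CARD('n) * norm (x - y)" for x y
  proof (intro wasserstein_diff_le F b mu)
    fix f assume "f \<in> Lip1 b"
    then have "\<bar>(LINT v|F x. f v) - (LINT v|F y. f v)\<bar>
        \<le> norm (weighted_matrix A (hermitian_of_params x) - weighted_matrix A (hermitian_of_params y)) / sqrt CARD('n)"
      unfolding F_def by (intro empirical_spectral_measure_lipschitz hermitian_weighted_matrix A) (auto simp: Lip1_def)
    also have "\<dots> \<le> a * sqrt (2 / CARD('n)) * norm (x - y) / sqrt CARD('n)"
      by (intro divide_right_mono norm_weighted_matrix_diff a) simp
    also have "\<dots> = sqrt 2 * a / CARD('n) * norm (x - y)"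
      by (simp add: real_sqrt_divide)
    finally show "\<bar>(LINT v|F x. f v) - (LINT v|F y. f v)\<bar> \<le> sqrt 2 * a / CARD('n) * norm (x - y)" .
  qed
  from *[of x y] *[of y x] show ?thesis by (simp add: norm_minus_commute abs_le_iff)
qed

subsection \<open>Exponential concentration under convolution\<close>

lemma prob_space_convolution:
  assumes "prob_space M" "prob_space N" "sets M = sets borel" "sets N = sets borel"
  shows "prob_space (M \<star> N)"
proof -
  interpret M: prob_space M by fact
  interpret N: prob_space N by fact
  interpret pair_prob_space M N ..
  have [measurable_cong]: "sets M = sets borel" "sets N = sets borel" by fact+
  show ?thesis unfolding convolution_def by (rule prob_space_distr) measurable
qed

lemma integral_convolution:
  fixes f :: "'a::ordered_euclidean_space \<Rightarrow> 'b::{banach, second_countable_topology}"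
  assumes "prob_space M" "prob_space N" and [measurable_cong]: "sets M = sets borel" "sets N = sets borel"
    and f [measurable]: "f \<in> borel_measurable borel" and B: "\<And>x. norm (f x) \<le> B"
  shows "(LINT x|(M \<star> N). f x) = (LINT x|M. LINT y|N. f (x + y))"
proof -
  interpret M: prob_space M by fact
  interpret N: prob_space N by fact
  interpret pair_prob_space M N ..
  have i: "integrable (M \<Otimes>\<^sub>M N) (\<lambda>(x, y). f (x + y))"
    by (rule integrable_const_bound[of _ B]) (use B in auto)
  have "(LINT x|(M \<star> N). f x) = (LINT z|(M \<Otimes>\<^sub>M N). (case z of (x, y) \<Rightarrow> f (x + y)))"
    unfolding convolution_def by (subst integral_distr) (auto simp: case_prod_unfold)
  also have "\<dots> = (LINT x|M. LINT y|N. f (x + y))"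
    using integral_fst[OF i] by simp
  finally show ?thesis .
qed

section \<open>Characteristic functions on a Euclidean space\<close>

definition char_fun :: "'a::euclidean_space measure \<Rightarrow> 'a \<Rightarrow> complex" where
  "char_fun P t = (CLINT x|P. iexp (t \<bullet> x))"

lemma iexp_inner_measurable [measurable]: "(\<lambda>x::'a::euclidean_space. iexp (t \<bullet> x)) \<in> borel_measurable borel"
  by (intro borel_measurable_continuous_onI continuous_intros)

lemma integrable_iexp_inner:
  fixes P :: "'a::euclidean_space measure"
  assumes "prob_space P" "sets P = sets borel"
  shows "integrable P (\<lambda>x. iexp (t \<bullet> x))"
proof -
  interpret prob_space P by fact
  have [measurable_cong]: "sets P = sets borel" by fact
  have "(\<lambda>x. iexp (t \<bullet> x)) \<in> borel_measurable P"
    by (subst measurable_cong_sets[OF assms(2) refl]) (rule iexp_inner_measurable)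
  then show ?thesis by (intro integrable_const_bound[of _ 1]) auto
qed

lemma norm_char_fun_le_1:
  assumes "prob_space P" "sets P = sets borel"
  shows "cmod (char_fun P t) \<le> 1"
proof -
  interpret prob_space P by fact
  have "cmod (char_fun P t) \<le> (LINT x|P. cmod (iexp (t \<bullet> x)))"
    unfolding char_fun_def by (rule integral_norm_bound)
  then show ?thesis by (simp add: prob_space)
qed

lemma char_fun_convolution:
  fixes M N :: "'a::ordered_euclidean_space measure"
  assumes "prob_space M" "prob_space N" "sets M = sets borel" "sets N = sets borel"
  shows "char_fun (M \<star> N) t = char_fun M t * char_fun N t"
proof -
  have "char_fun (M \<star> N) t = (CLINT x|M. CLINT y|N. iexp (t \<bullet> (x + y)))"
    unfolding char_fun_def by (rule integral_convolution[OF assms, of _ 1]) auto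
  also have "\<dots> = (CLINT x|M. iexp (t \<bullet> x) * char_fun N t)"
    by (simp add: inner_add_right distrib_left exp_add char_fun_def)
  finally show ?thesis by (simp add: char_fun_def)
qed

lemma char_fun_return: "char_fun (return borel x) t = iexp (t \<bullet> x)"
  unfolding char_fun_def by (rule integral_return) auto

primrec conv_power :: "'a::ordered_euclidean_space measure \<Rightarrow> nat \<Rightarrow> 'a measure" where
  "conv_power \<mu> 0 = return borel 0"
| "conv_power \<mu> (Suc n) = (\<mu> \<star> conv_power \<mu> n)"

lemma sets_conv_power [simp]: "sets (conv_power \<mu> n) = sets borel"
  by (cases n) auto

lemma prob_space_conv_power:
  "prob_space \<mu> \<Longrightarrow> sets \<mu> = sets borel \<Longrightarrow> prob_space (conv_power \<mu> n)"
  by (induction n) (simp_all add: prob_space_convolution prob_space_return)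

lemma char_fun_conv_power:
  "prob_space \<mu> \<Longrightarrow> sets \<mu> = sets borel \<Longrightarrow> char_fun (conv_power \<mu> n) t = char_fun \<mu> t ^ n"
  by (induction n) (simp_all add: char_fun_convolution char_fun_return prob_space_conv_power)

text \<open>The mixture of the point mass at 0, with weight \<open>1 - p\<close>, and of
  \<open>\<rho>\<close>, with weight \<open>p\<close>, realized as a push-forward so that facts on
  product measures apply.\<close>

definition step_law :: "real \<Rightarrow> 'a::euclidean_space measure \<Rightarrow> 'a measure" where
  "step_law p \<rho> = distr (measure_pmf (bernoulli_pmf p) \<Otimes>\<^sub>M \<rho>) borel (\<lambda>(b, x). if b then x else 0)"

lemma sets_step_law [simp]: "sets (step_law p \<rho>) = sets borel"
  by (simp add: step_law_def)

context
  fixes p :: real and \<rho> :: "'a::euclidean_space measure"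
  assumes p: "0 \<le> p" "p \<le> 1" and rho: "prob_space \<rho>" "sets \<rho> = sets borel"
begin

lemma measurable_step_map [measurable]:
  "(\<lambda>(b, x). if b then x else 0) \<in> measure_pmf (bernoulli_pmf p) \<Otimes>\<^sub>M \<rho> \<rightarrow>\<^sub>M borel"
proof -
  have [measurable_cong]: "sets \<rho> = sets borel" by fact
  show ?thesis by measurable
qed

lemma prob_space_step_law: "prob_space (step_law p \<rho>)"
proof -
  interpret rho: prob_space \<rho> by fact
  interpret pair_prob_space "measure_pmf (bernoulli_pmf p)" \<rho> ..
  show ?thesis unfolding step_law_def by (rule prob_space_distr) measurable
qed

lemma integral_step_law:
  fixes f :: "'a \<Rightarrow> 'b::{banach, second_countable_topology}"
  assumes [measurable]: "f \<in> borel_measurable borel" and B: "\<And>x. norm (f x) \<le> B"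
  shows "(LINT x|(step_law p \<rho>). f x) = p *\<^sub>R (LINT x|\<rho>. f x) + (1 - p) *\<^sub>R f 0"
proof -
  interpret rho: prob_space \<rho> by fact
  interpret pair_prob_space "measure_pmf (bernoulli_pmf p)" \<rho> ..
  have [measurable_cong]: "sets \<rho> = sets borel" by fact
  have i: "integrable (measure_pmf (bernoulli_pmf p) \<Otimes>\<^sub>M \<rho>) (\<lambda>(b, x). f (if b then x else 0))"
    by (rule integrable_const_bound[of _ B]) (use B in auto)
  have "(LINT x|(step_law p \<rho>). f x) =
      (LINT z|(measure_pmf (bernoulli_pmf p) \<Otimes>\<^sub>M \<rho>). (case z of (b, x) \<Rightarrow> f (if b then x else 0)))"
    unfolding step_law_def by (subst integral_distr) (auto simp: case_prod_unfold)
  also have "\<dots> = (LINT b|(measure_pmf (bernoulli_pmf p)). LINT x|\<rho>. f (if b then x else 0))"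
    using integral_fst[OF i] by simp
  also have "\<dots> = p *\<^sub>R (LINT x|\<rho>. f x) + (1 - p) *\<^sub>R f 0"
    using p by (simp add: integral_measure_pmf[of UNIV] UNIV_bool rho.prob_space add.commute)
  finally show ?thesis .
qed

lemma char_fun_step_law: "char_fun (step_law p \<rho>) t = 1 + p * (CLINT x|\<rho>. iexp (t \<bullet> x) - 1)"
proof -
  interpret rho: prob_space \<rho> by fact
  have "(CLINT x|\<rho>. iexp (t \<bullet> x) - 1) = (CLINT x|\<rho>. iexp (t \<bullet> x)) - 1"
    using integrable_iexp_inner[OF rho] by (subst Bochner_Integration.integral_diff) (auto simp: rho.prob_space)
  moreover have "char_fun (step_law p \<rho>) t = p *\<^sub>R (CLINT x|\<rho>. iexp (t \<bullet> x)) + (1 - p) *\<^sub>R iexp (t \<bullet> 0)"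
    unfolding char_fun_def by (rule integral_step_law[of _ 1]) auto
  ultimately show ?thesis by (simp add: scaleR_conv_of_real[where 'a = complex] right_diff_distrib)
qed

end

text \<open>This class is closed under translation and under averaging over translations, which the
  convolution step needs; boundedness makes all exponential integrals finite.\<close>

definition lip1_bounded :: "('a::real_normed_vector \<Rightarrow> real) \<Rightarrow> bool" where
  "lip1_bounded G \<longleftrightarrow> (\<forall>x y. \<bar>G x - G y\<bar> \<le> norm (x - y)) \<and> (\<exists>B. \<forall>x. \<bar>G x\<bar> \<le> B)"

lemma lip1_boundedD: "lip1_bounded G \<Longrightarrow> \<bar>G x - G y\<bar> \<le> norm (x - y)"
  by (simp add: lip1_bounded_def)

lemma lip1_bounded_measurable:
  "lip1_bounded G \<Longrightarrow> G \<in> borel_measurable (borel :: 'a::euclidean_space measure)"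
  by (intro borel_measurable_continuous_onI lipschitz_on_continuous_on[of 1])
    (auto simp: lipschitz_on_def dist_norm lip1_bounded_def)

text \<open>A bound on the Laplace transform of every centred \<open>G\<close>, with one constant
  \<open>K\<close> for all of them. As an inequality between integrals it can pass to weak
  limits.\<close>

definition exp_conc :: "real \<Rightarrow> real \<Rightarrow> 'a::euclidean_space measure \<Rightarrow> bool" where
  "exp_conc s K Q \<longleftrightarrow>
    (\<forall>G. lip1_bounded G \<longrightarrow> (LINT x|Q. exp (s * G x)) \<le> exp (K + s * (LINT x|Q. G x)))"

lemma exp_conc_return: "exp_conc s 0 (return borel x)"
  unfolding exp_conc_def by (auto dest!: lip1_bounded_measurable simp: integral_return)

lemma bounded_measurable_integrable:
  fixes f :: "'a::euclidean_space \<Rightarrow> 'b::{banach, second_countable_topology}"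
  assumes "prob_space Q" and [measurable_cong]: "sets Q = sets borel"
    and [measurable]: "f \<in> borel_measurable borel" and B: "\<And>x. norm (f x) \<le> B"
  shows "integrable Q f"
proof -
  interpret prob_space Q by fact
  show ?thesis by (rule integrable_const_bound[of _ B]) (use B in auto)
qed

lemma abs_bounded_integral:
  fixes f :: "'a::euclidean_space \<Rightarrow> real"
  assumes "prob_space Q" "sets Q = sets borel" "f \<in> borel_measurable borel" and B: "\<And>x. \<bar>f x\<bar> \<le> B"
  shows "\<bar>LINT x|Q. f x\<bar> \<le> B"
proof -
  interpret prob_space Q by fact
  have "norm (LINT x|Q. f x) \<le> (LINT x|Q. B)"
    using bounded_measurable_integrable[of Q f B] assms
    by (intro Bochner_Integration.integral_norm_bound_integral) auto
  then show ?thesis by (simp add: prob_space)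
qed

text \<open>For a fixed first summand \<open>x\<close> the bound for \<open>Q\<close> applies to the
  translate of \<open>G\<close>, whose mean is \<open>g x\<close>. The bound for \<open>P\<close>
  then applies to \<open>g\<close>, which is again bounded and 1-Lipschitz and whose mean under
  \<open>P\<close> is that of \<open>G\<close> under the convolution.\<close>

lemma exp_conc_convolution:
  fixes P Q :: "'a::ordered_euclidean_space measure"
  assumes P: "prob_space P" "sets P = sets borel" "exp_conc s K P"
    and Q: "prob_space Q" "sets Q = sets borel" "exp_conc s L Q"
  shows "exp_conc s (K + L) (P \<star> Q)"
  unfolding exp_conc_def
proof (intro allI impI)
  fix G :: "'a \<Rightarrow> real" assume G: "lip1_bounded G"
  note [measurable] = lip1_bounded_measurable[OF G]
  obtain B where B: "\<And>x. \<bar>G x\<bar> \<le> B" using G by (auto simp: lip1_bounded_def)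
  have eB: "norm (exp (s * G x)) \<le> exp (\<bar>s\<bar> * B)" for x
    using mult_left_mono[OF B, of "\<bar>s\<bar>" x] abs_ge_self[of "s * G x"] by (simp add: abs_mult)
  have shift: "lip1_bounded (\<lambda>y. G (x + y))" for x
    using lip1_boundedD[OF G, of "x + y" "x + z" for y z] B by (auto simp: lip1_bounded_def)
  define g where "g x = (LINT y|Q. G (x + y))" for x
  have int: "integrable Q (\<lambda>y. G (x + y))" for x
    by (rule bounded_measurable_integrable[OF Q(1,2), of _ B]) (use B in auto)
  have g: "lip1_bounded g"
    unfolding lip1_bounded_def
  proof (intro conjI allI exI)
    show "\<bar>g x\<bar> \<le> B" for x unfolding g_def by (rule abs_bounded_integral[OF Q(1,2)]) (use B in auto)
    have "g x - g y = (LINT z|Q. G (x + z) - G (y + z))" for x y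
      unfolding g_def using int by simp
    moreover have "\<bar>LINT z|Q. G (x + z) - G (y + z)\<bar> \<le> norm (x - y)" for x y
      using lip1_boundedD[OF G, of "x + z" "y + z" for z]
      by (intro abs_bounded_integral[OF Q(1,2)]) simp_all
    ultimately show "\<bar>g x - g y\<bar> \<le> norm (x - y)" for x y by simp
  qed
  note [measurable] = lip1_bounded_measurable[OF g]
  have gB: "\<bar>g x\<bar> \<le> B" for x unfolding g_def by (rule abs_bounded_integral[OF Q(1,2)]) (use B in auto)
  have egB: "norm (exp (s * g x)) \<le> exp (\<bar>s\<bar> * B)" for x
    using mult_left_mono[OF gB, of "\<bar>s\<bar>" x] abs_ge_self[of "s * g x"] by (simp add: abs_mult)
  interpret Q: prob_space Q by fact
  have [measurable_cong]: "sets P = sets borel" "sets Q = sets borel" by fact+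
  have inner_bound: "norm (LINT y|Q. exp (s * G (x + y))) \<le> exp (\<bar>s\<bar> * B)" for x
    unfolding real_norm_def by (rule abs_bounded_integral[OF Q(1,2)]) (use eB in auto)
  have "(LINT x|(P \<star> Q). exp (s * G x)) = (LINT x|P. LINT y|Q. exp (s * G (x + y)))"
    by (rule integral_convolution[OF P(1) Q(1) P(2) Q(2) _ eB]) measurable
  also have "\<dots> \<le> (LINT x|P. exp (L + s * g x))"
  proof (rule integral_mono)
    show "integrable P (\<lambda>x. LINT y|Q. exp (s * G (x + y)))"
      by (rule bounded_measurable_integrable[OF P(1,2) _ inner_bound]) measurable
    show "integrable P (\<lambda>x. exp (L + s * g x))"
      unfolding exp_add by (intro integrable_mult_right bounded_measurable_integrable[OF P(1,2) _ egB]) measurable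
    show "(LINT y|Q. exp (s * G (x + y))) \<le> exp (L + s * g x)" for x
      using Q(3) shift[of x] unfolding exp_conc_def g_def by blast
  qed
  also have "\<dots> = exp L * (LINT x|P. exp (s * g x))" by (simp add: exp_add)
  also have "\<dots> \<le> exp L * exp (K + s * (LINT x|P. g x))"
    using P(3) g unfolding exp_conc_def by simp
  also have "(LINT x|P. g x) = (LINT x|(P \<star> Q). G x)"
    unfolding g_def by (rule integral_convolution[OF P(1) Q(1) P(2) Q(2), symmetric, of _ B]) (use B in auto)
  finally show "(LINT x|(P \<star> Q). exp (s * G x)) \<le> exp (K + L + s * (LINT x|(P \<star> Q). G x))"
    by (simp add: exp_add mult_ac)
qed

lemma exp_conc_conv_power:
  assumes "prob_space \<mu>" "sets \<mu> = sets borel" "exp_conc s K \<mu>"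
  shows "exp_conc s (real n * K) (conv_power \<mu> n)"
proof (induction n)
  case (Suc n)
  have "exp_conc s (K + real n * K) (\<mu> \<star> conv_power \<mu> n)"
    by (intro exp_conc_convolution assms prob_space_conv_power Suc sets_conv_power)
  then show ?case by (simp add: algebra_simps)
qed (simp add: exp_conc_return)

text \<open>On the nonnegative axis the remainder is increasing. A negative argument
  \<open>- y\<close> is compared with \<open>y\<close>, where the difference is
  \<open>2 * (sinh y - y)\<close>.\<close>

lemma exp_remainder_le:
  fixes x y :: real
  assumes "\<bar>x\<bar> \<le> y"
  shows "exp x - 1 - x \<le> exp y - 1 - y"
proof -
  have mono: "exp u - u \<le> exp v - v" if "0 \<le> u" "u \<le> v" for u v :: real
  proof -
    have "exp v = exp u * exp (v - u)" by (simp add: exp_add[symmetric])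
    moreover have "exp u * exp (v - u) \<ge> exp u * (1 + (v - u))"
      by (intro mult_left_mono exp_ge_add_one_self) auto
    moreover have "exp u * (v - u) \<ge> 1 * (v - u)" using that by (intro mult_right_mono) auto
    ultimately show ?thesis by (simp add: algebra_simps)
  qed
  have "exp x - x \<le> exp \<bar>x\<bar> - \<bar>x\<bar>"
  proof (cases "x \<ge> 0")
    case False
    define y where "y = -x"
    have y: "y \<ge> 0" using False by (simp add: y_def)
    have "sinh y \<ge> y"
    proof -
      have "sinh 0 - 0 \<le> sinh y - y"
      proof (rule DERIV_nonneg_imp_nondecreasing[OF y])
        fix z :: real
        have "((\<lambda>y. sinh y - y) has_real_derivative (cosh z - 1)) (at z)"
          by (auto intro!: derivative_eq_intros)
        then show "\<exists>d. ((\<lambda>y. sinh y - y) has_real_derivative d) (at z) \<and> 0 \<le> d"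
          using cosh_real_ge_1[of z] by (intro exI[of _ "cosh z - 1"]) simp
      qed
      then show ?thesis by simp
    qed
    then show ?thesis using False by (simp add: sinh_field_def y_def)
  qed simp
  also have "\<dots> \<le> exp y - y" using assms by (intro mono) auto
  finally show ?thesis by simp
qed

text \<open>The step law is close to a compound Poisson law, so \<open>1 + x \<le> exp x\<close> loses nothing in the
  limit.\<close>

lemma exp_conc_step_law:
  assumes p: "0 \<le> p" "p \<le> 1" and rho: "prob_space \<rho>" "sets \<rho> = sets borel" and s: "s \<ge> 0"
    and int: "integrable \<rho> (\<lambda>u. exp (s * norm u) - 1 - s * norm u)"
  shows "exp_conc s (p * (LINT u|\<rho>. exp (s * norm u) - 1 - s * norm u)) (step_law p \<rho>)"
  unfolding exp_conc_def
proof (intro allI impI)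
  fix G :: "'a \<Rightarrow> real" assume G: "lip1_bounded G"
  note [measurable] = lip1_bounded_measurable[OF G]
  obtain B where B: "\<And>x. \<bar>G x\<bar> \<le> B" using G by (auto simp: lip1_bounded_def)
  have eB: "norm (exp (s * G x)) \<le> exp (\<bar>s\<bar> * B)" for x
    using mult_left_mono[OF B, of "\<bar>s\<bar>" x] abs_ge_self[of "s * G x"] by (simp add: abs_mult)
  interpret rho: prob_space \<rho> by fact
  have ie: "integrable \<rho> (\<lambda>x. exp (s * G x))" and ig: "integrable \<rho> G"
    by (rule bounded_measurable_integrable[OF rho _ eB] bounded_measurable_integrable[OF rho, of _ B];
      use B in simp)+
  let ?h = "\<lambda>u. exp (s * norm u) - 1 - s * norm u"
  \<comment> \<open>Centring at \<open>G 0\<close>, the value at the atom, makes the exponential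
    moment of the step law equal to \<open>exp (s * G 0) * (1 + p * c)\<close>.\<close>
  define c where "c = (LINT x|\<rho>. exp (s * (G x - G 0)) - 1)"
  have ie': "integrable \<rho> (\<lambda>x. exp (s * (G x - G 0)) - 1)"
    using ie by (simp add: right_diff_distrib exp_diff)
  have c: "(LINT x|\<rho>. exp (s * G x)) = exp (s * G 0) * (1 + c)"
  proof -
    have "c = (LINT x|\<rho>. exp (s * G x) / exp (s * G 0)) - 1"
      unfolding c_def right_diff_distrib exp_diff
      using ie by (subst Bochner_Integration.integral_diff) (auto simp: rho.prob_space)
    then show ?thesis by simp
  qed
  have "c \<le> (LINT x|\<rho>. ?h x + s * (G x - G 0))"
    unfolding c_def
  proof (rule integral_mono[OF ie'])
    show "integrable \<rho> (\<lambda>x. ?h x + s * (G x - G 0))" using int ig by simp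
    \<comment> \<open>The Lipschitz property relative to 0 bounds the remainder in terms of
      \<open>norm x\<close>; the linear part is kept exactly, since it has to reproduce the mean of
      \<open>G\<close> under the step law.\<close>
    have "\<bar>s * (G x - G 0)\<bar> \<le> s * norm x" for x
      using lip1_boundedD[OF G, of x 0] s by (simp add: abs_mult mult_left_mono)
    from exp_remainder_le[OF this] show "exp (s * (G x - G 0)) - 1 \<le> ?h x + s * (G x - G 0)" for x
      by (simp only: diff_le_eq)
  qed
  also have "\<dots> = (LINT x|\<rho>. ?h x) + s * ((LINT x|\<rho>. G x) - G 0)"
    using int ig by (subst Bochner_Integration.integral_add) (auto simp: rho.prob_space)
  finally have cle: "c \<le> (LINT x|\<rho>. ?h x) + s * ((LINT x|\<rho>. G x) - G 0)" .
  have "(LINT x|(step_law p \<rho>). exp (s * G x)) = p *\<^sub>R (LINT x|\<rho>. exp (s * G x)) + (1 - p) *\<^sub>R exp (s * G 0)"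
    by (rule integral_step_law[OF p rho _ eB]) measurable
  also have "\<dots> = exp (s * G 0) * (1 + p * c)" by (simp add: c algebra_simps)
  also have "\<dots> \<le> exp (s * G 0) * exp (p * c)" by (intro mult_left_mono exp_ge_add_one_self) auto
  also have "\<dots> = exp (s * G 0 + p * c)" by (simp add: exp_add)
  also have "\<dots> \<le> exp (s * G 0 + p * ((LINT x|\<rho>. ?h x) + s * ((LINT x|\<rho>. G x) - G 0)))"
    using mult_left_mono[OF cle p(1)] by simp
  also have "s * G 0 + p * ((LINT x|\<rho>. ?h x) + s * ((LINT x|\<rho>. G x) - G 0)) =
      p * (LINT x|\<rho>. ?h x) + s * (p *\<^sub>R (LINT x|\<rho>. G x) + (1 - p) *\<^sub>R G 0)"
    by (simp add: algebra_simps)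
  also have "p *\<^sub>R (LINT x|\<rho>. G x) + (1 - p) *\<^sub>R G 0 = (LINT x|(step_law p \<rho>). G x)"
    by (rule integral_step_law[OF p rho, symmetric, of _ B]) (use B in auto)
  finally show "(LINT x|(step_law p \<rho>). exp (s * G x)) \<le>
      exp (p * (LINT x|\<rho>. ?h x) + s * (LINT x|(step_law p \<rho>). G x))" .
qed

subsection \<open>Convergence of characteristic functions\<close>

definition gauss :: "'a::euclidean_space \<Rightarrow> real" where
  "gauss x = exp (- (norm x)\<^sup>2 / 2)"

lemma gauss_measurable [measurable]: "gauss \<in> borel_measurable borel"
  unfolding gauss_def by measurable

lemma gauss_pos: "gauss x > 0" and gauss_le_1: "gauss x \<le> 1"
  by (simp_all add: gauss_def)

lemma gauss_eq_prod: "gauss x = (\<Prod>b\<in>Basis. exp (- (x \<bullet> b)\<^sup>2 / 2))"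
proof -
  have "(norm x)\<^sup>2 = (\<Sum>b\<in>Basis. (x \<bullet> b)\<^sup>2)"
    unfolding power2_norm_eq_inner by (subst euclidean_inner) (simp add: power2_eq_square)
  then show ?thesis by (simp add: gauss_def exp_sum[symmetric] sum_negf sum_divide_distrib[symmetric])
qed

text \<open>Built as the product of one-dimensional normal laws over the basis. Reading the kernel
  as a characteristic function is what later expresses smoothed densities through characteristic
  functions.\<close>

lemma gauss_is_char_fun:
  obtains \<gamma> :: "'a::euclidean_space measure"
  where "prob_space \<gamma>" "sets \<gamma> = sets borel" "\<And>t. char_fun \<gamma> t = of_real (gauss t)"
proof -
  define M where "M = (\<lambda>b::'a. std_normal_distribution)"
  interpret N: real_distribution std_normal_distribution by (rule real_dist_normal_dist)
  interpret product_prob_space M Basis unfolding M_def by unfold_locales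
  define F where "F = (\<lambda>f. \<Sum>b\<in>Basis. f b *\<^sub>R b :: 'a)"
  have [measurable_cong]: "sets (M b) = sets borel" for b by (simp add: M_def)
  have F [measurable]: "F \<in> Pi\<^sub>M Basis M \<rightarrow>\<^sub>M borel" unfolding F_def by measurable
  have PM: "prob_space (Pi\<^sub>M Basis M)" by (rule prob_space_PiM) (simp add: M_def N.prob_space_axioms)
  define \<gamma> where "\<gamma> = distr (Pi\<^sub>M Basis M) borel F"
  have "char_fun \<gamma> t = of_real (gauss t)" for t
  proof -
    have "char_fun \<gamma> t = (CLINT f|Pi\<^sub>M Basis M. iexp (t \<bullet> F f))"
      unfolding char_fun_def \<gamma>_def by (rule integral_distr) measurable
    also have "\<dots> = (CLINT f|Pi\<^sub>M Basis M. \<Prod>b\<in>Basis. iexp ((t \<bullet> b) * f b))"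
      by (simp add: F_def inner_sum_right exp_sum[symmetric] sum_distrib_left mult_ac)
    also have "\<dots> = (\<Prod>b\<in>Basis. CLINT x|M b. iexp ((t \<bullet> b) * x))"
      by (rule product_integral_prod) (auto simp: M_def intro!: N.integrable_iexp)
    also have "\<dots> = (\<Prod>b\<in>Basis. char std_normal_distribution (t \<bullet> b))"
      by (simp add: char_def M_def)
    also have "\<dots> = of_real (gauss t)"
      by (simp only: char_std_normal_distribution gauss_eq_prod of_real_prod)
    finally show ?thesis .
  qed
  moreover have "prob_space \<gamma>" unfolding \<gamma>_def by (rule prob_space.prob_space_distr[OF PM]) measurable
  ultimately show ?thesis using that[of \<gamma>] by (simp add: \<gamma>_def)
qed

lemma gauss_integral_finite_pos:
  "(\<integral>\<^sup>+x. ennreal (gauss (x::'a::euclidean_space)) \<partial>lborel) < \<infinity>" (is ?fin)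
  "(\<integral>\<^sup>+x. ennreal (gauss (x::'a::euclidean_space)) \<partial>lborel) > 0" (is ?pos)
proof -
  have "(\<integral>\<^sup>+x. ennreal (gauss (x::'a)) \<partial>lborel) =
      (\<integral>\<^sup>+x. (\<Prod>b\<in>Basis. ennreal (exp (- ((x::'a) \<bullet> b)\<^sup>2 / 2))) \<partial>lborel)"
    by (simp add: gauss_eq_prod prod_ennreal)
  also have "\<dots> = (\<Prod>b\<in>(Basis::'a set). \<integral>\<^sup>+y. ennreal (exp (- y\<^sup>2 / 2)) \<partial>lborel)"
    by (rule nn_integral_lborel_prod) auto
  also have "\<dots> < \<infinity>"
  proof -
    have eq: "(\<lambda>y::real. exp (- y\<^sup>2 / 2)) = (\<lambda>y. sqrt (2 * pi) * std_normal_density y)"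
      by (simp add: std_normal_density_def)
    have "integrable lborel (\<lambda>y::real. exp (- y\<^sup>2 / 2))"
      unfolding eq by (intro integrable_mult_right integrable_normal_density) simp
    then have "(\<integral>\<^sup>+y. ennreal (exp (- y\<^sup>2 / 2)) \<partial>lborel) \<noteq> \<infinity>"
      by (simp add: integrable_iff_bounded less_top)
    then show ?thesis by (simp add: ennreal_prod_eq_top less_top[symmetric] power_eq_top_ennreal)
  qed
  finally show ?fin .
  show ?pos
  proof (rule ccontr)
    assume "\<not> ?pos"
    then have "AE x in lborel. ennreal (gauss (x::'a)) = 0"
      by (subst (asm) not_gr_zero) (subst (asm) nn_integral_0_iff_AE, auto)
    moreover have "ennreal (gauss x) \<noteq> 0" for x :: 'a
      using gauss_pos[of x] by (simp add: ennreal_eq_0_iff not_le)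
    ultimately have "AE x in (lborel :: 'a measure). False" by simp
    then show False by (simp add: AE_iff_measurable[OF _ refl])
  qed
qed

lemma nn_integral_lborel_scale:
  fixes h :: "'a::euclidean_space \<Rightarrow> ennreal"
  assumes [measurable]: "h \<in> borel_measurable borel" and k: "k > 0"
  shows "(\<integral>\<^sup>+x. h x \<partial>lborel) = (\<integral>\<^sup>+x. ennreal (k ^ DIM('a)) * h (k *\<^sub>R x) \<partial>lborel)"
proof -
  have "(\<integral>\<^sup>+x. h x \<partial>lborel) = (\<integral>\<^sup>+x. h x \<partial>density (distr lborel borel (\<lambda>x. 0 + k *\<^sub>R x)) (\<lambda>_. \<bar>k\<bar>^DIM('a)))"
    using k by (subst lborel_affine[of k 0]) auto
  then show ?thesis using k by (simp add: nn_integral_density nn_integral_distr)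
qed

lemma nn_integral_lborel_shift:
  fixes h :: "'a::euclidean_space \<Rightarrow> ennreal"
  assumes [measurable]: "h \<in> borel_measurable borel"
  shows "(\<integral>\<^sup>+x. h x \<partial>lborel) = (\<integral>\<^sup>+x. h (c + x) \<partial>lborel)"
proof -
  have "(\<integral>\<^sup>+x. h x \<partial>lborel) = (\<integral>\<^sup>+x. h x \<partial>distr lborel borel ((+) c))"
    by (simp add: lborel_distr_plus)
  then show ?thesis by (simp add: nn_integral_distr)
qed

definition gauss_mass :: "'a::euclidean_space itself \<Rightarrow> real" where
  "gauss_mass _ = enn2real (\<integral>\<^sup>+x. ennreal (gauss (x::'a)) \<partial>lborel)"

text \<open>Noise of scale 1 / k, which concentrates at 0 as \<open>k\<close> grows.\<close>

definition gauss_law :: "real \<Rightarrow> 'a::euclidean_space measure" where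
  "gauss_law k = distr (density lborel (\<lambda>x. ennreal (gauss x / gauss_mass TYPE('a)))) borel (\<lambda>x. x /\<^sub>R k)"

lemma gauss_mass: "gauss_mass TYPE('a::euclidean_space) > 0"
    "ennreal (gauss_mass TYPE('a)) = (\<integral>\<^sup>+x. ennreal (gauss (x::'a)) \<partial>lborel)"
  using gauss_integral_finite_pos[where 'a = 'a] by (simp_all add: gauss_mass_def enn2real_positive_iff)

lemma prob_space_gauss_density:
  "prob_space (density lborel (\<lambda>x. ennreal (gauss (x::'a::euclidean_space) / gauss_mass TYPE('a))))"
proof (rule prob_spaceI)
  have "emeasure (density lborel (\<lambda>x. ennreal (gauss (x::'a) / gauss_mass TYPE('a)))) UNIV
      = (\<integral>\<^sup>+x. ennreal (gauss (x::'a)) / ennreal (gauss_mass TYPE('a)) \<partial>lborel)"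
    using gauss_mass(1)[where 'a = 'a] by (simp add: emeasure_density divide_ennreal less_imp_le gauss_pos)
  also have "\<dots> = 1"
    using gauss_mass[where 'a = 'a] by (simp add: nn_integral_divide gauss_mass(2)[symmetric] ennreal_divide_self)
  finally show "emeasure (density lborel (\<lambda>x. ennreal (gauss (x::'a) / gauss_mass TYPE('a))))
      (space (density lborel (\<lambda>x. ennreal (gauss (x::'a) / gauss_mass TYPE('a))))) = 1" by simp
qed

lemma gauss_law: "prob_space (gauss_law k)" "sets (gauss_law k) = sets borel"
  unfolding gauss_law_def by (auto intro!: prob_space.prob_space_distr[OF prob_space_gauss_density])

section \<open>Gaussian smoothing of a law\<close>

definition smooth_density :: "real \<Rightarrow> 'a::euclidean_space measure \<Rightarrow> 'a \<Rightarrow> real" where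
  "smooth_density k Q y = k ^ DIM('a) / gauss_mass TYPE('a) * (LINT x|Q. gauss (k *\<^sub>R (y - x)))"

lemma smooth_density_nonneg: "k > 0 \<Longrightarrow> smooth_density k Q y \<ge> 0"
  unfolding smooth_density_def using gauss_mass(1)[where 'a = 'a]
  by (intro mult_nonneg_nonneg integral_nonneg_AE) (auto simp: gauss_pos less_imp_le)

lemma smooth_density_measurable [measurable]:
  assumes "prob_space Q" "sets Q = sets borel"
  shows "smooth_density k Q \<in> borel_measurable borel"
proof -
  interpret prob_space Q by fact
  have [measurable_cong]: "sets Q = sets borel" by fact
  show ?thesis unfolding smooth_density_def by measurable
qed

text \<open>Rescaling the noise by \<open>k\<close>, with Jacobian \<open>k ^ DIM('a)\<close>, and
  translating it by \<open>x\<close> exposes the kernel; exchanging the order of integration then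
  averages it over \<open>Q\<close>.\<close>

lemma convolution_gauss_law:
  fixes Q :: "'a::ordered_euclidean_space measure"
  assumes Q: "prob_space Q" "sets Q = sets borel" and k: "k > 0"
  shows "(Q \<star> gauss_law k) = density lborel (\<lambda>y. ennreal (smooth_density k Q y))"
proof (rule measure_eqI)
  interpret Q: prob_space Q by fact
  interpret K: prob_space "gauss_law k :: 'a measure" by (rule gauss_law)
  have [measurable_cong]: "sets Q = sets borel" by fact
  note smooth_density_measurable[OF Q, measurable]
  show "sets (Q \<star> gauss_law k) = sets (density lborel (\<lambda>y. ennreal (smooth_density k Q y)))" by simp
  fix S assume "S \<in> sets (Q \<star> gauss_law k)"
  then have [measurable]: "S \<in> sets borel" by simp
  let ?c = "gauss_mass TYPE('a)"
  have c: "?c > 0" by (rule gauss_mass)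
  have "emeasure (Q \<star> gauss_law k) S = (\<integral>\<^sup>+x. \<integral>\<^sup>+z. indicator S (x + z) \<partial>gauss_law k \<partial>Q)"
    by (rule convolution_emeasure') (auto simp: gauss_law Q Q.finite_measure_axioms K.finite_measure_axioms)
  also have "\<dots> = (\<integral>\<^sup>+x. (\<integral>\<^sup>+z. ennreal (gauss z / ?c) * indicator S (x + z /\<^sub>R k) \<partial>lborel) \<partial>Q)"
    unfolding gauss_law_def by (simp add: nn_integral_distr nn_integral_density)
  also have "\<dots> = (\<integral>\<^sup>+x. (\<integral>\<^sup>+z. ennreal (k ^ DIM('a)) * (ennreal (gauss (k *\<^sub>R z) / ?c) * indicator S (x + z)) \<partial>lborel) \<partial>Q)"
    using k by (subst nn_integral_lborel_scale[OF _ k]) simp_all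
  also have "\<dots> = (\<integral>\<^sup>+x. (\<integral>\<^sup>+y. ennreal (k ^ DIM('a)) * (ennreal (gauss (k *\<^sub>R (y - x)) / ?c) * indicator S y) \<partial>lborel) \<partial>Q)"
  proof (rule nn_integral_cong)
    fix x :: 'a
    show "(\<integral>\<^sup>+z. ennreal (k ^ DIM('a)) * (ennreal (gauss (k *\<^sub>R z) / ?c) * indicator S (x + z)) \<partial>lborel)
      = (\<integral>\<^sup>+y. ennreal (k ^ DIM('a)) * (ennreal (gauss (k *\<^sub>R (y - x)) / ?c) * indicator S y) \<partial>lborel)"
      using nn_integral_lborel_shift[of "\<lambda>y. ennreal (k ^ DIM('a)) * (ennreal (gauss (k *\<^sub>R (y - x)) / ?c) * indicator S y)" x]
      by simp
  qed
  also have "\<dots> = (\<integral>\<^sup>+y. (\<integral>\<^sup>+x. ennreal (k ^ DIM('a)) * (ennreal (gauss (k *\<^sub>R (y - x)) / ?c) * indicator S y) \<partial>Q) \<partial>lborel)"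
  proof -
    interpret pair_sigma_finite lborel Q ..
    show ?thesis by (rule Fubini') measurable
  qed
  also have "\<dots> = (\<integral>\<^sup>+y. ennreal (smooth_density k Q y) * indicator S y \<partial>lborel)"
  proof (intro nn_integral_cong)
    fix y :: 'a
    have "ennreal (k ^ DIM('a)) * (ennreal (gauss (k *\<^sub>R (y - x)) / ?c) * indicator S y) =
        ennreal (k ^ DIM('a) / ?c * gauss (k *\<^sub>R (y - x))) * indicator S y" for x
      using k c gauss_pos[of "k *\<^sub>R (y - x)"]
      by (simp add: mult.assoc[symmetric] ennreal_mult[symmetric] less_imp_le)
    then have "(\<integral>\<^sup>+x. ennreal (k ^ DIM('a)) * (ennreal (gauss (k *\<^sub>R (y - x)) / ?c) * indicator S y) \<partial>Q)
        = (\<integral>\<^sup>+x. ennreal (k ^ DIM('a) / ?c * gauss (k *\<^sub>R (y - x))) \<partial>Q) * indicator S y"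
      by (simp add: nn_integral_multc)
    also have "(\<integral>\<^sup>+x. ennreal (k ^ DIM('a) / ?c * gauss (k *\<^sub>R (y - x))) \<partial>Q) = ennreal (smooth_density k Q y)"
      unfolding smooth_density_def integral_mult_right_zero[symmetric]
    proof (rule nn_integral_eq_integral)
      show "integrable Q (\<lambda>x. k ^ DIM('a) / ?c * gauss (k *\<^sub>R (y - x)))"
        by (intro integrable_mult_right bounded_measurable_integrable[OF Q, of _ 1])
          (auto simp: gauss_pos gauss_le_1 less_imp_le)
    qed (use k c in \<open>auto simp: gauss_pos less_imp_le\<close>)
    finally show "(\<integral>\<^sup>+x. ennreal (k ^ DIM('a)) * (ennreal (gauss (k *\<^sub>R (y - x)) / ?c) * indicator S y) \<partial>Q)
      = ennreal (smooth_density k Q y) * indicator S y" .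
  qed
  also have "\<dots> = emeasure (density lborel (\<lambda>y. ennreal (smooth_density k Q y))) S"
    by (simp add: emeasure_density)
  finally show "emeasure (Q \<star> gauss_law k) S = emeasure (density lborel (\<lambda>y. ennreal (smooth_density k Q y))) S" .
qed

text \<open>A Parseval identity: the kernel is replaced by its representation as a characteristic
  function and the two integrals are exchanged.\<close>

lemma smooth_density_char_fun:
  fixes Q \<gamma> :: "'a::euclidean_space measure"
  assumes Q: "prob_space Q" "sets Q = sets borel" and \<gamma>: "prob_space \<gamma>" "sets \<gamma> = sets borel"
    and char: "\<And>t. char_fun \<gamma> t = of_real (gauss t)"
  shows "of_real (LINT x|Q. gauss (k *\<^sub>R (y - x))) = (CLINT z|\<gamma>. iexp ((k *\<^sub>R y) \<bullet> z) * char_fun Q (- k *\<^sub>R z))"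
proof -
  interpret Q: prob_space Q by fact
  interpret G: prob_space \<gamma> by fact
  interpret pair_prob_space Q \<gamma> ..
  have [measurable_cong]: "sets Q = sets borel" "sets \<gamma> = sets borel" by fact+
  have meas [measurable]: "(\<lambda>(x, z). iexp ((k *\<^sub>R (y - x)) \<bullet> z)) \<in> borel_measurable (Q \<Otimes>\<^sub>M \<gamma>)"
  proof -
    have "(\<lambda>p::'a \<times> 'a. iexp ((k *\<^sub>R (y - fst p)) \<bullet> snd p)) \<in> borel_measurable borel"
      by (intro borel_measurable_continuous_onI continuous_intros)
    moreover have "sets (Q \<Otimes>\<^sub>M \<gamma>) = sets (borel :: ('a \<times> 'a) measure)"
      unfolding borel_prod[symmetric] by (rule sets_pair_measure_cong[OF Q(2) \<gamma>(2)])
    ultimately show ?thesis by (subst measurable_cong_sets[OF _ refl]) (auto simp: case_prod_unfold)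
  qed
  have int: "integrable (Q \<Otimes>\<^sub>M \<gamma>) (\<lambda>(x, z). iexp ((k *\<^sub>R (y - x)) \<bullet> z))"
    by (rule integrable_const_bound[of _ 1]) (use meas in auto)
  have "complex_of_real (LINT x|Q. gauss (k *\<^sub>R (y - x))) = (CLINT x|Q. char_fun \<gamma> (k *\<^sub>R (y - x)))"
    by (simp add: char)
  also have "\<dots> = (CLINT x|Q. CLINT z|\<gamma>. iexp ((k *\<^sub>R (y - x)) \<bullet> z))"
    by (simp only: char_fun_def)
  also have "\<dots> = (CLINT z|\<gamma>. CLINT x|Q. iexp ((k *\<^sub>R (y - x)) \<bullet> z))"
    by (rule Fubini_integral[OF int, symmetric])
  also have "\<dots> = (CLINT z|\<gamma>. iexp ((k *\<^sub>R y) \<bullet> z) * char_fun Q (- k *\<^sub>R z))"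
  proof (rule Bochner_Integration.integral_cong[OF refl])
    fix z
    have "iexp ((k *\<^sub>R (y - x)) \<bullet> z) = iexp ((k *\<^sub>R y) \<bullet> z) * iexp ((- k *\<^sub>R z) \<bullet> x)" for x
      by (simp add: exp_add[symmetric] inner_diff_left algebra_simps inner_commute)
    then show "(CLINT x|Q. iexp ((k *\<^sub>R (y - x)) \<bullet> z)) = iexp ((k *\<^sub>R y) \<bullet> z) * char_fun Q (- k *\<^sub>R z)"
      unfolding char_fun_def by (simp only: integral_mult_right_zero)
  qed
  finally show ?thesis .
qed

lemma char_fun_measurable:
  fixes Q :: "'a::euclidean_space measure"
  assumes Q: "prob_space Q" "sets Q = sets borel"
  shows "char_fun Q \<in> borel_measurable borel"
proof -
  interpret Q: prob_space Q by fact
  have "(\<lambda>p::'a \<times> 'a. iexp (fst p \<bullet> snd p)) \<in> borel_measurable borel"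
    by (intro borel_measurable_continuous_onI continuous_intros)
  moreover have "sets (borel \<Otimes>\<^sub>M Q) = sets (borel :: ('a \<times> 'a) measure)"
    unfolding borel_prod[symmetric] by (rule sets_pair_measure_cong[OF refl Q(2)])
  ultimately have "(\<lambda>(t, x). iexp (t \<bullet> x)) \<in> borel_measurable (borel \<Otimes>\<^sub>M Q)"
    by (subst measurable_cong_sets[OF _ refl]) (auto simp: case_prod_unfold)
  then show ?thesis unfolding char_fun_def[abs_def] by (rule Q.borel_measurable_lebesgue_integral)
qed

text \<open>After the Parseval identity the characteristic functions stand under an integral over a
  probability measure and are bounded by 1, so dominated convergence applies.\<close>

lemma smooth_density_tendsto:
  fixes P :: "'a::euclidean_space measure"
  assumes Pn: "\<And>n. prob_space (Pn n)" "\<And>n. sets (Pn n) = sets borel"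
    and P: "prob_space P" "sets P = sets borel"
    and lim: "\<And>t. (\<lambda>n. char_fun (Pn n) t) \<longlonglongrightarrow> char_fun P t"
  shows "(\<lambda>n. smooth_density k (Pn n) y) \<longlonglongrightarrow> smooth_density k P y"
proof -
  obtain \<gamma> :: "'a measure" where \<gamma>: "prob_space \<gamma>" "sets \<gamma> = sets borel"
    and char: "\<And>t. char_fun \<gamma> t = of_real (gauss t)" using gauss_is_char_fun by blast
  interpret G: prob_space \<gamma> by fact
  have [measurable_cong]: "sets \<gamma> = sets borel" by fact
  have cm: "(\<lambda>z. iexp ((k *\<^sub>R y) \<bullet> z) * char_fun Q (- k *\<^sub>R z)) \<in> borel_measurable \<gamma>"
    if "prob_space Q" "sets Q = sets borel" for Q
  proof -
    note char_fun_measurable[OF that, measurable]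
    show ?thesis by measurable
  qed
  have "(\<lambda>n. CLINT z|\<gamma>. iexp ((k *\<^sub>R y) \<bullet> z) * char_fun (Pn n) (- k *\<^sub>R z)) \<longlonglongrightarrow>
      (CLINT z|\<gamma>. iexp ((k *\<^sub>R y) \<bullet> z) * char_fun P (- k *\<^sub>R z))"
  proof (rule integral_dominated_convergence[where w = "\<lambda>_. 1"])
    show "AE z in \<gamma>. (\<lambda>n. iexp ((k *\<^sub>R y) \<bullet> z) * char_fun (Pn n) (- k *\<^sub>R z))
        \<longlonglongrightarrow> iexp ((k *\<^sub>R y) \<bullet> z) * char_fun P (- k *\<^sub>R z)"
      by (intro AE_I2 tendsto_mult tendsto_const lim)
    show "AE z in \<gamma>. cmod (iexp ((k *\<^sub>R y) \<bullet> z) * char_fun (Pn n) (- k *\<^sub>R z)) \<le> 1" for n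
      using norm_char_fun_le_1[OF Pn] by (simp add: norm_mult)
  qed (rule cm[OF P], rule cm[OF Pn], simp)
  then have "(\<lambda>n. complex_of_real (LINT x|Pn n. gauss (k *\<^sub>R (y - x)))) \<longlonglongrightarrow>
      complex_of_real (LINT x|P. gauss (k *\<^sub>R (y - x)))"
    by (simp only: smooth_density_char_fun[OF _ _ \<gamma> char] Pn P)
  then have "(\<lambda>n. LINT x|Pn n. gauss (k *\<^sub>R (y - x))) \<longlonglongrightarrow> (LINT x|P. gauss (k *\<^sub>R (y - x)))"
    by (simp only: tendsto_of_real_iff)
  then show ?thesis unfolding smooth_density_def by (intro tendsto_mult tendsto_const)
qed

text \<open>Densities of total mass 1 that converge pointwise to such a density converge in L1 by
  Scheffe's lemma, and this is enough for every bounded measurable \<open>f\<close>.\<close>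

lemma smoothed_integral_tendsto:
  fixes P :: "'a::ordered_euclidean_space measure" and f :: "'a \<Rightarrow> real"
  assumes Pn: "\<And>n. prob_space (Pn n)" "\<And>n. sets (Pn n) = sets borel"
    and P: "prob_space P" "sets P = sets borel"
    and lim: "\<And>t. (\<lambda>n. char_fun (Pn n) t) \<longlonglongrightarrow> char_fun P t"
    and k: "k > 0" and f [measurable]: "f \<in> borel_measurable borel" and B: "\<And>x. \<bar>f x\<bar> \<le> B"
  shows "(\<lambda>n. LINT x|(Pn n \<star> gauss_law k). f x) \<longlonglongrightarrow> (LINT x|(P \<star> gauss_law k). f x)"
proof -
  let ?r = "smooth_density k"
  note smooth_density_measurable[OF P, measurable] smooth_density_measurable[OF Pn, measurable]
  have tot: "(\<integral>\<^sup>+y. ennreal (?r Q y) \<partial>lborel) = 1" if Q: "prob_space Q" "sets Q = sets borel" for Q :: "'a measure"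
  proof -
    note smooth_density_measurable[OF Q, measurable]
    interpret prob_space "density lborel (\<lambda>y. ennreal (?r Q y))"
      using prob_space_convolution[OF Q(1) gauss_law(1) Q(2) gauss_law(2), of k]
      by (simp add: convolution_gauss_law[OF Q k])
    show ?thesis using emeasure_space_1 by (simp add: emeasure_density)
  qed
  have int: "integrable lborel (?r Q)" if Q: "prob_space Q" "sets Q = sets borel" for Q :: "'a measure"
  proof -
    note smooth_density_measurable[OF Q, measurable]
    show ?thesis using tot[OF Q] by (intro integrableI_nonneg) (auto simp: smooth_density_nonneg[OF k])
  qed
  have rep: "(LINT x|(Q \<star> gauss_law k). f x) = (LINT y|lborel. ?r Q y * f y)"
    if Q: "prob_space Q" "sets Q = sets borel" for Q :: "'a measure"
  proof -
    note smooth_density_measurable[OF Q, measurable]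
    show ?thesis unfolding convolution_gauss_law[OF Q k]
      by (subst integral_density) (auto simp: smooth_density_nonneg[OF k])
  qed
  have intf: "integrable lborel (\<lambda>y. ?r Q y * f y)"
    if Q: "prob_space Q" "sets Q = sets borel" for Q :: "'a measure"
  proof -
    note smooth_density_measurable[OF Q, measurable]
    have "integrable lborel (\<lambda>y. B * ?r Q y)" using int[OF Q] by simp
    then show ?thesis
    proof (rule Bochner_Integration.integrable_bound)
      show "AE y in lborel. norm (?r Q y * f y) \<le> norm (B * ?r Q y)"
      proof (intro AE_I2)
        fix y
        have "\<bar>?r Q y\<bar> * \<bar>f y\<bar> \<le> \<bar>?r Q y\<bar> * \<bar>B\<bar>"
          using B[of y] by (intro mult_left_mono) auto
        then show "norm (?r Q y * f y) \<le> norm (B * ?r Q y)" by (simp add: abs_mult mult.commute)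
      qed
    qed measurable
  qed
  have "(\<lambda>n. \<integral>\<^sup>+y. norm (?r (Pn n) y - ?r P y) \<partial>lborel) \<longlonglongrightarrow> 0"
    using smooth_density_tendsto[OF Pn P lim] tot[OF Pn] tot[OF P]
    by (intro Scheffe_lemma2 int P) (auto simp: smooth_density_nonneg[OF k] intro!: AE_I2)
  moreover have "(\<integral>\<^sup>+y. norm (?r (Pn n) y - ?r P y) \<partial>lborel) = ennreal (LINT y|lborel. \<bar>?r (Pn n) y - ?r P y\<bar>)" for n
    using int[OF Pn] int[OF P] by (subst nn_integral_eq_integral) auto
  ultimately have L1: "(\<lambda>n. LINT y|lborel. \<bar>?r (Pn n) y - ?r P y\<bar>) \<longlonglongrightarrow> 0"
    by (simp add: ennreal_tendsto_0_iff)
  have "\<bar>(LINT x|(Pn n \<star> gauss_law k). f x) - (LINT x|(P \<star> gauss_law k). f x)\<bar>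
      \<le> B * (LINT y|lborel. \<bar>?r (Pn n) y - ?r P y\<bar>)" for n
  proof -
    have "\<bar>(LINT x|(Pn n \<star> gauss_law k). f x) - (LINT x|(P \<star> gauss_law k). f x)\<bar>
        = norm (LINT y|lborel. (?r (Pn n) y - ?r P y) * f y)"
      using intf[OF Pn] intf[OF P] by (simp add: rep[OF Pn] rep[OF P] left_diff_distrib)
    also have "\<dots> \<le> (LINT y|lborel. B * \<bar>?r (Pn n) y - ?r P y\<bar>)"
    proof (rule Bochner_Integration.integral_norm_bound_integral)
      show "integrable lborel (\<lambda>y. (?r (Pn n) y - ?r P y) * f y)"
        using intf[OF Pn] intf[OF P] by (simp add: left_diff_distrib)
      show "integrable lborel (\<lambda>y. B * \<bar>?r (Pn n) y - ?r P y\<bar>)"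
        using int[OF Pn] int[OF P] by auto
      show "norm ((?r (Pn n) y - ?r P y) * f y) \<le> B * \<bar>?r (Pn n) y - ?r P y\<bar>" for y
        using mult_left_mono[OF B[of y], of "\<bar>?r (Pn n) y - ?r P y\<bar>"] by (simp add: abs_mult mult.commute)
    qed
    finally show ?thesis by simp
  qed
  then have le: "\<forall>n. norm ((LINT x|(Pn n \<star> gauss_law k). f x) - (LINT x|(P \<star> gauss_law k). f x))
      \<le> B * (LINT y|lborel. \<bar>?r (Pn n) y - ?r P y\<bar>)" by simp
  have "(\<lambda>n. B * (LINT y|lborel. \<bar>?r (Pn n) y - ?r P y\<bar>)) \<longlonglongrightarrow> 0"
    using tendsto_mult[OF tendsto_const[of B] L1] by simp
  then have "(\<lambda>n. (LINT x|(Pn n \<star> gauss_law k). f x) - (LINT x|(P \<star> gauss_law k). f x)) \<longlonglongrightarrow> 0"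
    by (rule Lim_null_comparison[OF always_eventually[OF le]])
  then show ?thesis by (rule LIM_zero_cancel)
qed

section \<open>Removing the smoothing\<close>

lemma gauss_law_concentrated:
  assumes B: "B \<ge> 0"
  shows "(\<lambda>n. LINT z|(gauss_law (real (Suc n)) :: 'a::euclidean_space measure). min (norm z) B) \<longlonglongrightarrow> 0"
proof -
  let ?D = "density lborel (\<lambda>x. ennreal (gauss (x::'a) / gauss_mass TYPE('a)))"
  interpret prob_space ?D by (rule prob_space_gauss_density)
  have eq: "(LINT z|(gauss_law (real (Suc n)) :: 'a measure). min (norm z) B)
      = (LINT z|?D. min (norm z / real (Suc n)) B)" for n
    unfolding gauss_law_def by (subst integral_distr) (auto simp: divide_inverse mult.commute)
  have lim: "(\<lambda>n. min (norm z / real (Suc n)) B) \<longlonglongrightarrow> 0" for z :: 'a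
    using tendsto_min[OF LIMSEQ_Suc[OF lim_const_over_n[of "norm z"]] tendsto_const[of B]] B
    by (simp del: of_nat_Suc)
  have "(\<lambda>n. LINT z|?D. min (norm z / real (Suc n)) B) \<longlonglongrightarrow> (LINT z|?D. 0)"
    by (rule integral_dominated_convergence[where w = "\<lambda>_. B"]) (use B in \<open>auto intro!: AE_I2 lim simp del: of_nat_Suc\<close>)
  then show ?thesis using B by (simp add: eq del: of_nat_Suc)
qed

text \<open>Smoothing changes the integral of \<open>f\<close> by an amount that is small uniformly
  over all laws, so \<open>k\<close> is fixed first and \<open>n\<close> afterwards. Since the limit
  is given as a probability law, no mass escapes: its smoothed density has integral 1, which is what
  Scheffe's lemma uses.\<close>

theorem char_fun_continuity:
  fixes P :: "'a::ordered_euclidean_space measure" and f :: "'a \<Rightarrow> real"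
  assumes Pn: "\<And>n. prob_space (Pn n)" "\<And>n. sets (Pn n) = sets borel"
    and P: "prob_space P" "sets P = sets borel"
    and lim: "\<And>t. (\<lambda>n. char_fun (Pn n) t) \<longlonglongrightarrow> char_fun P t"
    and f: "lip1_bounded f"
  shows "(\<lambda>n. LINT x|Pn n. f x) \<longlonglongrightarrow> (LINT x|P. f x)"
proof -
  note [measurable] = lip1_bounded_measurable[OF f]
  obtain B where B: "\<And>x. \<bar>f x\<bar> \<le> B" using f by (auto simp: lip1_bounded_def)
  \<comment> \<open>The bound depends on the noise alone: a translation by \<open>z\<close> changes
    \<open>f\<close> by at most \<open>norm z\<close> and by at most \<open>2 * B\<close>.\<close>
  have smooth: "\<bar>(LINT x|(Q \<star> gauss_law k). f x) - (LINT x|Q. f x)\<bar>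
      \<le> (LINT z|(gauss_law k :: 'a measure). min (norm z) (2 * B))"
    if Q: "prob_space Q" "sets Q = sets borel" for Q and k :: real
  proof -
    let ?K = "gauss_law k :: 'a measure"
    have "0 \<le> B" using B[of 0] by linarith
    interpret Q: prob_space Q by fact
    interpret K: prob_space ?K by (rule gauss_law)
    have [measurable_cong]: "sets Q = sets borel" "sets ?K = sets borel" by (simp_all add: Q gauss_law)
    have iK: "integrable ?K (\<lambda>z. f (x + z))" for x
      by (rule bounded_measurable_integrable[OF gauss_law, of _ B]) (use B in auto)
    have bK: "\<bar>LINT z|?K. f (x + z)\<bar> \<le> B" for x
      by (rule abs_bounded_integral[OF gauss_law]) (use B in auto)
    have im: "integrable ?K (\<lambda>z. min (norm z) (2 * B))"
      using \<open>0 \<le> B\<close> by (intro bounded_measurable_integrable[OF gauss_law, of _ "2 * B"]) auto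
    have iQ: "integrable Q (\<lambda>x. LINT z|?K. f (x + z))"
      by (rule bounded_measurable_integrable[OF Q, of _ B]) (use bK in auto)
    have "(LINT x|(Q \<star> ?K). f x) - (LINT x|Q. f x) = (LINT x|Q. (LINT z|?K. f (x + z)) - f x)"
      using iQ bounded_measurable_integrable[OF Q, of f B] B
      by (subst integral_convolution[OF Q(1) gauss_law(1) Q(2) gauss_law(2), of _ B]) auto
    also have "\<bar>\<dots>\<bar> \<le> (LINT z|?K. min (norm z) (2 * B))"
    proof (rule abs_bounded_integral[OF Q])
      show "(\<lambda>x. (LINT z|?K. f (x + z)) - f x) \<in> borel_measurable borel" by measurable
      fix x
      have "(LINT z|?K. f (x + z)) - f x = (LINT z|?K. f (x + z) - f x)"
        using iK by (subst Bochner_Integration.integral_diff) (auto simp: K.prob_space)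
      also have "norm \<dots> \<le> (LINT z|?K. min (norm z) (2 * B))"
      proof (rule Bochner_Integration.integral_norm_bound_integral[OF _ im])
        show "integrable ?K (\<lambda>z. f (x + z) - f x)" using iK by simp
        fix z
        show "norm (f (x + z) - f x) \<le> min (norm z) (2 * B)"
          using lip1_boundedD[OF f, of "x + z" x] B[of x] B[of "x + z"] by simp
      qed
      finally show "\<bar>(LINT z|?K. f (x + z)) - f x\<bar> \<le> (LINT z|?K. min (norm z) (2 * B))" by simp
    qed
    finally show ?thesis .
  qed
  show ?thesis
  proof (rule LIMSEQ_I)
    fix e :: real assume "e > 0"
    have "0 \<le> B" using B[of 0] by linarith
    then have "(\<lambda>n. LINT z|(gauss_law (real (Suc n)) :: 'a measure). min (norm z) (2 * B)) \<longlonglongrightarrow> 0"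
      using gauss_law_concentrated[of "2 * B", where 'a = 'a] by simp
    from LIMSEQ_D[OF this, where r = "e / 3"] \<open>e > 0\<close> obtain m where
      "\<bar>LINT z|(gauss_law (real (Suc m)) :: 'a measure). min (norm z) (2 * B)\<bar> < e / 3" by fastforce
    then have small': "(LINT z|(gauss_law (real (Suc m)) :: 'a measure). min (norm z) (2 * B)) < e / 3"
      by linarith
    define k where "k = real (Suc m)"
    have small: "(LINT z|(gauss_law k :: 'a measure). min (norm z) (2 * B)) < e / 3"
      unfolding k_def by (rule small')
    have "k > 0" by (simp add: k_def)
    from LIMSEQ_D[OF smoothed_integral_tendsto[OF Pn P lim \<open>k > 0\<close> lip1_bounded_measurable[OF f] B], where r = "e / 3"] \<open>e > 0\<close>
    obtain n0 where n0: "\<And>n. n \<ge> n0 \<Longrightarrow> \<bar>(LINT x|(Pn n \<star> gauss_law k). f x) - (LINT x|(P \<star> gauss_law k). f x)\<bar> < e / 3"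
      by auto
    have "norm ((LINT x|Pn n. f x) - (LINT x|P. f x)) < e" if "n \<ge> n0" for n
      using n0[OF that] smooth[OF Pn, of n k] smooth[OF P, of k] small unfolding real_norm_def by linarith
    then show "\<exists>n0. \<forall>n\<ge>n0. norm ((LINT x|Pn n. f x) - (LINT x|P. f x)) < e" by blast
  qed
qed

lemma char_fun_continuity_lipschitz:
  fixes P :: "'a::ordered_euclidean_space measure" and f :: "'a \<Rightarrow> real"
  assumes Pn: "\<And>n. prob_space (Pn n)" "\<And>n. sets (Pn n) = sets borel"
    and P: "prob_space P" "sets P = sets borel"
    and lim: "\<And>t. (\<lambda>n. char_fun (Pn n) t) \<longlonglongrightarrow> char_fun P t"
    and L: "L > 0" "\<And>x y. \<bar>f x - f y\<bar> \<le> L * norm (x - y)" and B: "\<And>x. \<bar>f x\<bar> \<le> B"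
  shows "(\<lambda>n. LINT x|Pn n. f x) \<longlonglongrightarrow> (LINT x|P. f x)"
proof -
  have "lip1_bounded (\<lambda>x. f x / L)"
    unfolding lip1_bounded_def
  proof (intro conjI allI exI)
    show "\<bar>f x / L - f y / L\<bar> \<le> norm (x - y)" for x y
      using L by (simp add: diff_divide_distrib[symmetric] abs_div field_simps)
    show "\<bar>f x / L\<bar> \<le> B / L" for x using B[of x] L(1) by (simp add: abs_div divide_right_mono)
  qed
  from char_fun_continuity[OF Pn P lim this]
  have "(\<lambda>n. (LINT x|Pn n. f x / L) * L) \<longlonglongrightarrow> (LINT x|P. f x / L) * L"
    by (intro tendsto_mult tendsto_const)
  then show ?thesis using L(1) by simp
qed

subsection \<open>Approximation of infinitely divisible laws\<close>

text \<open>If \<open>\<nu> B = 0\<close>, the jump probability \<open>p\<close> below is \<open>0\<close>, and any probability measure would do.\<close>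

definition normalized_restriction :: "'a::euclidean_space measure \<Rightarrow> 'a set \<Rightarrow> 'a measure" where
  "normalized_restriction \<nu> B =
     (if measure \<nu> B = 0 then return borel 0
      else density \<nu> (\<lambda>u. ennreal (indicator B u / measure \<nu> B)))"

text \<open>A binomial approximation of the compound Poisson law with intensity \<open>\<nu>\<close>
  restricted to \<open>B\<close>: \<open>N\<close> independent trials, each jumping with probability
  \<open>measure \<nu> B / N\<close>.\<close>

definition compound_law :: "'a::ordered_euclidean_space measure \<Rightarrow> 'a set \<Rightarrow> nat \<Rightarrow> 'a measure" where
  "compound_law \<nu> B N = conv_power (step_law (measure \<nu> B / N) (normalized_restriction \<nu> B)) N"

text \<open>The exponent in the characteristic function of that compound Poisson law.\<close>

definition jump_exponent :: "'a::euclidean_space measure \<Rightarrow> 'a set \<Rightarrow> 'a \<Rightarrow> complex" where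
  "jump_exponent \<nu> B t = (CLINT u|\<nu>. indicator B u *\<^sub>R (iexp (t \<bullet> u) - 1))"

text \<open>Integrated against \<open>\<nu>\<close>, this is the exponent of the concentration
  bound. Subtracting the linear term makes it quadratic near the origin, as integrability against a
  Levy measure demands.\<close>

definition exp_remainder :: "real \<Rightarrow> 'a::real_normed_vector \<Rightarrow> real" where
  "exp_remainder s u = exp (s * norm u) - 1 - s * norm u"

lemma exp_remainder_nonneg: "exp_remainder s u \<ge> 0"
  unfolding exp_remainder_def using exp_ge_add_one_self[of "s * norm u"] by linarith

lemma exp_remainder_measurable [measurable]: "exp_remainder s \<in> borel_measurable (borel :: 'a::euclidean_space measure)"
  unfolding exp_remainder_def by measurable

text \<open>Both bases, \<open>1 + z / of_nat N\<close> and \<open>exp (z / of_nat N)\<close>, lie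
  in the closed unit disc, so the \<open>N\<close>-th powers differ by at most \<open>N\<close>
  times the difference of the bases, which Taylor's formula makes quadratic in z / N.\<close>

lemma power_exp_approx:
  fixes z :: complex
  assumes N: "N > 0" and z: "Re z \<le> 0" "cmod (1 + z / of_nat N) \<le> 1" "cmod z \<le> real N"
  shows "cmod ((1 + z / of_nat N) ^ N - exp z) \<le> 3 * (cmod z)\<^sup>2 / real N"
proof -
  let ?w = "z / of_nat N"
  have w: "cmod ?w \<le> 1" using z(3) N by (simp add: norm_divide)
  have "exp z = exp ?w ^ N" using N by (simp add: exp_divide_power_eq)
  then have "cmod ((1 + ?w) ^ N - exp z) \<le> N * cmod (1 + ?w - exp ?w)"
    using norm_power_diff[of "1 + ?w" "exp ?w" N] z N by (simp add: divide_nonpos_pos)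
  also have "cmod (1 + ?w - exp ?w) \<le> 3 * (cmod ?w)\<^sup>2"
  proof -
    have "cmod (exp ?w - (\<Sum>k\<le>1. ?w ^ k / fact k)) \<le> exp \<bar>Re ?w\<bar> * cmod ?w ^ Suc 1 / fact 1"
      by (rule Taylor_exp)
    \<comment> \<open>The modulus of \<open>?w\<close> is at most 1, so the exponential factor is at
      most \<open>exp 1\<close>, hence at most 3.\<close>
    also have "\<dots> \<le> exp 1 * (cmod ?w)\<^sup>2"
      using w abs_Re_le_cmod[of ?w] by (auto simp: power2_eq_square intro!: mult_right_mono)
    also have "\<dots> \<le> 3 * (cmod ?w)\<^sup>2" using exp_le by (intro mult_right_mono) auto
    finally show ?thesis by (simp add: norm_minus_commute algebra_simps)
  qed
  also have "real N * (3 * (cmod ?w)\<^sup>2) = 3 * (cmod z)\<^sup>2 / real N"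
    using N by (simp add: norm_divide power2_eq_square)
  finally show ?thesis using N by simp
qed

section \<open>Restriction of the Levy measure to a set of finite mass\<close>

context
  fixes \<nu> :: "'a::euclidean_space measure" and B :: "'a set"
  assumes nu [measurable_cong]: "sets \<nu> = sets borel" and B [measurable]: "B \<in> sets borel" and fin: "emeasure \<nu> B \<noteq> \<infinity>"
begin

lemma space_nu: "space \<nu> = UNIV"
  using sets_eq_imp_space_eq[OF nu] by simp

lemma emeasure_B: "emeasure \<nu> B = ennreal (measure \<nu> B)"
  using fin by (simp add: emeasure_eq_ennreal_measure top.not_eq_extremum)

lemma integrable_indicator_bounded:
  fixes f :: "'a \<Rightarrow> 'b::{banach, second_countable_topology}"
  assumes [measurable]: "f \<in> borel_measurable borel" and K: "\<And>u. u \<in> B \<Longrightarrow> norm (f u) \<le> K"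
  shows "integrable \<nu> (\<lambda>u. indicator B u *\<^sub>R f u)"
proof (rule Bochner_Integration.integrable_bound)
  show "integrable \<nu> (\<lambda>u. K * indicator B u)"
    using fin by (intro integrable_mult_right integrable_real_indicator) (auto simp: nu less_top)
  show "AE u in \<nu>. norm (indicator B u *\<^sub>R f u) \<le> norm (K * indicator B u)"
    using K by (intro AE_I2) (fastforce split: split_indicator)
qed measurable

lemma prob_space_normalized_restriction: "prob_space (normalized_restriction \<nu> B)"
proof (cases "measure \<nu> B = 0")
  case False
  then have pos: "measure \<nu> B > 0" using measure_nonneg[of \<nu> B] by linarith
  have "(\<integral>\<^sup>+u. ennreal (indicator B u / measure \<nu> B) \<partial>\<nu>) = (\<integral>\<^sup>+u. ennreal (1 / measure \<nu> B) * indicator B u \<partial>\<nu>)"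
    by (intro nn_integral_cong) (auto split: split_indicator)
  also have "\<dots> = ennreal (1 / measure \<nu> B) * ennreal (measure \<nu> B)"
    by (subst nn_integral_cmult_indicator) (auto simp: emeasure_B)
  also have "\<dots> = 1" using pos by (simp add: ennreal_mult[symmetric])
  finally have "(\<integral>\<^sup>+u. ennreal (indicator B u / measure \<nu> B) \<partial>\<nu>) = 1" .
  then show ?thesis using False
    by (intro prob_spaceI) (simp add: normalized_restriction_def emeasure_density space_nu)
qed (auto simp: normalized_restriction_def intro: prob_space_return)

lemma sets_normalized_restriction: "sets (normalized_restriction \<nu> B) = sets borel"
  by (simp add: normalized_restriction_def nu)

text \<open>A product with \<open>measure \<nu> B\<close> rather than a quotient: if
  \<open>B\<close> has measure 0 both sides vanish, so later formulas need no case
  distinction.\<close>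

lemma integral_normalized_restriction:
  fixes f :: "'a \<Rightarrow> 'b::{banach, second_countable_topology}"
  assumes [measurable]: "f \<in> borel_measurable borel"
  shows "measure \<nu> B *\<^sub>R (LINT u|normalized_restriction \<nu> B. f u) = (LINT u|\<nu>. indicator B u *\<^sub>R f u)"
proof (cases "measure \<nu> B = 0")
  case True
  then have "B \<in> null_sets \<nu>" by (intro null_setsI) (auto simp: emeasure_B nu)
  then have "AE u in \<nu>. indicator B u *\<^sub>R f u = 0"
    by (rule AE_I'[where N = B]) (auto split: split_indicator)
  then show ?thesis using True by (simp add: integral_eq_zero_AE)
next
  case False
  then have pos: "measure \<nu> B > 0" using measure_nonneg[of \<nu> B] by linarith
  have "(LINT u|normalized_restriction \<nu> B. f u) = (LINT u|\<nu>. (indicator B u / measure \<nu> B) *\<^sub>R f u)"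
    using False by (simp add: normalized_restriction_def) (subst integral_density, auto)
  also have "\<dots> = (1 / measure \<nu> B) *\<^sub>R (LINT u|\<nu>. indicator B u *\<^sub>R f u)"
    by (subst integral_scaleR_right[symmetric]) simp
  finally show ?thesis using pos by simp
qed

lemma integrable_normalized_restriction:
  fixes f :: "'a \<Rightarrow> 'b::{banach, second_countable_topology}"
  assumes [measurable]: "f \<in> borel_measurable borel" and int: "integrable \<nu> (\<lambda>u. indicator B u *\<^sub>R f u)"
  shows "integrable (normalized_restriction \<nu> B) f"
proof (cases "measure \<nu> B = 0")
  case True
  interpret prob_space "return borel (0::'a)" by (rule prob_space_return) simp
  have "AE u in return borel 0. norm (f u) \<le> norm (f 0)" by (subst AE_return) auto
  then show ?thesis using True by (simp add: normalized_restriction_def integrable_const_bound)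
next
  case False
  have "integrable \<nu> (\<lambda>u. (1 / measure \<nu> B) *\<^sub>R (indicator B u *\<^sub>R f u))" by (intro integrable_scaleR_right int)
  then show ?thesis using False
    by (simp add: normalized_restriction_def) (subst integrable_density, auto)
qed

lemma jump_exponent_bounds:
  shows "cmod (jump_exponent \<nu> B t) \<le> 2 * measure \<nu> B" and "Re (jump_exponent \<nu> B t) \<le> 0"
proof -
  have 2: "cmod (iexp (t \<bullet> u) - 1) \<le> 2" for u
    using norm_triangle_ineq4[of "iexp (t \<bullet> u)" 1] by simp
  have int: "integrable \<nu> (\<lambda>u. indicator B u *\<^sub>R (iexp (t \<bullet> u) - 1))"
    by (rule integrable_indicator_bounded[of _ 2]) (use 2 in auto)
  have "integrable \<nu> (\<lambda>u. indicator B u *\<^sub>R (2::real))"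
    by (rule integrable_indicator_bounded[of _ 2]) auto
  then have "cmod (jump_exponent \<nu> B t) \<le> (LINT u|\<nu>. indicator B u *\<^sub>R 2)"
    unfolding jump_exponent_def using 2
    by (intro Bochner_Integration.integral_norm_bound_integral int) (auto split: split_indicator)
  then show "cmod (jump_exponent \<nu> B t) \<le> 2 * measure \<nu> B" by (simp add: space_nu)
  have "Re (jump_exponent \<nu> B t) = (LINT u|\<nu>. Re (indicator B u *\<^sub>R (iexp (t \<bullet> u) - 1)))"
    unfolding jump_exponent_def by (rule integral_Re[OF int, symmetric])
  also have "\<dots> = - (LINT u|\<nu>. indicator B u * (1 - cos (t \<bullet> u)))"
    by (subst integral_minus[symmetric], intro Bochner_Integration.integral_cong)
      (auto split: split_indicator simp: Re_exp)
  also have "\<dots> \<le> 0"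
    by (simp add: Bochner_Integration.integral_nonneg)
  finally show "Re (jump_exponent \<nu> B t) \<le> 0" .
qed

end

section \<open>Binomial approximation of compound Poisson laws\<close>

context
  fixes \<nu> :: "'a::ordered_euclidean_space measure" and B :: "'a set" and N :: nat
  assumes nu [measurable_cong]: "sets \<nu> = sets borel" and B [measurable]: "B \<in> sets borel" and fin: "emeasure \<nu> B \<noteq> \<infinity>"
    and N: "N > 0" "measure \<nu> B \<le> real N"
begin

lemma step_bounds: "0 \<le> measure \<nu> B / real N" "measure \<nu> B / real N \<le> 1"
  using N by auto

lemmas step_facts = step_bounds prob_space_normalized_restriction[OF nu B fin]
  sets_normalized_restriction[OF nu B fin]

lemma prob_space_compound_law: "prob_space (compound_law \<nu> B N)"
  and sets_compound_law: "sets (compound_law \<nu> B N) = sets borel"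
  unfolding compound_law_def by (simp_all add: prob_space_conv_power prob_space_step_law step_facts)

lemma char_fun_compound_step:
  "char_fun (step_law (measure \<nu> B / real N) (normalized_restriction \<nu> B)) t = 1 + jump_exponent \<nu> B t / of_nat N"
proof -
  have "of_real (measure \<nu> B) * (CLINT u|normalized_restriction \<nu> B. iexp (t \<bullet> u) - 1) = jump_exponent \<nu> B t"
    using integral_normalized_restriction[OF nu B fin, of "\<lambda>u. iexp (t \<bullet> u) - 1"]
    by (simp add: jump_exponent_def scaleR_conv_of_real[where 'a = complex])
  then show ?thesis by (subst char_fun_step_law) (auto simp: step_facts)
qed

lemma char_fun_compound_law:
  "char_fun (compound_law \<nu> B N) t = (1 + jump_exponent \<nu> B t / of_nat N) ^ N"
  unfolding compound_law_def
  by (simp add: char_fun_conv_power prob_space_step_law step_facts char_fun_compound_step)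

lemma char_fun_compound_law_approx:
  assumes "2 * measure \<nu> B \<le> real N"
  shows "cmod (char_fun (compound_law \<nu> B N) t - exp (jump_exponent \<nu> B t)) \<le> 12 * (measure \<nu> B)\<^sup>2 / real N"
proof -
  note b = jump_exponent_bounds[OF nu B fin, of t]
  \<comment> \<open>This number is itself the characteristic function of one step, hence of modulus
    at most 1.\<close>
  have "cmod (1 + jump_exponent \<nu> B t / of_nat N) \<le> 1"
    unfolding char_fun_compound_step[symmetric]
    by (rule norm_char_fun_le_1[OF prob_space_step_law sets_step_law]) (simp_all add: step_facts)
  then have "cmod (char_fun (compound_law \<nu> B N) t - exp (jump_exponent \<nu> B t))
      \<le> 3 * (cmod (jump_exponent \<nu> B t))\<^sup>2 / real N"
    unfolding char_fun_compound_law using b assms N by (intro power_exp_approx) auto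
  \<comment> \<open>The jump exponent is at most twice the mass of \<open>B\<close>, which turns the
    constant 3 into 12.\<close>
  also have "\<dots> \<le> 3 * (2 * measure \<nu> B)\<^sup>2 / real N"
    using b by (intro divide_right_mono mult_left_mono power_mono) auto
  finally show ?thesis by (simp add: power_mult_distrib)
qed

text \<open>The exponent of one step is 1 / N times the integral over \<open>B\<close>; the
  \<open>N\<close> steps add up to that integral, whatever \<open>N\<close> is.\<close>

lemma exp_conc_compound_law:
  assumes s: "s \<ge> 0" and int: "integrable \<nu> (\<lambda>u. indicator B u *\<^sub>R exp_remainder s u)"
  shows "exp_conc s (LINT u|\<nu>. indicator B u *\<^sub>R exp_remainder s u) (compound_law \<nu> B N)"
proof -
  have "exp_conc s (measure \<nu> B / N * (LINT u|normalized_restriction \<nu> B. exp_remainder s u))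
      (step_law (measure \<nu> B / N) (normalized_restriction \<nu> B))"
    unfolding exp_remainder_def
    using integrable_normalized_restriction[OF nu B fin exp_remainder_measurable int]
    by (intro exp_conc_step_law step_facts s) (simp add: exp_remainder_def[abs_def])
  then have "exp_conc s (real N * (measure \<nu> B / N * (LINT u|normalized_restriction \<nu> B. exp_remainder s u))) (compound_law \<nu> B N)"
    unfolding compound_law_def by (intro exp_conc_conv_power prob_space_step_law step_facts) auto
  then show ?thesis
    using integral_normalized_restriction[OF nu B fin exp_remainder_measurable[of s]] N by simp
qed

end

section \<open>The truncated Levy-Khintchine exponent\<close>

definition levy_integrand :: "'a::euclidean_space \<Rightarrow> 'a \<Rightarrow> complex" where
  "levy_integrand t u = iexp (t \<bullet> u) - 1 - \<i> * complex_of_real (t \<bullet> u) * indicator (cball 0 1) u"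

lemma levy_integrand_measurable [measurable]:
  fixes t :: "'a::euclidean_space"
  shows "levy_integrand t \<in> borel_measurable borel"
proof -
  have "(\<lambda>u. complex_of_real (t \<bullet> u)) \<in> borel_measurable borel"
    by (intro borel_measurable_continuous_onI continuous_intros)
  moreover have "(indicator (cball 0 1) :: 'a \<Rightarrow> complex) \<in> borel_measurable borel"
    by (intro borel_measurable_indicator) simp
  ultimately show ?thesis unfolding levy_integrand_def[abs_def]
    by (intro borel_measurable_diff borel_measurable_times borel_measurable_const iexp_inner_measurable)
qed

text \<open>Inside the unit ball the compensated integrand is a second-order Taylor remainder,
  outside it is bounded by 2; the factor covers both cases.\<close>

lemma norm_levy_integrand_le:
  "cmod (levy_integrand t u) \<le> ((norm t)\<^sup>2 + 2) * min 1 ((norm u)\<^sup>2)"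
proof (cases "norm u \<le> 1")
  case True
  have "cmod (iexp (t \<bullet> u) - (\<Sum>k\<le>1. (\<i> * (t \<bullet> u)) ^ k / fact k)) \<le> \<bar>t \<bullet> u\<bar> ^ Suc 1 / fact (Suc 1)"
    by (rule iexp_approx1)
  then have "cmod (levy_integrand t u) \<le> \<bar>t \<bullet> u\<bar>\<^sup>2 / 2"
    using True by (simp add: levy_integrand_def dist_norm numeral_2_eq_2 algebra_simps)
  also have "\<dots> \<le> (norm t * norm u)\<^sup>2 / 2"
    by (intro divide_right_mono power_mono Cauchy_Schwarz_ineq2) auto
  also have "\<dots> \<le> ((norm t)\<^sup>2 + 2) * (norm u)\<^sup>2" by (simp add: power_mult_distrib algebra_simps)
  also have "(norm u)\<^sup>2 = min 1 ((norm u)\<^sup>2)" using True by (simp add: power_le_one min_absorb2)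
  finally show ?thesis .
next
  case False
  then have "1 \<le> (norm u)\<^sup>2" by (simp add: one_le_power)
  then have "min 1 ((norm u)\<^sup>2) = 1" by simp
  moreover have "cmod (levy_integrand t u) \<le> 2"
    using False norm_triangle_ineq4[of "iexp (t \<bullet> u)" 1] by (simp add: levy_integrand_def dist_norm)
  ultimately show ?thesis using zero_le_power2[of "norm t"] by (simp add: add_increasing)
qed

text \<open>The cutoff at 1 / (n + 1) excludes the origin and makes the mass finite. The boundary 1
  belongs to the small jumps, matching the closed unit ball of the truncation.\<close>

definition small_jumps :: "nat \<Rightarrow> 'a::real_normed_vector set" where
  "small_jumps n = {u. 1 / real (Suc n) < norm u \<and> norm u \<le> 1}"

definition big_jumps :: "'a::real_normed_vector set" where
  "big_jumps = {u. 1 < norm u}"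

lemma jumps_measurable [measurable]:
  "small_jumps n \<in> sets (borel :: 'a::euclidean_space measure)"
  "big_jumps \<in> sets (borel :: 'a::euclidean_space measure)"
  unfolding small_jumps_def big_jumps_def by measurable

text \<open>Replacing \<open>exp z\<close> by \<open>(1 + z / N) ^ N\<close> costs \<open>O(\<bar>z\<bar>\<^sup>2 / N)\<close>, hence the square.\<close>

definition approx_steps :: "'a::euclidean_space measure \<Rightarrow> nat \<Rightarrow> nat" where
  "approx_steps \<nu> n =
     nat \<lceil>real (Suc n) * (2 * measure \<nu> (small_jumps n) + 2 * measure \<nu> big_jumps + 1)\<^sup>2\<rceil>"

text \<open>The shift subtracts the mean of the retained small jumps; it supplies the compensating
  term of the Levy-Khintchine exponent.\<close>

definition approx_small :: "'a::ordered_euclidean_space measure \<Rightarrow> 'a \<Rightarrow> nat \<Rightarrow> 'a measure" where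
  "approx_small \<nu> \<beta> n =
     (return borel (\<beta> - (LINT u|\<nu>. indicator (small_jumps n) u *\<^sub>R u)) \<star>
       compound_law \<nu> (small_jumps n) (approx_steps \<nu> n))"

text \<open>The big jumps are a separate convolution factor so that moment estimates can condition
  on the rest.\<close>

definition approx_law :: "'a::ordered_euclidean_space measure \<Rightarrow> 'a \<Rightarrow> nat \<Rightarrow> 'a measure" where
  "approx_law \<nu> \<beta> n = (approx_small \<nu> \<beta> n \<star> compound_law \<nu> big_jumps (approx_steps \<nu> n))"

context
  fixes \<nu> :: "'a::ordered_euclidean_space measure"
  assumes levy: "levy_measure \<nu>"
begin

lemma sets_levy: "sets \<nu> = sets borel"
  using levy by (simp add: levy_measure_def)

lemma integrable_levy:
  fixes f :: "'a \<Rightarrow> 'b::{banach, second_countable_topology}"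
  assumes [measurable]: "f \<in> borel_measurable borel"
    and K: "\<And>u. norm (f u) \<le> K * min 1 ((norm u)\<^sup>2)"
  shows "integrable \<nu> f"
proof (rule Bochner_Integration.integrable_bound)
  note sets_levy [measurable_cong]
  show "integrable \<nu> (\<lambda>u. K * min 1 ((norm u)\<^sup>2))"
  proof (intro integrable_mult_right integrableI_nonneg)
    show "(\<integral>\<^sup>+u. ennreal (min 1 ((norm u)\<^sup>2)) \<partial>\<nu>) < \<infinity>"
      using levy by (simp only: levy_measure_def)
  qed simp_all
  show "AE u in \<nu>. norm (f u) \<le> norm (K * min 1 ((norm u)\<^sup>2))"
    by (intro AE_I2 order_trans[OF K]) simp
  show "f \<in> borel_measurable \<nu>" by measurable
qed

lemma levy_finite_away:
  assumes [measurable]: "B \<in> sets borel" and e: "e > 0" and B: "\<And>u. u \<in> B \<Longrightarrow> e \<le> norm u"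
  shows "emeasure \<nu> B \<noteq> \<infinity>"
proof -
  have e2: "min 1 (e\<^sup>2) > 0" using e by simp
  have "integrable \<nu> (\<lambda>u. indicator B u :: real)"
  proof (rule integrable_levy[of _ "1 / min 1 (e\<^sup>2)"])
    fix u
    have "u \<in> B \<Longrightarrow> min 1 (e\<^sup>2) \<le> min 1 ((norm u)\<^sup>2)"
      using B[of u] e by (intro min.mono power_mono) auto
    then show "norm (indicator B u :: real) \<le> 1 / min 1 (e\<^sup>2) * min 1 ((norm u)\<^sup>2)"
      using e2 by (auto split: split_indicator simp: field_simps)
  qed measurable
  then show ?thesis
    by (simp add: integrable_indicator_iff sets_levy less_top Int_absorb2 sets_eq_imp_space_eq[OF sets_levy])
qed

lemma small_jumps_fin: "emeasure \<nu> (small_jumps n) \<noteq> \<infinity>"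
  by (rule levy_finite_away[of _ "1 / real (Suc n)"]) (auto simp: small_jumps_def[symmetric] simp del: of_nat_Suc, auto simp: small_jumps_def)

lemma big_jumps_fin: "emeasure \<nu> big_jumps \<noteq> \<infinity>"
  by (rule levy_finite_away[of _ 1]) (auto simp: big_jumps_def[symmetric], auto simp: big_jumps_def)

lemma approx_steps_bounds:
  fixes n :: nat
  defines "m \<equiv> measure \<nu> (small_jumps n)" and "c \<equiv> measure \<nu> big_jumps" and "N \<equiv> approx_steps \<nu> n"
  shows "N > 0" "2 * m \<le> real N" "2 * c \<le> real N" "m\<^sup>2 / real N \<le> 1 / real (Suc n)" "c\<^sup>2 / real N \<le> 1 / real (Suc n)"
proof -
  let ?q = "2 * m + 2 * c + 1"
  have mc: "m \<ge> 0" "c \<ge> 0" by (simp_all add: m_def c_def)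
  have N: "real N \<ge> real (Suc n) * ?q\<^sup>2"
    unfolding N_def approx_steps_def m_def c_def by (rule of_nat_ceiling)
  \<comment> \<open>The added 1 makes \<open>?q\<close> at least 1 and so at most its square: one
    choice of \<open>N\<close> serves the linear and the quadratic bounds, and \<open>N\<close> is
    positive.\<close>
  have "1 * ?q \<le> ?q * ?q" using mc by (intro mult_right_mono) auto
  then have q: "?q \<le> ?q\<^sup>2" by (simp add: power2_eq_square)
  moreover have "1 * ?q\<^sup>2 \<le> real (Suc n) * ?q\<^sup>2" by (intro mult_right_mono) auto
  ultimately have qN: "?q \<le> real N" using N by linarith
  show pos: "N > 0" using qN mc by (intro gr0I) auto
  show "2 * m \<le> real N" "2 * c \<le> real N" using qN mc by linarith+
  have "real (Suc n) * m\<^sup>2 \<le> real (Suc n) * ?q\<^sup>2" "real (Suc n) * c\<^sup>2 \<le> real (Suc n) * ?q\<^sup>2"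
    using mc by (auto intro!: mult_left_mono power_mono)
  then have "real (Suc n) * m\<^sup>2 \<le> real N" "real (Suc n) * c\<^sup>2 \<le> real N" using N by linarith+
  then show "m\<^sup>2 / real N \<le> 1 / real (Suc n)" "c\<^sup>2 / real N \<le> 1 / real (Suc n)"
    using pos by (simp_all add: field_simps del: of_nat_Suc)
qed

lemma approx_steps_bounds': "measure \<nu> (small_jumps n) \<le> real (approx_steps \<nu> n)"
  "measure \<nu> big_jumps \<le> real (approx_steps \<nu> n)"
  using approx_steps_bounds[of n] measure_nonneg[of \<nu> "small_jumps n"] measure_nonneg[of \<nu> big_jumps] by linarith+

lemmas small_facts = sets_levy jumps_measurable(1) small_jumps_fin approx_steps_bounds(1) approx_steps_bounds'(1)
lemmas big_facts = sets_levy jumps_measurable(2) big_jumps_fin approx_steps_bounds(1) approx_steps_bounds'(2)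

lemma prob_space_approx_small: "prob_space (approx_small \<nu> \<beta> n)"
  and sets_approx_small: "sets (approx_small \<nu> \<beta> n) = sets borel"
  unfolding approx_small_def
  by (auto intro!: prob_space_convolution prob_space_return
      prob_space_compound_law[OF small_facts] sets_compound_law[OF small_facts])

lemma prob_space_approx_big: "prob_space (compound_law \<nu> big_jumps (approx_steps \<nu> n))"
  and sets_approx_big: "sets (compound_law \<nu> big_jumps (approx_steps \<nu> n)) = sets borel"
  by (rule prob_space_compound_law[OF big_facts] sets_compound_law[OF big_facts])+

lemma prob_space_approx_law: "prob_space (approx_law \<nu> \<beta> n)"
  and sets_approx_law: "sets (approx_law \<nu> \<beta> n) = sets borel"
  unfolding approx_law_def
  by (auto intro!: prob_space_convolution prob_space_approx_small sets_approx_small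
      prob_space_approx_big sets_approx_big)

lemma integrable_jump_exponent:
  assumes "B \<in> sets borel" "emeasure \<nu> B \<noteq> \<infinity>"
  shows "integrable \<nu> (\<lambda>u. indicator B u *\<^sub>R (iexp (t \<bullet> u) - 1))"
proof (rule integrable_indicator_bounded[OF sets_levy assms, of _ 2])
  show "cmod (iexp (t \<bullet> u) - 1) \<le> 2" for u
    using norm_triangle_ineq4[of "iexp (t \<bullet> u)" 1] by simp
qed measurable

text \<open>The compensator in the drift and the two jump exponents recombine into the integral of
  \<open>levy_integrand\<close> beyond the cutoff; a multiple of
  \<open>min 1 ((norm u)\<^sup>2)\<close> dominates as the cutoff shrinks.\<close>

lemma approx_exponent_tendsto:
  "(\<lambda>n. \<i> * of_real (t \<bullet> (\<beta> - (LINT u|\<nu>. indicator (small_jumps n) u *\<^sub>R u)))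
      + jump_exponent \<nu> (small_jumps n) t + jump_exponent \<nu> big_jumps t)
    \<longlonglongrightarrow> \<i> * of_real (t \<bullet> \<beta>) + (CLINT u|\<nu>. levy_integrand t u)"
proof -
  note sets_levy [measurable_cong]
  let ?A = "\<lambda>n. {u::'a. 1 / real (Suc n) < norm u}"
  have [measurable]: "?A n \<in> sets borel" for n by measurable
  have eq: "\<i> * of_real (t \<bullet> (\<beta> - (LINT u|\<nu>. indicator (small_jumps n) u *\<^sub>R u)))
      + jump_exponent \<nu> (small_jumps n) t + jump_exponent \<nu> big_jumps t
      = \<i> * of_real (t \<bullet> \<beta>) + (CLINT u|\<nu>. indicator (?A n) u *\<^sub>R levy_integrand t u)" for n
  proof -
    have i1: "integrable \<nu> (\<lambda>u. indicator (small_jumps n) u *\<^sub>R (iexp (t \<bullet> u) - 1))"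
      by (rule integrable_jump_exponent[OF jumps_measurable(1) small_jumps_fin])
    have i2: "integrable \<nu> (\<lambda>u. indicator big_jumps u *\<^sub>R (iexp (t \<bullet> u) - 1))"
      by (rule integrable_jump_exponent[OF jumps_measurable(2) big_jumps_fin])
    have i3: "integrable \<nu> (\<lambda>u. indicator (small_jumps n) u *\<^sub>R u)"
      by (rule integrable_indicator_bounded[OF sets_levy _ small_jumps_fin, of _ _ 1])
        (auto simp: small_jumps_def[symmetric], auto simp: small_jumps_def)
    have i4: "integrable \<nu> (\<lambda>u. t \<bullet> (indicator (small_jumps n) u *\<^sub>R u))"
      using i3 by (rule integrable_inner_right)
    have i5: "complex_integrable \<nu> (\<lambda>u. \<i> * of_real (t \<bullet> (indicator (small_jumps n) u *\<^sub>R u)))"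
      by (intro integrable_mult_right integrable_of_real i4)
    have drift: "t \<bullet> (LINT u|\<nu>. indicator (small_jumps n) u *\<^sub>R u) = (LINT u|\<nu>. t \<bullet> (indicator (small_jumps n) u *\<^sub>R u))"
      using i3 by (rule integral_inner_right[symmetric])
    have "(CLINT u|\<nu>. indicator (?A n) u *\<^sub>R levy_integrand t u) =
       (CLINT u|\<nu>. indicator (small_jumps n) u *\<^sub>R (iexp (t \<bullet> u) - 1)
          + indicator big_jumps u *\<^sub>R (iexp (t \<bullet> u) - 1)
          - \<i> * of_real (t \<bullet> (indicator (small_jumps n) u *\<^sub>R u)))"
    proof (rule Bochner_Integration.integral_cong[OF refl])
      fix u :: 'a
      \<comment> \<open>Since the cutoff is at most 1, every big jump lies beyond it, and three
        cases remain: up to the cutoff, from there to 1, above 1.\<close>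
      have "1 / real (Suc n) \<le> 1" by simp
      then consider "u \<notin> ?A n" "u \<notin> small_jumps n" "u \<notin> big_jumps"
        | "u \<in> ?A n" "u \<in> small_jumps n" "u \<notin> big_jumps" "norm u \<le> 1"
        | "u \<in> ?A n" "u \<notin> small_jumps n" "u \<in> big_jumps" "\<not> norm u \<le> 1"
        unfolding small_jumps_def big_jumps_def mem_Collect_eq by linarith
      then show "indicator (?A n) u *\<^sub>R levy_integrand t u =
          indicator (small_jumps n) u *\<^sub>R (iexp (t \<bullet> u) - 1)
          + indicator big_jumps u *\<^sub>R (iexp (t \<bullet> u) - 1)
          - \<i> * of_real (t \<bullet> (indicator (small_jumps n) u *\<^sub>R u))"
        by cases (simp_all add: levy_integrand_def dist_norm del: of_nat_Suc)
    qed
    also have "\<dots> = jump_exponent \<nu> (small_jumps n) t + jump_exponent \<nu> big_jumps t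
        - \<i> * of_real (t \<bullet> (LINT u|\<nu>. indicator (small_jumps n) u *\<^sub>R u))"
      by (simp only: Bochner_Integration.integral_diff[OF Bochner_Integration.integrable_add[OF i1 i2] i5]
          Bochner_Integration.integral_add[OF i1 i2] drift jump_exponent_def
          integral_complex_of_real integral_mult_right_zero)
    finally show ?thesis by (simp add: inner_diff_right right_diff_distrib)
  qed
  have dom: "integrable \<nu> (\<lambda>u. ((norm t)\<^sup>2 + 2) * min 1 ((norm u)\<^sup>2))"
    by (rule integrable_levy[of _ "(norm t)\<^sup>2 + 2"]) (auto simp: abs_mult)
  have "(\<lambda>n. CLINT u|\<nu>. indicator (?A n) u *\<^sub>R levy_integrand t u) \<longlonglongrightarrow> (CLINT u|\<nu>. levy_integrand t u)"
  proof (rule integral_dominated_convergence[OF _ _ dom])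
    show "AE u in \<nu>. (\<lambda>n. indicator (?A n) u *\<^sub>R levy_integrand t u) \<longlonglongrightarrow> levy_integrand t u"
    proof (intro AE_I2)
      fix u :: 'a
      show "(\<lambda>n. indicator (?A n) u *\<^sub>R levy_integrand t u) \<longlonglongrightarrow> levy_integrand t u"
      \<comment> \<open>The origin is never beyond the cutoff, but the integrand vanishes
        there.\<close>
      proof (cases "u = 0")
        case False
        have "eventually (\<lambda>n. 1 / real (Suc n) < norm u) sequentially"
          using order_tendstoD(2)[OF LIMSEQ_Suc[OF lim_const_over_n[of 1]], of "norm u"] False by simp
        then have "eventually (\<lambda>n. indicator (?A n) u *\<^sub>R levy_integrand t u = levy_integrand t u) sequentially"
          by eventually_elim simp
        then show ?thesis by (rule tendsto_eventually)
      qed (simp add: levy_integrand_def)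
    qed
    show "AE u in \<nu>. cmod (indicator (?A n) u *\<^sub>R levy_integrand t u) \<le> ((norm t)\<^sup>2 + 2) * min 1 ((norm u)\<^sup>2)" for n
    proof (intro AE_I2)
      fix u :: 'a
      have "cmod (indicator (?A n) u *\<^sub>R levy_integrand t u) \<le> cmod (levy_integrand t u)"
        by (auto split: split_indicator)
      then show "cmod (indicator (?A n) u *\<^sub>R levy_integrand t u) \<le> ((norm t)\<^sup>2 + 2) * min 1 ((norm u)\<^sup>2)"
        using norm_levy_integrand_le[of t u] by linarith
    qed
  qed measurable
  then show ?thesis unfolding eq by (intro tendsto_add tendsto_const)
qed

text \<open>The approximants are compared with the exponentials of their own exponents, with an
  error of order 1 / n, and these exponents converge. All factors have modulus at most 1, so the
  errors of the two compound laws simply add.\<close>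

lemma char_fun_approx_law_tendsto:
  "(\<lambda>n. char_fun (approx_law \<nu> \<beta> n) t) \<longlonglongrightarrow> exp (\<i> * of_real (t \<bullet> \<beta>) + (CLINT u|\<nu>. levy_integrand t u))"
proof -
  define d where "d n = \<beta> - (LINT u|\<nu>. indicator (small_jumps n) u *\<^sub>R u)" for n
  define a where "a n = char_fun (compound_law \<nu> (small_jumps n) (approx_steps \<nu> n)) t" for n
  define b where "b n = char_fun (compound_law \<nu> big_jumps (approx_steps \<nu> n)) t" for n
  define z where "z n = jump_exponent \<nu> (small_jumps n) t" for n
  define w where "w = jump_exponent \<nu> big_jumps t"
  have char: "char_fun (approx_law \<nu> \<beta> n) t = iexp (t \<bullet> d n) * a n * b n" for n
    unfolding approx_law_def
    by (subst char_fun_convolution[OF prob_space_approx_small prob_space_approx_big sets_approx_small sets_approx_big])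
      (simp add: approx_small_def char_fun_convolution prob_space_return char_fun_return a_def b_def d_def
        prob_space_compound_law[OF small_facts] sets_compound_law[OF small_facts])
  have az: "cmod (a n - exp (z n)) \<le> 12 * (1 / real (Suc n))" for n
    using char_fun_compound_law_approx[OF small_facts approx_steps_bounds(2), of n t] approx_steps_bounds(4)[of n]
    unfolding a_def z_def by (simp del: of_nat_Suc)
  have bw: "cmod (b n - exp w) \<le> 12 * (1 / real (Suc n))" for n
    using char_fun_compound_law_approx[OF big_facts approx_steps_bounds(3), of n t] approx_steps_bounds(5)[of n]
    unfolding b_def w_def by (simp del: of_nat_Suc)
  have b1: "cmod (b n) \<le> 1" for n
    unfolding b_def by (rule norm_char_fun_le_1[OF prob_space_approx_big sets_approx_big])
  have z1: "cmod (exp (z n)) \<le> 1" for n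
    using jump_exponent_bounds(2)[OF sets_levy jumps_measurable(1) small_jumps_fin] by (simp add: z_def)
  have bound: "cmod (char_fun (approx_law \<nu> \<beta> n) t - exp (\<i> * of_real (t \<bullet> d n) + z n + w)) \<le> 24 * (1 / real (Suc n))" for n
  proof -
    have "char_fun (approx_law \<nu> \<beta> n) t - exp (\<i> * of_real (t \<bullet> d n) + z n + w)
        = iexp (t \<bullet> d n) * ((a n - exp (z n)) * b n + exp (z n) * (b n - exp w))"
      by (simp add: char exp_add algebra_simps)
    also have "cmod \<dots> = cmod ((a n - exp (z n)) * b n + exp (z n) * (b n - exp w))"
      by (subst norm_mult) simp
    also have "\<dots> \<le> cmod (a n - exp (z n)) * cmod (b n) + cmod (exp (z n)) * cmod (b n - exp w)"
      unfolding norm_mult[symmetric] by (rule norm_triangle_ineq)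
    also have "\<dots> \<le> cmod (a n - exp (z n)) * 1 + 1 * cmod (b n - exp w)"
      by (intro add_mono mult_left_mono mult_right_mono b1 z1) auto
    also have "\<dots> \<le> 24 * (1 / real (Suc n))" using az[of n] bw[of n] by linarith
    finally show ?thesis .
  qed
  have "(\<lambda>n. 24 * (1 / real (Suc n))) \<longlonglongrightarrow> 24 * 0"
    by (intro tendsto_mult tendsto_const LIMSEQ_Suc lim_const_over_n)
  then have lim0: "(\<lambda>n. 24 * (1 / real (Suc n))) \<longlonglongrightarrow> 0" by (simp only: mult_zero_right)
  have "\<forall>n. norm (char_fun (approx_law \<nu> \<beta> n) t - exp (\<i> * of_real (t \<bullet> d n) + z n + w)) \<le> 24 * (1 / real (Suc n))"
    using bound by blast
  then have null: "(\<lambda>n. char_fun (approx_law \<nu> \<beta> n) t - exp (\<i> * of_real (t \<bullet> d n) + z n + w)) \<longlonglongrightarrow> 0"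
    by (rule Lim_null_comparison[OF always_eventually lim0])
  have "(\<lambda>n. exp (\<i> * of_real (t \<bullet> d n) + z n + w)) \<longlonglongrightarrow> exp (\<i> * of_real (t \<bullet> \<beta>) + (CLINT u|\<nu>. levy_integrand t u))"
    unfolding d_def z_def w_def by (intro tendsto_exp approx_exponent_tendsto)
  from tendsto_add[OF null this] show ?thesis by simp
qed

end

lemma exp_diff_le:
  fixes a b M :: real
  assumes "a \<le> M" "b \<le> M"
  shows "\<bar>exp a - exp b\<bar> \<le> exp M * \<bar>a - b\<bar>"
proof -
  have *: "exp a - exp b \<le> exp M * \<bar>a - b\<bar>" if "a \<le> M" for a b :: real
  proof (cases "a \<le> b")
    case True
    then have "exp a - exp b \<le> 0" by simp
    also have "0 \<le> exp M * \<bar>a - b\<bar>" by simp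
    finally show ?thesis .
  next
    case False
    have "exp b = exp a * exp (b - a)" by (simp add: exp_add[symmetric])
    moreover have "exp a * (1 + (b - a)) \<le> exp a * exp (b - a)"
      by (intro mult_left_mono exp_ge_add_one_self) auto
    ultimately have "exp a - exp b \<le> exp a * (a - b)" by (simp add: algebra_simps)
    also have "\<dots> \<le> exp M * \<bar>a - b\<bar>" using that False by (intro mult_mono) auto
    finally show ?thesis .
  qed
  from *[OF assms(1), of b] *[OF assms(2), of a] show ?thesis by (simp add: abs_minus_commute abs_le_iff)
qed

text \<open>The first bound keeps the event that no step jumps, the second the events that exactly
  one does; \<open>(1 - p) ^ n\<close> in place of the exact exponent \<open>n - 1\<close> only
  weakens it.\<close>

lemma step_conv_power_lower:
  fixes \<rho> :: "'a::ordered_euclidean_space measure" and f :: "'a \<Rightarrow> real"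
  assumes p: "0 \<le> p" "p \<le> 1" and rho: "prob_space \<rho>" "sets \<rho> = sets borel"
    and f: "f \<in> borel_measurable borel" and B: "\<And>x. 0 \<le> f x" "\<And>x. f x \<le> B"
  shows "(1 - p) ^ n * f 0 \<le> (LINT x|conv_power (step_law p \<rho>) n. f x)"
    and "real n * p * (1 - p) ^ n * (LINT x|\<rho>. f x) \<le> (LINT x|conv_power (step_law p \<rho>) n. f x)"
proof -
  let ?mu = "step_law p \<rho>" and ?C = "conv_power (step_law p \<rho>)"
  note mu = prob_space_step_law[OF p rho] sets_step_law[of p \<rho>]
  note C = prob_space_conv_power[OF mu]
  interpret rho: prob_space \<rho> by fact
  have meas: "(\<lambda>x. LINT y|?C n. f (x + y)) \<in> borel_measurable borel"
    if [measurable]: "f \<in> borel_measurable borel" for n and f :: "'a \<Rightarrow> real"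
  proof -
    interpret C: prob_space "?C n" by (rule C)
    have [measurable_cong]: "sets (?C n) = sets borel" by simp
    show ?thesis by measurable
  qed
  have shift: "(\<lambda>y. f (x + y)) \<in> borel_measurable borel" if [measurable]: "f \<in> borel_measurable borel"
    for x and f :: "'a \<Rightarrow> real" by measurable
  have bound: "0 \<le> (LINT y|?C n. f (x + y))" "\<bar>LINT y|?C n. f (x + y)\<bar> \<le> B"
    if "f \<in> borel_measurable borel" "\<And>x. 0 \<le> f x" "\<And>x. f x \<le> B" for n x and f :: "'a \<Rightarrow> real"
  proof -
    show "0 \<le> (LINT y|?C n. f (x + y))" using that by (intro Bochner_Integration.integral_nonneg) auto
    show "\<bar>LINT y|?C n. f (x + y)\<bar> \<le> B"
      by (rule abs_bounded_integral[OF C sets_conv_power shift]) (use that in auto)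
  qed
  have step: "(LINT x|?C (Suc n). f x) = p * (LINT x|\<rho>. LINT y|?C n. f (x + y)) + (1 - p) * (LINT y|?C n. f y)"
    if "f \<in> borel_measurable borel" "\<And>x. 0 \<le> f x" "\<And>x. f x \<le> B" for n and f :: "'a \<Rightarrow> real"
  proof -
    have "(LINT x|?C (Suc n). f x) = (LINT x|?mu. LINT y|?C n. f (x + y))"
      unfolding conv_power.simps
      by (rule integral_convolution[OF mu(1) C mu(2) sets_conv_power that(1), of B]) (use that in auto)
    also have "\<dots> = p *\<^sub>R (LINT x|\<rho>. LINT y|?C n. f (x + y)) + (1 - p) *\<^sub>R (LINT y|?C n. f (0 + y))"
      by (rule integral_step_law[OF p rho meas, where B = B]) (use that bound[OF that] in auto)
    finally show ?thesis by simp
  qed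
  have int: "integrable \<rho> (\<lambda>x. LINT y|?C n. f (x + y))" "integrable \<rho> f"
    if "f \<in> borel_measurable borel" "\<And>x. 0 \<le> f x" "\<And>x. f x \<le> B" for n and f :: "'a \<Rightarrow> real"
    by (rule bounded_measurable_integrable[OF rho meas[OF that(1)], of _ B]
        bounded_measurable_integrable[OF rho that(1), of B]; use that bound in simp)+
  have zero: "(1 - p) ^ n * f 0 \<le> (LINT x|?C n. f x)"
    if "f \<in> borel_measurable borel" "\<And>x. 0 \<le> f x" "\<And>x. f x \<le> B" for n and f :: "'a \<Rightarrow> real"
  proof (induction n)
    case 0
    then show ?case using that by (simp add: integral_return)
  next
    case (Suc n)
    have "(1 - p) * ((1 - p) ^ n * f 0) \<le> (1 - p) * (LINT x|?C n. f x)"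
      using Suc p by (intro mult_left_mono) auto
    moreover have "0 \<le> p * (LINT x|\<rho>. LINT y|?C n. f (x + y))"
      using p bound(1)[OF that] by (intro mult_nonneg_nonneg Bochner_Integration.integral_nonneg[of \<rho>]) auto
    ultimately show ?case by (simp only: step[OF that] power_Suc mult.assoc)
  qed
  show "(1 - p) ^ n * f 0 \<le> (LINT x|?C n. f x)" by (rule zero[OF f B])
  show "real n * p * (1 - p) ^ n * (LINT x|\<rho>. f x) \<le> (LINT x|?C n. f x)"
  proof (induction n)
    case 0
    show ?case using bound(1)[OF f B, of 0 0] by simp
  next
    case (Suc n)
    have I: "(LINT x|\<rho>. f x) \<ge> 0" using B by (intro Bochner_Integration.integral_nonneg) auto
    \<comment> \<open>The contribution of a jump at the first step: the remaining steps vanish, by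
      the first bound applied to the translate of \<open>f\<close>.\<close>
    have "(1 - p) ^ n * (LINT x|\<rho>. f x) = (LINT x|\<rho>. (1 - p) ^ n * f x)" by simp
    also have "\<dots> \<le> (LINT x|\<rho>. LINT y|?C n. f (x + y))"
    proof (rule integral_mono)
      show "(1 - p) ^ n * f x \<le> (LINT y|?C n. f (x + y))" for x
        using zero[OF shift[OF f], of x n] B by simp
    qed (use int[OF f B] in auto)
    finally have "p * ((1 - p) ^ n * (LINT x|\<rho>. f x)) \<le> p * (LINT x|\<rho>. LINT y|?C n. f (x + y))"
      using p by (intro mult_left_mono) auto
    moreover have "p * ((1 - p) ^ Suc n * (LINT x|\<rho>. f x)) \<le> p * ((1 - p) ^ n * (LINT x|\<rho>. f x))"
      using p I by (intro mult_left_mono mult_right_mono power_decreasing) auto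
    moreover have "(1 - p) * (real n * p * (1 - p) ^ n * (LINT x|\<rho>. f x)) \<le> (1 - p) * (LINT x|?C n. f x)"
      using Suc p by (intro mult_left_mono) auto
    ultimately show ?case unfolding step[OF f B] by (simp add: algebra_simps)
  qed
qed

text \<open>Bounds the probability of no jump from below independently of \<open>N\<close>. It rests
  on \<open>(1 + 2 * p) * (1 - p) \<ge> 1\<close> for \<open>p\<close> between 0 and 1 / 2.\<close>

lemma one_minus_power_ge:
  assumes "0 \<le> c" "2 * c \<le> real N" "N > 0"
  shows "exp (- 2 * c) \<le> (1 - c / real N) ^ N"
proof -
  define p where "p = c / real N"
  have p: "0 \<le> p" "p \<le> 1 / 2" using assms by (auto simp: field_simps p_def)
  have "p * p \<le> 1 / 2 * p" using p by (intro mult_right_mono) auto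
  then have "1 \<le> (1 + 2 * p) * (1 - p)" by (simp add: algebra_simps)
  also have "\<dots> \<le> exp (2 * p) * (1 - p)"
    using p by (intro mult_right_mono exp_ge_add_one_self) auto
  finally have "exp (- (2 * p)) \<le> 1 - p" by (simp add: exp_minus field_simps)
  then have "exp (- (2 * p)) ^ N \<le> (1 - p) ^ N" by (intro power_mono) auto
  then show ?thesis using assms by (simp add: exp_of_nat_mult[symmetric] p_def)
qed

section \<open>Passage to the infinitely divisible law\<close>

context
  fixes P :: "'a::ordered_euclidean_space measure" and \<beta> :: 'a and \<nu> :: "'a measure"
  assumes id: "infinitely_divisible_law P \<beta> \<nu>"
begin

lemma id_facts: "prob_space P" "sets P = sets borel" "levy_measure \<nu>"
  using id by (simp_all add: infinitely_divisible_law_def)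

lemma approx_law_tendsto:
  fixes f :: "'a \<Rightarrow> real"
  assumes "L > 0" "\<And>x y. \<bar>f x - f y\<bar> \<le> L * norm (x - y)" "\<And>x. \<bar>f x\<bar> \<le> B"
  shows "(\<lambda>n. LINT x|approx_law \<nu> \<beta> n. f x) \<longlonglongrightarrow> (LINT x|P. f x)"
proof (rule char_fun_continuity_lipschitz[OF _ _ id_facts(1,2) _ assms])
  show "prob_space (approx_law \<nu> \<beta> n)" "sets (approx_law \<nu> \<beta> n) = sets borel" for n
    by (rule prob_space_approx_law[OF id_facts(3)] sets_approx_law[OF id_facts(3)])+
  show "(\<lambda>n. char_fun (approx_law \<nu> \<beta> n) t) \<longlonglongrightarrow> char_fun P t" for t
  proof -
    have "char_fun P t = exp (\<i> * of_real (t \<bullet> \<beta>) + (CLINT u|\<nu>. levy_integrand t u))"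
      using id unfolding infinitely_divisible_law_def char_fun_def levy_integrand_def by blast
    then show ?thesis using char_fun_approx_law_tendsto[OF id_facts(3), of \<beta> t] by simp
  qed
qed

text \<open>The exponents of the two jump factors add up to at most the integral over the whole
  space, for every \<open>n\<close>. Both sides of the inequality then converge, since they involve
  integrals of bounded Lipschitz functions.\<close>

theorem exp_conc_infinitely_divisible:
  assumes s: "s \<ge> 0" and int: "integrable \<nu> (exp_remainder s)"
  shows "exp_conc s (LINT u|\<nu>. exp_remainder s u) P"
  unfolding exp_conc_def
proof (intro allI impI)
  fix G :: "'a \<Rightarrow> real" assume G: "lip1_bounded G"
  obtain B where B: "\<And>x. \<bar>G x\<bar> \<le> B" using G by (auto simp: lip1_bounded_def)
  let ?H = "LINT u|\<nu>. exp_remainder s u"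
  note [measurable] = jumps_measurable
  have sets: "sets \<nu> = sets borel" by (rule sets_levy[OF id_facts(3)])
  have i: "integrable \<nu> (\<lambda>u. indicator S u *\<^sub>R exp_remainder s u)" if "S \<in> sets borel" for S
    using that int by (intro integrable_mult_indicator) (auto simp: sets)
  have conc: "exp_conc s ?H (approx_law \<nu> \<beta> n)" for n
  proof -
    let ?K1 = "LINT u|\<nu>. indicator (small_jumps n) u *\<^sub>R exp_remainder s u"
    let ?K2 = "LINT u|\<nu>. indicator big_jumps u *\<^sub>R exp_remainder s u"
    note sf = small_facts[OF id_facts(3)] and bf = big_facts[OF id_facts(3)]
    have "exp_conc s (0 + ?K1) (approx_small \<nu> \<beta> n)"
      unfolding approx_small_def
      by (intro exp_conc_convolution exp_conc_return exp_conc_compound_law[OF sf] s i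
          prob_space_return prob_space_compound_law[OF sf] sets_compound_law[OF sf]) auto
    then have "exp_conc s ((0 + ?K1) + ?K2) (approx_law \<nu> \<beta> n)"
      unfolding approx_law_def
      by (intro exp_conc_convolution exp_conc_compound_law[OF bf] s i
          prob_space_approx_small[OF id_facts(3)] sets_approx_small[OF id_facts(3)]
          prob_space_compound_law[OF bf] sets_compound_law[OF bf]) auto
    moreover have "0 + ?K1 + ?K2 \<le> ?H"
    proof -
      have "?K1 + ?K2 = (LINT u|\<nu>. indicator (small_jumps n) u *\<^sub>R exp_remainder s u + indicator big_jumps u *\<^sub>R exp_remainder s u)"
        by (rule Bochner_Integration.integral_add[symmetric]) (intro i jumps_measurable)+
      also have "\<dots> \<le> ?H"
      proof (rule integral_mono[OF _ int])
        show "integrable \<nu> (\<lambda>u. indicator (small_jumps n) u *\<^sub>R exp_remainder s u + indicator big_jumps u *\<^sub>R exp_remainder s u)"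
          by (intro Bochner_Integration.integrable_add i jumps_measurable)
        show "indicator (small_jumps n) u *\<^sub>R exp_remainder s u + indicator big_jumps u *\<^sub>R exp_remainder s u \<le> exp_remainder s u" for u
          using exp_remainder_nonneg[of s u] by (auto split: split_indicator simp: small_jumps_def big_jumps_def)
      qed
      finally show ?thesis by simp
    qed
    ultimately show ?thesis unfolding exp_conc_def
      by (meson add_le_cancel_right exp_le_cancel_iff order_trans)
  qed
  have lim1: "(\<lambda>n. LINT x|approx_law \<nu> \<beta> n. G x) \<longlonglongrightarrow> (LINT x|P. G x)"
    by (rule approx_law_tendsto[of 1 _ B]) (use lip1_boundedD[OF G] B in auto)
  have sB: "s * G x \<le> s * B" for x using B[of x] s by (intro mult_left_mono) auto
  have lim2: "(\<lambda>n. LINT x|approx_law \<nu> \<beta> n. exp (s * G x)) \<longlonglongrightarrow> (LINT x|P. exp (s * G x))"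
  proof (rule approx_law_tendsto)
    \<comment> \<open>A Lipschitz constant of \<open>exp (s * G x)\<close> in \<open>x\<close>; the
      added 1 keeps it positive when \<open>s = 0\<close>.\<close>
    show "0 < exp (s * B) * s + 1" using s by (intro add_nonneg_pos) auto
    show "\<bar>exp (s * G x)\<bar> \<le> exp (s * B)" for x using sB by simp
    fix x y
    have "\<bar>exp (s * G x) - exp (s * G y)\<bar> \<le> exp (s * B) * \<bar>s * G x - s * G y\<bar>"
      by (rule exp_diff_le[OF sB sB])
    also have "\<dots> = exp (s * B) * s * \<bar>G x - G y\<bar>"
      using s by (simp add: right_diff_distrib[symmetric] abs_mult)
    also have "\<dots> \<le> exp (s * B) * s * norm (x - y)"
      using s by (intro mult_left_mono lip1_boundedD[OF G]) auto
    finally show "\<bar>exp (s * G x) - exp (s * G y)\<bar> \<le> (exp (s * B) * s + 1) * norm (x - y)"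
      by (simp add: distrib_right add_increasing2)
  qed
  have "(\<lambda>n. exp (?H + s * (LINT x|approx_law \<nu> \<beta> n. G x))) \<longlonglongrightarrow> exp (?H + s * (LINT x|P. G x))"
    by (intro tendsto_intros lim1)
  then show "(LINT x|P. exp (s * G x)) \<le> exp (?H + s * (LINT x|P. G x))"
    using conc G unfolding exp_conc_def by (intro LIMSEQ_le[OF lim2]) auto
qed

end

subsection \<open>Exponential moments of the Levy measure\<close>

context
  fixes P :: "'a::ordered_euclidean_space measure" and \<beta> :: 'a and \<nu> :: "'a measure"
  assumes id: "infinitely_divisible_law P \<beta> \<nu>"
begin

text \<open>The events of no big jump and of exactly one, with a constant \<open>q\<close> that does
  not depend on \<open>n\<close> and therefore survives the limit.\<close>

lemma big_jumps_lower:
  fixes f :: "'a \<Rightarrow> real" and n :: nat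
  assumes f: "f \<in> borel_measurable borel" and B: "\<And>x. 0 \<le> f x" "\<And>x. f x \<le> B"
  defines "q \<equiv> exp (- 2 * measure \<nu> big_jumps)" and "R \<equiv> compound_law \<nu> big_jumps (approx_steps \<nu> n)"
  shows "q * f 0 \<le> (LINT x|R. f x)"
    and "q * (LINT u|\<nu>. indicator big_jumps u * f u) \<le> (LINT x|R. f x)"
proof -
  note levy = id_facts(3)[OF id]
  note bf = sets_levy[OF levy] jumps_measurable(2) big_jumps_fin[OF levy]
  let ?N = "approx_steps \<nu> n" and ?c = "measure \<nu> big_jumps"
  let ?rho = "normalized_restriction \<nu> big_jumps"
  have N: "?N > 0" "2 * ?c \<le> real ?N" by (rule approx_steps_bounds[OF levy])+
  have p: "0 \<le> ?c / real ?N" "?c / real ?N \<le> 1" using N approx_steps_bounds'(2)[OF levy, of n] by auto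
  have q: "q \<le> (1 - ?c / real ?N) ^ ?N"
    unfolding q_def by (rule one_minus_power_ge) (use N in auto)
  note rho = prob_space_normalized_restriction[OF bf] sets_normalized_restriction[OF bf]
  have "q * f 0 \<le> (1 - ?c / real ?N) ^ ?N * f 0" using q B by (intro mult_right_mono) auto
  also have "\<dots> \<le> (LINT x|R. f x)"
    unfolding R_def compound_law_def by (rule step_conv_power_lower(1)[OF p rho f B])
  finally show "q * f 0 \<le> (LINT x|R. f x)" .
  have I: "(LINT u|\<nu>. indicator big_jumps u * f u) = ?c * (LINT x|?rho. f x)"
    using integral_normalized_restriction[OF bf f] by simp
  have "(LINT x|?rho. f x) \<ge> 0" using B by (intro Bochner_Integration.integral_nonneg) auto
  then have "q * (?c * (LINT x|?rho. f x)) \<le> (1 - ?c / real ?N) ^ ?N * (?c * (LINT x|?rho. f x))"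
    using q by (intro mult_right_mono) auto
  also have "\<dots> = real ?N * (?c / real ?N) * (1 - ?c / real ?N) ^ ?N * (LINT x|?rho. f x)"
    using N by simp
  also have "\<dots> \<le> (LINT x|R. f x)"
    unfolding R_def compound_law_def by (rule step_conv_power_lower(2)[OF p rho f B])
  finally show "q * (LINT u|\<nu>. indicator big_jumps u * f u) \<le> (LINT x|R. f x)" by (simp add: I)
qed

text \<open>Integrates out the big jumps first, so that a lower bound given the small-jump part
  \<open>x\<close> suffices.\<close>

lemma approx_law_lower:
  fixes f :: "'a \<Rightarrow> real"
  assumes f [measurable]: "f \<in> borel_measurable borel" and B: "\<And>x. 0 \<le> f x" "\<And>x. f x \<le> B"
    and g: "integrable (approx_small \<nu> \<beta> n) g"
      "\<And>x. g x \<le> (LINT y|compound_law \<nu> big_jumps (approx_steps \<nu> n). f (x + y))"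
  shows "(LINT x|approx_small \<nu> \<beta> n. g x) \<le> (LINT x|approx_law \<nu> \<beta> n. f x)"
proof -
  note levy = id_facts(3)[OF id]
  let ?R = "compound_law \<nu> big_jumps (approx_steps \<nu> n)"
  note R = prob_space_approx_big[OF levy, of n] sets_approx_big[OF levy, of n]
  note Q = prob_space_approx_small[OF levy, of \<beta> n] sets_approx_small[OF levy, of \<beta> n]
  interpret R: prob_space ?R by (rule R)
  note R(2) [measurable_cong]
  have m: "(\<lambda>x. LINT y|?R. f (x + y)) \<in> borel_measurable borel" by measurable
  have bd: "\<bar>LINT y|?R. f (x + y)\<bar> \<le> B" for x
    by (rule abs_bounded_integral[OF R]) (use B in auto)
  have "(LINT x|approx_small \<nu> \<beta> n. g x) \<le> (LINT x|approx_small \<nu> \<beta> n. LINT y|?R. f (x + y))"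
    by (rule integral_mono[OF g(1) bounded_measurable_integrable[OF Q m, of B]]) (use g bd in auto)
  also have "\<dots> = (LINT x|approx_law \<nu> \<beta> n. f x)"
    unfolding approx_law_def
    by (rule integral_convolution[OF Q(1) R(1) Q(2) R(2), symmetric, of _ B]) (use B in auto)
  finally show ?thesis .
qed

text \<open>A Lipschitz stand-in for the indicator of the exterior of a ball, since the weak
  convergence at hand is tested on Lipschitz functions. It vanishes up to radius \<open>R\<close>
  and equals 1 from \<open>R + 1\<close> on.\<close>

definition ramp :: "real \<Rightarrow> 'a \<Rightarrow> real" where
  "ramp R x = min 1 (max 0 (norm x - R))"

lemma ramp: "0 \<le> ramp R x" "ramp R x \<le> 1" "lip1_bounded (ramp R)" "ramp R \<in> borel_measurable borel"
proof -
  show b: "0 \<le> ramp R x" "ramp R x \<le> 1" for x by (auto simp: ramp_def)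
  have "\<bar>ramp R x - ramp R y\<bar> \<le> norm (x - y)" for x y
    using norm_triangle_ineq3[of x y] by (auto simp: ramp_def min_def max_def)
  then show l: "lip1_bounded (ramp R)"
    using b unfolding lip1_bounded_def by (auto intro!: exI[of _ 1])
  show "ramp R \<in> borel_measurable borel" by (rule lip1_bounded_measurable[OF l])
qed

text \<open>The big jumps vanish with probability bounded below, so tightness of the approximating laws
  is inherited by their small-jump parts.\<close>

lemma approx_small_tight:
  obtains R where "eventually (\<lambda>n. (LINT x|approx_small \<nu> \<beta> n. ramp R x) \<le> 1 / 2) sequentially"
proof -
  note levy = id_facts(3)[OF id]
  note PP = id_facts(1,2)[OF id]
  interpret P: prob_space P by (rule PP)
  define q where "q = exp (- 2 * measure \<nu> big_jumps)"
  have q: "q > 0" by (simp add: q_def)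
  have "(\<lambda>k. LINT x|P. ramp (real k) x) \<longlonglongrightarrow> (LINT x|P. 0)"
  proof (rule integral_dominated_convergence[where w = "\<lambda>_. 1"])
    show "AE x in P. (\<lambda>k. ramp (real k) x) \<longlonglongrightarrow> 0"
    proof (intro AE_I2 tendsto_eventually)
      fix x :: 'a
      obtain k0 where "norm x \<le> real k0" using real_arch_simple by blast
      then show "eventually (\<lambda>k. ramp (real k) x = 0) sequentially"
        by (intro eventually_sequentiallyI[of k0]) (auto simp: ramp_def)
    qed
    show "ramp (real k) \<in> borel_measurable P" for k
      using ramp(4) by (subst measurable_cong_sets[OF PP(2) refl])
    show "AE x in P. norm (ramp (real k) x) \<le> 1" for k using ramp by (intro AE_I2) simp
  qed auto
  then have "(\<lambda>k. LINT x|P. ramp (real k) x) \<longlonglongrightarrow> 0" by simp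
  \<comment> \<open>The level q / 2 becomes 1 / 2 once the factor \<open>q\<close> for the absence
    of big jumps is divided out.\<close>
  from order_tendstoD(2)[OF this, of "q / 2"] q
  obtain k where k: "(LINT x|P. ramp (real k) x) < q / 2"
    by (auto simp: eventually_sequentially)
  let ?f = "ramp (real k)"
  have "(\<lambda>n. LINT x|approx_law \<nu> \<beta> n. ?f x) \<longlonglongrightarrow> (LINT x|P. ?f x)"
    by (rule approx_law_tendsto[OF id, of 1 _ 1])
      (use lip1_boundedD[OF ramp(3)] ramp in auto)
  from order_tendstoD(2)[OF this k]
  have "eventually (\<lambda>n. (LINT x|approx_small \<nu> \<beta> n. ?f x) \<le> 1 / 2) sequentially"
  proof eventually_elim
    case (elim n)
    note Q = prob_space_approx_small[OF levy, of \<beta> n] sets_approx_small[OF levy, of \<beta> n]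
    have int: "integrable (approx_small \<nu> \<beta> n) ?f"
      by (rule bounded_measurable_integrable[OF Q ramp(4), of _ 1]) (use ramp in auto)
    have "(LINT x|approx_small \<nu> \<beta> n. q * ?f x) \<le> (LINT x|approx_law \<nu> \<beta> n. ?f x)"
    proof (rule approx_law_lower[of _ 1])
      fix x
      have "(\<lambda>y. ?f (x + y)) \<in> borel_measurable borel"
        using ramp(4)[of "real k", measurable] by measurable
      from big_jumps_lower(1)[OF this, of 1 n] ramp
      show "q * ?f x \<le> (LINT y|compound_law \<nu> big_jumps (approx_steps \<nu> n). ?f (x + y))"
        by (simp add: q_def)
    qed (use ramp int in auto)
    then have "q * (LINT x|approx_small \<nu> \<beta> n. ?f x) \<le> q / 2" using elim by simp
    then show ?case using q by simp
  qed
  then show ?thesis by (rule that)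
qed

text \<open>A jump \<open>u\<close> added to a small-jump part of norm below \<open>R + 1\<close>
  ends at norm at least \<open>norm u - R - 1\<close>, so the exponential moment of \<open>P\<close>
  dominates that of \<open>\<nu>\<close> up to a constant. Truncation at level \<open>k\<close>
  keeps the test functions bounded and Lipschitz, and Fatou's lemma removes it.\<close>

theorem levy_exp_moment:
  assumes t: "t > 0" and int: "integrable P (\<lambda>x. exp (t * norm x))"
  shows "integrable \<nu> (\<lambda>u. indicator big_jumps u * exp (t * norm u))"
proof -
  note levy = id_facts(3)[OF id]
  note PP = id_facts(1,2)[OF id]
  note sets = sets_levy[OF levy]
  note [measurable] = jumps_measurable
  note sets [measurable_cong]
  define q where "q = exp (- 2 * measure \<nu> big_jumps)"
  have q: "q > 0" by (simp add: q_def)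
  obtain R where R: "eventually (\<lambda>n. (LINT x|approx_small \<nu> \<beta> n. ramp R x) \<le> 1 / 2) sequentially"
    by (rule approx_small_tight)
  define m where "m = (LINT x|P. exp (t * norm x))"
  \<comment> \<open>The shift by \<open>R + 1\<close> allows for the displacement by the small-jump
    part.\<close>
  define J where "J k u = exp (min (t * (norm u - R - 1)) k)" for k :: real and u :: 'a
  have J [measurable]: "J k \<in> borel_measurable borel" for k unfolding J_def by measurable
  have Jb: "0 \<le> J k u" "J k u \<le> exp k" for k u by (auto simp: J_def)
  \<comment> \<open>The bound must not depend on \<open>k\<close>. The factor 2 comes from
    tightness, 1 / q from the absence of any other big jump.\<close>
  have key: "(LINT u|\<nu>. indicator big_jumps u * J k u) \<le> 2 * m / q" for k
  proof -
    define F where "F x = exp (min (t * norm x) k)" for x :: 'a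
    have F [measurable]: "F \<in> borel_measurable borel" unfolding F_def by measurable
    have Fb: "0 \<le> F x" "F x \<le> exp k" for x by (auto simp: F_def)
    let ?I = "LINT u|\<nu>. indicator big_jumps u * J k u"
    have I: "?I \<ge> 0" using Jb by (intro Bochner_Integration.integral_nonneg) auto
    have intJ: "integrable \<nu> (\<lambda>u. indicator big_jumps u * J k u)"
      using integrable_indicator_bounded[OF sets jumps_measurable(2) big_jumps_fin[OF levy] J, of k "exp k"] Jb
      by simp
    have lim: "(\<lambda>n. LINT x|approx_law \<nu> \<beta> n. F x) \<longlonglongrightarrow> (LINT x|P. F x)"
    proof (rule approx_law_tendsto[OF id])
      show "exp k * t > 0" using t by simp
      show "\<bar>F x\<bar> \<le> exp k" for x using Fb[of x] by simp
      fix x y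
      have "\<bar>F x - F y\<bar> \<le> exp k * \<bar>min (t * norm x) k - min (t * norm y) k\<bar>"
        unfolding F_def by (rule exp_diff_le) auto
      also have "\<bar>min (t * norm x) k - min (t * norm y) k\<bar> \<le> \<bar>t * norm x - t * norm y\<bar>" by linarith
      also have "\<dots> = t * \<bar>norm x - norm y\<bar>" using t by (simp add: right_diff_distrib[symmetric] abs_mult)
      also have "\<dots> \<le> t * norm (x - y)" using t norm_triangle_ineq3[of x y] by (intro mult_left_mono) auto
      finally show "\<bar>F x - F y\<bar> \<le> exp k * t * norm (x - y)" by (simp add: mult.assoc)
    qed
    have "eventually (\<lambda>n. q * ?I / 2 \<le> (LINT x|approx_law \<nu> \<beta> n. F x)) sequentially"
      using R
    proof eventually_elim
      case (elim n)
      note Q = prob_space_approx_small[OF levy, of \<beta> n] sets_approx_small[OF levy, of \<beta> n]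
      interpret Q: prob_space "approx_small \<nu> \<beta> n" by (rule Q)
      have intr: "integrable (approx_small \<nu> \<beta> n) (ramp R)"
        by (rule bounded_measurable_integrable[OF Q ramp(4), of _ 1]) (use ramp in auto)
      have "(LINT x|approx_small \<nu> \<beta> n. q * ?I * (1 - ramp R x)) \<le> (LINT x|approx_law \<nu> \<beta> n. F x)"
      proof (rule approx_law_lower[of _ "exp k"])
        fix x
        have mF: "(\<lambda>y. F (x + y)) \<in> borel_measurable borel" by measurable
        have intF: "integrable \<nu> (\<lambda>u. indicator big_jumps u * F (x + u))"
          using integrable_indicator_bounded[OF sets jumps_measurable(2) big_jumps_fin[OF levy] mF, of "exp k"] Fb
          by simp
        \<comment> \<open>Where the ramp is below 1 the small-jump part has norm below
          \<open>R + 1\<close>; elsewhere the left-hand side is 0.\<close>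
        have pw: "(1 - ramp R x) * J k u \<le> F (x + u)" for u
        proof (cases "ramp R x < 1")
          case True
          then have "norm x < R + 1" by (auto simp: ramp_def min_def max_def split: if_splits)
          then have "norm u - R - 1 \<le> norm (x + u)"
            using norm_triangle_ineq4[of "x + u" x] by simp
          then have "t * (norm u - R - 1) \<le> t * norm (x + u)" using t by (intro mult_left_mono) auto
          then have "J k u \<le> F (x + u)" by (simp add: J_def F_def)
          moreover have "(1 - ramp R x) * J k u \<le> 1 * J k u"
            using ramp(1)[of R x] Jb by (intro mult_right_mono) auto
          ultimately show ?thesis by simp
        next
          case False
          then have "ramp R x = 1" using ramp(2)[of R x] by simp
          then show ?thesis using Fb by simp
        qed
        have "(1 - ramp R x) * ?I = (LINT u|\<nu>. (1 - ramp R x) * (indicator big_jumps u * J k u))" by simp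
        also have "\<dots> \<le> (LINT u|\<nu>. indicator big_jumps u * F (x + u))"
        proof (rule integral_mono[OF integrable_mult_right[OF intJ] intF])
          show "(1 - ramp R x) * (indicator big_jumps u * J k u) \<le> indicator big_jumps u * F (x + u)" for u
            using pw[of u] by (auto split: split_indicator)
        qed
        finally have "q * ((1 - ramp R x) * ?I) \<le> q * (LINT u|\<nu>. indicator big_jumps u * F (x + u))"
          using q by (intro mult_left_mono) auto
        also have "\<dots> \<le> (LINT y|compound_law \<nu> big_jumps (approx_steps \<nu> n). F (x + y))"
          unfolding q_def by (rule big_jumps_lower(2)[OF mF]) (use Fb in auto)
        finally show "q * ?I * (1 - ramp R x) \<le> (LINT y|compound_law \<nu> big_jumps (approx_steps \<nu> n). F (x + y))"
          by (simp add: mult_ac)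
      qed (use Fb intr in auto)
      also have "(LINT x|approx_small \<nu> \<beta> n. q * ?I * (1 - ramp R x)) = q * ?I * (1 - (LINT x|approx_small \<nu> \<beta> n. ramp R x))"
        using intr by (simp add: Q.prob_space)
      finally have "q * ?I * (1 - (LINT x|approx_small \<nu> \<beta> n. ramp R x)) \<le> (LINT x|approx_law \<nu> \<beta> n. F x)" .
      moreover have "q * ?I * (1 / 2) \<le> q * ?I * (1 - (LINT x|approx_small \<nu> \<beta> n. ramp R x))"
        using elim q I by (intro mult_left_mono) auto
      ultimately show ?case by simp
    qed
    from tendsto_lowerbound[OF lim this] have "q * ?I / 2 \<le> (LINT x|P. F x)" by simp
    also have "\<dots> \<le> m"
      unfolding m_def
    proof (rule integral_mono[OF _ int])
      show "integrable P F" by (rule bounded_measurable_integrable[OF PP F, of "exp k"]) (use Fb in auto)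
    qed (simp add: F_def)
    finally show ?thesis using q by (simp add: field_simps)
  qed
  let ?E = "\<lambda>u. indicator big_jumps u * exp (t * (norm u - R - 1))"
  have nn: "(\<integral>\<^sup>+u. ennreal (?E u) \<partial>\<nu>) \<le> ennreal (2 * m / q)"
  proof -
    \<comment> \<open>As \<open>k\<close> grows the truncated integrand eventually equals the full
      one, so Fatou's lemma applies.\<close>
    have "(\<integral>\<^sup>+u. ennreal (?E u) \<partial>\<nu>) = (\<integral>\<^sup>+u. liminf (\<lambda>k. ennreal (indicator big_jumps u * J (real k) u)) \<partial>\<nu>)"
    proof (rule nn_integral_cong)
      fix u :: 'a
      obtain k0 where k0: "t * (norm u - R - 1) \<le> real k0" using real_arch_simple by blast
      have "eventually (\<lambda>k. ennreal (indicator big_jumps u * J (real k) u) = ennreal (?E u)) sequentially"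
        using k0 by (intro eventually_sequentiallyI[of k0]) (auto simp: J_def min_def)
      then have "(\<lambda>k. ennreal (indicator big_jumps u * J (real k) u)) \<longlonglongrightarrow> ennreal (?E u)"
        by (rule tendsto_eventually)
      then show "ennreal (?E u) = liminf (\<lambda>k. ennreal (indicator big_jumps u * J (real k) u))"
        by (intro lim_imp_Liminf[symmetric]) auto
    qed
    also have "\<dots> \<le> liminf (\<lambda>k. \<integral>\<^sup>+u. ennreal (indicator big_jumps u * J (real k) u) \<partial>\<nu>)"
      by (rule nn_integral_liminf) measurable
    also have "\<dots> \<le> ennreal (2 * m / q)"
    proof (rule Liminf_le[OF _ always_eventually], simp, intro allI)
      fix k
      have "integrable \<nu> (\<lambda>u. indicator big_jumps u * J (real k) u)"
        using integrable_indicator_bounded[OF sets jumps_measurable(2) big_jumps_fin[OF levy] J, of "real k" "exp (real k)"] Jb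
        by simp
      then have "(\<integral>\<^sup>+u. ennreal (indicator big_jumps u * J (real k) u) \<partial>\<nu>) = ennreal (LINT u|\<nu>. indicator big_jumps u * J (real k) u)"
        using Jb by (intro nn_integral_eq_integral) auto
      then show "(\<integral>\<^sup>+u. ennreal (indicator big_jumps u * J (real k) u) \<partial>\<nu>) \<le> ennreal (2 * m / q)"
        using key[of "real k"] by (simp add: ennreal_leI)
    qed
    finally show ?thesis .
  qed
  have "integrable \<nu> ?E"
  proof (rule integrableI_nonneg)
    show "(\<integral>\<^sup>+u. ennreal (?E u) \<partial>\<nu>) < \<infinity>" using nn by (simp add: le_less_trans)
  qed auto
  \<comment> \<open>Multiplication by \<open>exp (t * (R + 1))\<close> undoes the shift.\<close>
  then have "integrable \<nu> (\<lambda>u. exp (t * (R + 1)) * ?E u)" by simp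
  moreover have eq: "exp (t * (R + 1)) * ?E u = indicator big_jumps u * exp (t * norm u)" for u
    by (simp add: exp_add[symmetric] algebra_simps)
  ultimately show ?thesis by (simp only: eq)
qed

end

subsection \<open>The Legendre transform and Chernoff bound\<close>

text \<open>The derivative of \<open>h_integrand\<close> in its parameter, at \<open>r\<close>; its
  integral is a Lipschitz constant of \<open>h\<close> up to \<open>r\<close>.\<close>

definition second_exp :: "real \<Rightarrow> 'a::real_normed_vector \<Rightarrow> real" where
  "second_exp r u = (norm u)\<^sup>2 * exp (r * norm u)"

definition h_integrand :: "real \<Rightarrow> 'a::real_normed_vector \<Rightarrow> real" where
  "h_integrand s u = norm u * (exp (s * norm u) - 1)"

lemma levy_h_eq: "levy_h \<nu> s = (LINT u|\<nu>. h_integrand s u)"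
  by (simp add: levy_h_def h_integrand_def)

lemma second_exp_measurable [measurable]: "second_exp r \<in> borel_measurable (borel :: 'a::euclidean_space measure)"
  and h_integrand_measurable [measurable]: "h_integrand r \<in> borel_measurable (borel :: 'a::euclidean_space measure)"
  unfolding second_exp_def h_integrand_def by measurable

lemma second_exp_nonneg: "0 \<le> second_exp r u"
  by (simp add: second_exp_def)

lemma h_integrand_diff_le:
  assumes "s \<le> r" "s' \<le> r"
  shows "\<bar>h_integrand s' u - h_integrand s u\<bar> \<le> \<bar>s' - s\<bar> * second_exp r u"
proof -
  have "\<bar>exp (s' * norm u) - exp (s * norm u)\<bar> \<le> exp (r * norm u) * \<bar>s' * norm u - s * norm u\<bar>"
    using assms by (intro exp_diff_le mult_right_mono) auto
  also have "\<bar>s' * norm u - s * norm u\<bar> = \<bar>s' - s\<bar> * norm u"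
    by (simp add: left_diff_distrib[symmetric] abs_mult)
  finally have "norm u * \<bar>exp (s' * norm u) - exp (s * norm u)\<bar> \<le> norm u * (exp (r * norm u) * (\<bar>s' - s\<bar> * norm u))"
    by (intro mult_left_mono) auto
  moreover have "\<bar>h_integrand s' u - h_integrand s u\<bar> = norm u * \<bar>exp (s' * norm u) - exp (s * norm u)\<bar>"
    by (simp add: h_integrand_def right_diff_distrib[symmetric] abs_mult)
  ultimately show ?thesis by (simp add: second_exp_def power2_eq_square mult_ac)
qed

text \<open>The slope of the tangent is the integrand of \<open>h\<close>, which is therefore the derivative of the
  integrated remainder.\<close>

lemma exp_remainder_tangent:
  "exp_remainder \<sigma> u + h_integrand \<sigma> u * (s - \<sigma>) \<le> exp_remainder s u"
proof -
  have "exp (\<sigma> * norm u) * (1 + (s - \<sigma>) * norm u) \<le> exp (\<sigma> * norm u) * exp ((s - \<sigma>) * norm u)"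
    by (intro mult_left_mono exp_ge_add_one_self) auto
  also have "\<dots> = exp (s * norm u)" by (simp add: exp_add[symmetric] algebra_simps)
  finally show ?thesis by (simp add: exp_remainder_def h_integrand_def algebra_simps)
qed

lemma levy_measurable:
  fixes \<nu> :: "'a::ordered_euclidean_space measure"
  assumes "levy_measure \<nu>" "f \<in> borel_measurable borel"
  shows "f \<in> borel_measurable \<nu>"
  using assms(2) by (subst measurable_cong_sets[OF sets_levy[OF assms(1)] refl])

text \<open>Inside the unit ball the exponential is bounded. Outside,
  \<open>x\<^sup>2 / 2 \<le> exp x\<close> at \<open>x = (t - r) * norm u\<close> absorbs the
  quadratic factor, at the price of moving from \<open>r\<close> to \<open>t\<close>.\<close>

lemma second_exp_le:
  fixes u :: "'a::real_normed_vector"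
  assumes r: "r < t"
  shows "second_exp r u \<le> exp \<bar>r\<bar> * min 1 ((norm u)\<^sup>2)
    + 2 / (t - r)\<^sup>2 * (indicator big_jumps u * exp (t * norm u))"
proof (cases "norm u \<le> 1")
  case True
  have "r * norm u \<le> \<bar>r\<bar> * 1"
    using mult_left_mono[OF True, of "\<bar>r\<bar>"] abs_ge_self[of "r * norm u"] by (simp add: abs_mult)
  then have "second_exp r u \<le> (norm u)\<^sup>2 * exp \<bar>r\<bar>"
    unfolding second_exp_def by (intro mult_left_mono) auto
  moreover have "min 1 ((norm u)\<^sup>2) = (norm u)\<^sup>2" using True by (simp add: power_le_one min_absorb2)
  ultimately show ?thesis by (simp add: mult.commute add_increasing2)
next
  case False
  have "((t - r) * norm u)\<^sup>2 / 2 \<le> 1 + (t - r) * norm u + ((t - r) * norm u)\<^sup>2 / 2" using r by simp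
  also have "\<dots> \<le> exp ((t - r) * norm u)" by (rule exp_lower_Taylor_quadratic) (use r in simp)
  finally have "(norm u)\<^sup>2 * (t - r)\<^sup>2 \<le> 2 * exp ((t - r) * norm u)"
    by (simp add: power_mult_distrib mult.commute)
  then have "(norm u)\<^sup>2 \<le> 2 * exp ((t - r) * norm u) / (t - r)\<^sup>2"
    using r by (subst pos_le_divide_eq) auto
  then have "(norm u)\<^sup>2 \<le> 2 / (t - r)\<^sup>2 * exp ((t - r) * norm u)" by simp
  then have "second_exp r u \<le> 2 / (t - r)\<^sup>2 * exp ((t - r) * norm u) * exp (r * norm u)"
    unfolding second_exp_def by (intro mult_right_mono) auto
  also have "\<dots> = 2 / (t - r)\<^sup>2 * (indicator big_jumps u * exp (t * norm u))"
    using False by (simp add: big_jumps_def exp_add[symmetric] left_diff_distrib)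
  finally show ?thesis by (simp add: add_increasing)
qed

lemma integrable_second_exp:
  fixes \<nu> :: "'a::ordered_euclidean_space measure"
  assumes levy: "levy_measure \<nu>" and int: "integrable \<nu> (\<lambda>u. indicator big_jumps u * exp (t * norm u))"
    and r: "r < t"
  shows "integrable \<nu> (second_exp r)"
proof (rule Bochner_Integration.integrable_bound)
  have i1: "integrable \<nu> (\<lambda>u. exp \<bar>r\<bar> * min 1 ((norm u)\<^sup>2))"
    by (rule integrable_levy[OF levy, of _ "exp \<bar>r\<bar>"]) (auto simp: abs_mult)
  show "integrable \<nu> (\<lambda>u. exp \<bar>r\<bar> * min 1 ((norm u)\<^sup>2)
      + 2 / (t - r)\<^sup>2 * (indicator big_jumps u * exp (t * norm u)))"
    by (rule Bochner_Integration.integrable_add[OF i1 integrable_mult_right[OF int]])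
  show "second_exp r \<in> borel_measurable \<nu>" by (intro levy_measurable[OF levy] second_exp_measurable)
  have "norm (second_exp r u) \<le> norm (exp \<bar>r\<bar> * min 1 ((norm u)\<^sup>2)
      + 2 / (t - r)\<^sup>2 * (indicator big_jumps u * exp (t * norm u)))" for u :: 'a
    unfolding real_norm_def
    by (rule order_trans[OF _ abs_ge_self]) (use second_exp_le[OF r, of u] second_exp_nonneg[of r u] in simp)
  then show "AE u in \<nu>. norm (second_exp r u) \<le> norm (exp \<bar>r\<bar> * min 1 ((norm u)\<^sup>2)
      + 2 / (t - r)\<^sup>2 * (indicator big_jumps u * exp (t * norm u)))"
    by (intro AE_I2)
qed

section \<open>Monotonicity, continuity and inversion of \<open>h\<close>\<close>

context
  fixes \<nu> :: "'a::ordered_euclidean_space measure" and T :: ereal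
  assumes levy: "levy_measure \<nu>" and T: "T > 0"
    and second: "\<And>r. 0 \<le> r \<Longrightarrow> ereal r < T \<Longrightarrow> integrable \<nu> (second_exp r)"
begin

lemma integrable_h_integrand:
  assumes "0 \<le> s" "ereal s < T"
  shows "integrable \<nu> (h_integrand s)"
proof -
  have "integrable \<nu> (\<lambda>u. s * second_exp s u)" by (intro integrable_mult_right second assms)
  then show ?thesis
  proof (rule Bochner_Integration.integrable_bound)
    show "h_integrand s \<in> borel_measurable \<nu>" by (intro levy_measurable[OF levy] second_exp_measurable h_integrand_measurable exp_remainder_measurable)
    show "AE u in \<nu>. norm (h_integrand s u) \<le> norm (s * second_exp s u)"
    proof (intro AE_I2)
      fix u :: 'a
      have "h_integrand 0 u = 0" by (simp add: h_integrand_def)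
      then show "norm (h_integrand s u) \<le> norm (s * second_exp s u)"
        using h_integrand_diff_le[of 0 s s u] assms second_exp_nonneg[of s u] by (simp add: abs_mult)
    qed
  qed
qed

lemma integrable_exp_remainder:
  assumes "0 \<le> s" "ereal s < T"
  shows "integrable \<nu> (exp_remainder s)"
proof -
  have "integrable \<nu> (\<lambda>u. s * h_integrand s u)" by (intro integrable_mult_right integrable_h_integrand assms)
  then show ?thesis
  proof (rule Bochner_Integration.integrable_bound)
    show "exp_remainder s \<in> borel_measurable \<nu>" by (intro levy_measurable[OF levy] second_exp_measurable h_integrand_measurable exp_remainder_measurable)
    show "AE u in \<nu>. norm (exp_remainder s u) \<le> norm (s * h_integrand s u)"
    proof (intro AE_I2)
      fix u :: 'a
      have "exp_remainder 0 u = 0" by (simp add: exp_remainder_def)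
      then show "norm (exp_remainder s u) \<le> norm (s * h_integrand s u)"
        using exp_remainder_tangent[of s u 0] exp_remainder_nonneg[of s u] by (simp add: mult.commute)
    qed
  qed
qed

lemma h_0: "levy_h \<nu> 0 = 0"
  by (simp add: levy_h_def)

lemma h_lipschitz:
  assumes "0 \<le> s" "s \<le> r" "0 \<le> s'" "s' \<le> r" "ereal r < T"
  shows "\<bar>levy_h \<nu> s' - levy_h \<nu> s\<bar> \<le> \<bar>s' - s\<bar> * (LINT u|\<nu>. second_exp r u)"
proof -
  have sT: "ereal s < T" "ereal s' < T" using assms by (auto intro: le_less_trans[of _ "ereal r"])
  have "levy_h \<nu> s' - levy_h \<nu> s = (LINT u|\<nu>. h_integrand s' u - h_integrand s u)"
    unfolding levy_h_eq using assms sT by (subst Bochner_Integration.integral_diff) (auto intro!: integrable_h_integrand)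
  also have "norm \<dots> \<le> (LINT u|\<nu>. \<bar>s' - s\<bar> * second_exp r u)"
    using assms sT h_integrand_diff_le[of s r s']
    by (intro Bochner_Integration.integral_norm_bound_integral Bochner_Integration.integrable_diff
        integrable_h_integrand integrable_mult_right second) auto
  finally show ?thesis by simp
qed

lemma continuous_on_h:
  assumes "ereal r < T"
  shows "continuous_on {0..r} (levy_h \<nu>)"
proof (rule lipschitz_on_continuous_on)
  show "(LINT u|\<nu>. second_exp r u)-lipschitz_on {0..r} (levy_h \<nu>)"
  proof (rule lipschitz_onI)
    show "0 \<le> (LINT u|\<nu>. second_exp r u)"
      by (intro Bochner_Integration.integral_nonneg second_exp_nonneg)
    show "dist (levy_h \<nu> x) (levy_h \<nu> y) \<le> (LINT u|\<nu>. second_exp r u) * dist x y" if "x \<in> {0..r}" "y \<in> {0..r}" for x y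
      using h_lipschitz[of y r x] that assms by (simp add: dist_real_def mult.commute)
  qed
qed

text \<open>The integrand increases strictly away from the origin, and \<open>\<nu>\<close> is
  nonzero without an atom there, so the difference of the integrals cannot vanish.\<close>

lemma h_strict_mono:
  assumes "0 \<le> s" "s < s'" "ereal s' < T"
  shows "levy_h \<nu> s < levy_h \<nu> s'"
proof -
  have sT: "ereal s < T" using assms by (auto intro: less_trans[of _ "ereal s'"])
  let ?f = "\<lambda>u. h_integrand s' u - h_integrand s u"
  have int: "integrable \<nu> ?f"
    using assms sT by (intro Bochner_Integration.integrable_diff integrable_h_integrand) auto
  have pos: "?f u > 0" if "u \<noteq> 0" for u
    using that assms by (simp add: h_integrand_def)
  have nn: "?f u \<ge> 0" for u using pos[of u] by (cases "u = 0") (auto simp: h_integrand_def)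
  have "(LINT u|\<nu>. ?f u) \<noteq> 0"
  proof
    assume "(LINT u|\<nu>. ?f u) = 0"
    moreover have "AE u in \<nu>. 0 \<le> ?f u" by (intro AE_I2 nn)
    ultimately have "AE u in \<nu>. ?f u = 0"
      using integral_nonneg_eq_0_iff_AE[OF int] by blast
    then have "AE u in \<nu>. u \<in> {0}"
      by eventually_elim (use pos in force)
    moreover have "{0} \<in> null_sets \<nu>"
      using levy by (intro null_setsI) (auto simp: levy_measure_def)
    then have "AE u in \<nu>. u \<notin> {0}" by (rule AE_not_in)
    ultimately have "AE u in \<nu>. False" by eventually_elim simp
    then have "space \<nu> \<in> null_sets \<nu>" by (subst AE_iff_null_sets) auto
    then have "emeasure \<nu> (space \<nu>) = 0" by (rule null_setsD1)
    then show False using levy by (simp add: levy_measure_def)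
  qed
  moreover have "(LINT u|\<nu>. ?f u) \<ge> 0" by (intro Bochner_Integration.integral_nonneg nn)
  moreover have "(LINT u|\<nu>. ?f u) = levy_h \<nu> s' - levy_h \<nu> s"
    unfolding levy_h_eq using assms sT by (subst Bochner_Integration.integral_diff) (auto intro!: integrable_h_integrand)
  ultimately show ?thesis by simp
qed

lemma h_inv_h:
  assumes "0 < s" "ereal s < T"
  shows "levy_h_inv \<nu> T (levy_h \<nu> s) = s"
proof -
  have "inj_on (levy_h \<nu>) {s. 0 < s \<and> ereal s < T}"
  proof (rule inj_onI)
    fix x y assume "x \<in> {s. 0 < s \<and> ereal s < T}" "y \<in> {s. 0 < s \<and> ereal s < T}" "levy_h \<nu> x = levy_h \<nu> y"
    then show "x = y" using h_strict_mono[of x y] h_strict_mono[of y x] by (cases x y rule: linorder_cases) auto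
  qed
  then show ?thesis unfolding levy_h_inv_def using assms by (intro inv_into_f_f) auto
qed

text \<open>By monotonicity the left limit is the supremum of \<open>h\<close> on (0, T), so any
  smaller level is exceeded inside the interval. Existence of the limit is shown first, since
  \<open>Lim\<close> says nothing without it.\<close>

lemma less_h_left_limit:
  assumes y: "ereal y < levy_h_left_limit \<nu> T"
  obtains s where "0 < s" "ereal s < T" "y < levy_h \<nu> s"
proof -
  define F where "F s = ereal (levy_h \<nu> (real_of_ereal s))" for s :: ereal
  define L where "L = (SUP s\<in>{s. 0 < s \<and> ereal s < T}. ereal (levy_h \<nu> s))"
  have ev: "eventually P (at_left T) \<longleftrightarrow> (\<exists>b<T. \<forall>z>b. z < T \<longrightarrow> P z)" for P
    by (rule eventually_at_left[OF T])
  have real: "\<exists>r. z = ereal r \<and> s < r \<and> ereal r < T" if "ereal s < z" "z < T" for z s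
    using that by (cases z) auto
  have "(F \<longlongrightarrow> L) (at_left T)"
  proof (rule order_tendstoI)
    fix a assume "a < L"
    then obtain s where s: "0 < s" "ereal s < T" "a < ereal (levy_h \<nu> s)" by (auto simp: L_def less_SUP_iff)
    show "eventually (\<lambda>z. a < F z) (at_left T)"
      unfolding ev
    proof (intro exI[of _ "ereal s"] conjI allI impI)
      fix z assume "ereal s < z" "z < T"
      from real[OF this] obtain r where r: "z = ereal r" "s < r" "ereal r < T" by blast
      have "levy_h \<nu> s < levy_h \<nu> r" using s r by (intro h_strict_mono) auto
      then show "a < F z" using s(3) r by (simp add: F_def less_trans[of a "ereal (levy_h \<nu> s)"])
    qed (rule s)
  next
    fix a assume a: "L < a"
    show "eventually (\<lambda>z. F z < a) (at_left T)"
      unfolding ev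
    proof (intro exI[of _ 0] conjI allI impI T)
      fix z assume "0 < z" "z < T"
      with real[of 0 z] obtain r where r: "z = ereal r" "0 < r" "ereal r < T" by (auto simp: zero_ereal_def)
      then have "ereal (levy_h \<nu> r) \<le> L" unfolding L_def by (intro SUP_upper) auto
      then show "F z < a" using a r by (simp add: F_def le_less_trans)
    qed
  qed
  moreover have "at_left T \<noteq> bot"
  proof
    assume "at_left T = bot"
    then have "eventually (\<lambda>_. False) (at_left T)" by simp
    then show False unfolding ev using dense by blast
  qed
  ultimately have "levy_h_left_limit \<nu> T = L"
    unfolding levy_h_left_limit_def F_def[symmetric, abs_def] by (intro tendsto_Lim) auto
  with y obtain s where "0 < s" "ereal s < T" "y < levy_h \<nu> s" by (auto simp: L_def less_SUP_iff)
  then show ?thesis by (rule that)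
qed

section \<open>Legendre duality\<close>

lemma exp_remainder_integral_tangent:
  assumes "0 \<le> s" "ereal s < T" "0 \<le> \<sigma>" "ereal \<sigma> < T"
  shows "(LINT u|\<nu>. exp_remainder \<sigma> u) + levy_h \<nu> \<sigma> * (s - \<sigma>) \<le> (LINT u|\<nu>. exp_remainder s u)"
proof -
  have "(LINT u|\<nu>. exp_remainder \<sigma> u) + levy_h \<nu> \<sigma> * (s - \<sigma>)
      = (LINT u|\<nu>. exp_remainder \<sigma> u + h_integrand \<sigma> u * (s - \<sigma>))"
    unfolding levy_h_eq using assms
    by (subst Bochner_Integration.integral_add)
      (auto intro!: integrable_exp_remainder integrable_h_integrand)
  also have "\<dots> \<le> (LINT u|\<nu>. exp_remainder s u)"
    using assms by (intro integral_mono exp_remainder_tangent Bochner_Integration.integrable_add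
        integrable_exp_remainder integrable_mult_left integrable_h_integrand) auto
  finally show ?thesis .
qed

text \<open>The Legendre transform \<open>\<Phi>\<close> of the integrated remainder is a primitive of the inverse of \<open>h\<close>.\<close>

theorem integral_h_inv:
  assumes x: "0 < x" and xT: "ereal x < levy_h_left_limit \<nu> T"
  obtains s where "0 < s" "ereal s < T"
    "(LBINT y=0..ereal x. levy_h_inv \<nu> T y) = s * x - (LINT u|\<nu>. exp_remainder s u)"
proof -
  define H where "H s = (LINT u|\<nu>. exp_remainder s u)" for s
  define g where "g = levy_h_inv \<nu> T"
  \<comment> \<open>Everything takes place below \<open>b\<close>: levels between 0 and
    \<open>levy_h \<nu> b\<close> have their inverse in (0, b), where all integrals involved are
    finite.\<close>
  obtain b where b: "0 < b" "ereal b < T" "x < levy_h \<nu> b" by (rule less_h_left_limit[OF xT])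
  have below: "ereal s < T" if "s \<le> b" for s
    using that b(2) by (auto intro: le_less_trans[of _ "ereal b"])
  have gy: "0 < g y \<and> g y < b \<and> levy_h \<nu> (g y) = y" if y: "0 < y" "y < levy_h \<nu> b" for y
  proof -
    have "\<exists>s\<ge>0. s \<le> b \<and> levy_h \<nu> s = y"
      by (rule IVT') (use y b h_0 continuous_on_h[OF b(2)] in auto)
    then obtain s where s: "0 \<le> s" "s \<le> b" "levy_h \<nu> s = y" by blast
    then have "s \<noteq> 0" "s \<noteq> b" using y h_0 by auto
    then have "g y = s" using s h_inv_h[of s] below[of s] by (auto simp: g_def)
    then show ?thesis using s \<open>s \<noteq> 0\<close> \<open>s \<noteq> b\<close> by simp
  qed
  have contg: "isCont g y" if y: "0 < y" "y < levy_h \<nu> b" for y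
  proof -
    define d where "d = min (g y) (b - g y) / 2"
    have g: "0 < g y" "g y < b" "levy_h \<nu> (g y) = y" using gy[OF y] by auto
    have "isCont g (levy_h \<nu> (g y))"
    proof (rule isCont_inverse_function[of d "g y" g "levy_h \<nu>"])
      show "0 < d" using g by (simp add: d_def)
      fix z assume "\<bar>z - g y\<bar> \<le> d"
      then have zd: "z - g y \<le> d" "g y - z \<le> d" by (simp_all add: abs_le_iff)
      have "2 * d \<le> g y" "2 * d \<le> b - g y" by (simp_all add: d_def)
      with zd g(1,2) have z: "0 < z" "z < b" by linarith+
      then show "g (levy_h \<nu> z) = z" unfolding g_def by (intro h_inv_h below) auto
      have "continuous_on {0<..<b} (levy_h \<nu>)"
        by (rule continuous_on_subset[OF continuous_on_h[OF b(2)]]) auto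
      then show "isCont (levy_h \<nu>) z" using z by (simp add: continuous_on_eq_continuous_at)
    qed
    then show ?thesis using g by simp
  qed
  define \<Phi> where "\<Phi> y = y * g y - H (g y)" for y
  \<comment> \<open>By the tangent inequality, \<open>\<Phi> y\<close> is the largest value of
    \<open>s * y - H s\<close> on [0, b], attained at \<open>s = g y\<close>.\<close>
  have Phi_ge: "s * y - H s \<le> \<Phi> y" if y: "0 < y" "y < levy_h \<nu> b" and s: "0 \<le> s" "s \<le> b" for s y
    using exp_remainder_integral_tangent[of s "g y"] gy[OF y] s below[of s] below[of "g y"]
    by (simp add: \<Phi>_def H_def algebra_simps)
  \<comment> \<open>Using each maximizer as a competitor at the other point squeezes the increment
    of \<open>\<Phi>\<close> between the slopes \<open>g y\<close> and \<open>g z\<close>.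
    Continuity of \<open>g\<close> then gives the derivative of \<open>\<Phi>\<close> without
    differentiating \<open>H\<close>.\<close>
  have Phi_diff: "\<bar>(\<Phi> z - \<Phi> y) - g y * (z - y)\<bar> \<le> \<bar>g z - g y\<bar> * \<bar>z - y\<bar>"
    if y: "0 < y" "y < levy_h \<nu> b" and z: "0 < z" "z < levy_h \<nu> b" for y z
  proof -
    have "g y * (z - y) \<le> \<Phi> z - \<Phi> y"
      using Phi_ge[OF z, of "g y"] gy[OF y] by (simp add: \<Phi>_def algebra_simps)
    moreover have "\<Phi> z - \<Phi> y \<le> g z * (z - y)"
      using Phi_ge[OF y, of "g z"] gy[OF z] by (simp add: \<Phi>_def algebra_simps)
    ultimately have "\<bar>(\<Phi> z - \<Phi> y) - g y * (z - y)\<bar> \<le> (g z - g y) * (z - y)"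
      by (simp add: algebra_simps abs_le_iff)
    also have "\<dots> \<le> \<bar>(g z - g y) * (z - y)\<bar>" by simp
    finally show ?thesis by (simp add: abs_mult)
  qed
  have deriv: "(\<Phi> has_real_derivative g y) (at y)" if y: "0 < y" "y < levy_h \<nu> b" for y
    unfolding has_field_derivative_iff
  proof (rule LIM_zero_cancel, rule Lim_null_comparison)
    have "eventually (\<lambda>z. z \<in> {0<..<levy_h \<nu> b}) (at y)"
      using y by (intro eventually_at_in_open') auto
    moreover have "eventually (\<lambda>z. z \<noteq> y) (at y)" by (simp add: eventually_at_filter)
    ultimately show "eventually (\<lambda>z. norm ((\<Phi> z - \<Phi> y) / (z - y) - g y) \<le> \<bar>g z - g y\<bar>) (at y)"
    proof eventually_elim
      case (elim z)
      then have "(\<Phi> z - \<Phi> y) / (z - y) - g y = ((\<Phi> z - \<Phi> y) - g y * (z - y)) / (z - y)"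
        by (simp add: diff_divide_distrib)
      then show ?case using Phi_diff[OF y, of z] elim by (simp add: abs_div divide_le_eq)
    qed
    have "((\<lambda>z. \<bar>g z - g y\<bar>) \<longlongrightarrow> \<bar>g y - g y\<bar>) (at y)"
      using contg[OF y] unfolding isCont_def by (intro tendsto_intros)
    then show "((\<lambda>z. \<bar>g z - g y\<bar>) \<longlongrightarrow> 0) (at y)" by simp
  qed
  have H0: "H 0 = 0" by (simp add: H_def exp_remainder_def)
  have H_nonneg: "H s \<ge> 0" for s
    unfolding H_def by (intro Bochner_Integration.integral_nonneg exp_remainder_nonneg)
  \<comment> \<open>The competitor \<open>s = 0\<close> gives the lower bound,
    \<open>H_nonneg\<close> and \<open>g y < b\<close> the upper one.\<close>
  have lim0: "(\<Phi> \<longlongrightarrow> 0) (at_right 0)"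
  proof (rule tendsto_sandwich)
    have ev: "eventually (\<lambda>y. y \<in> {0<..<levy_h \<nu> b}) (at_right 0)"
      using x b by (intro eventually_at_right_real) auto
    show "eventually (\<lambda>y. 0 \<le> \<Phi> y) (at_right 0)"
      using ev by eventually_elim (use Phi_ge[of _ 0] b H0 in auto)
    show "eventually (\<lambda>y. \<Phi> y \<le> y * b) (at_right 0)"
      using ev
    proof eventually_elim
      case (elim y)
      then have "y * g y \<le> y * b" using gy[of y] by (intro mult_left_mono) auto
      then show ?case using H_nonneg[of "g y"] by (simp add: \<Phi>_def)
    qed
    have "((\<lambda>y. y * b) \<longlongrightarrow> 0 * b) (at_right 0)" by (intro tendsto_intros)
    then show "((\<lambda>y. y * b) \<longlongrightarrow> 0) (at_right 0)" by simp
  qed simp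
  have limx: "(\<Phi> \<longlongrightarrow> \<Phi> x) (at_left x)"
    using DERIV_isCont[OF deriv[of x]] x b unfolding isCont_def by (auto intro: tendsto_within_subset)
  \<comment> \<open>The endpoint 0 enters through a limit, because \<open>h\<close> is inverted on
    positive parameters only and does not take the value 0 there.\<close>
  have "(LBINT y=0..ereal x. g y) = \<Phi> x - 0"
  proof (rule interval_integral_FTC_nonneg(2))
    show "(0::ereal) < ereal x" using x by simp
    show "(\<Phi> has_real_derivative g y) (at y)" "isCont g y" if "0 < ereal y" "ereal y < ereal x" for y
      using that b by (auto intro!: deriv contg)
    show "AE y in lborel. 0 < ereal y \<longrightarrow> ereal y < ereal x \<longrightarrow> 0 \<le> g y"
    proof (intro AE_I2 impI)
      fix y assume "0 < ereal y" "ereal y < ereal x"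
      then show "0 \<le> g y" using gy[of y] b by simp
    qed
    show "((\<Phi> \<circ> real_of_ereal) \<longlongrightarrow> 0) (at_right 0)"
      unfolding zero_ereal_def ereal_tendsto_simps by (rule lim0)
    show "((\<Phi> \<circ> real_of_ereal) \<longlongrightarrow> \<Phi> x) (at_left (ereal x))"
      unfolding ereal_tendsto_simps by (rule limx)
  qed
  then have "(LBINT y=0..ereal x. levy_h_inv \<nu> T y) = g x * x - (LINT u|\<nu>. exp_remainder (g x) u)"
    by (simp add: \<Phi>_def g_def H_def mult.commute)
  moreover have "0 < g x" "ereal (g x) < T" using gy[of x] x b below[of "g x"] by auto
  ultimately show ?thesis using that by blast
qed

end

theorem infinitely_divisible_concentration:
  fixes P :: "'a::ordered_euclidean_space measure"
  assumes id: "infinitely_divisible_law P \<beta> \<nu>"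
    and T: "T > 0" "\<And>r. 0 \<le> r \<Longrightarrow> ereal r < T \<Longrightarrow> \<exists>t>r. integrable P (\<lambda>x. exp (t * norm x))"
    and G: "lip1_bounded G" and x: "0 < x" "ereal x < levy_h_left_limit \<nu> T"
  shows "measure P {v \<in> space P. G v - (LINT v|P. G v) \<ge> x}
    \<le> exp (- (LBINT y=0..ereal x. levy_h_inv \<nu> T y))"
proof -
  note levy = id_facts(3)[OF id]
  interpret P: prob_space P by (rule id_facts(1)[OF id])
  have sets: "sets P = sets borel" by (rule id_facts(2)[OF id])
  note sets [measurable_cong] and lip1_bounded_measurable[OF G, measurable]
  have second: "integrable \<nu> (second_exp r)" if r: "0 \<le> r" "ereal r < T" for r
  proof -
    \<comment> \<open>An exponential moment strictly beyond \<open>r\<close> leaves the room that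
      the quadratic factor requires.\<close>
    obtain t where t: "t > r" "integrable P (\<lambda>x. exp (t * norm x))" using T(2)[OF r] by blast
    show ?thesis using levy_exp_moment[OF id _ t(2)] t(1) r(1) by (intro integrable_second_exp[OF levy _ t(1)]) auto
  qed
  \<comment> \<open>The optimal Chernoff parameter: it attains the Legendre transform at
    \<open>x\<close>.\<close>
  obtain s where s: "0 < s" "ereal s < T"
    and I: "(LBINT y=0..ereal x. levy_h_inv \<nu> T y) = s * x - (LINT u|\<nu>. exp_remainder s u)"
    using integral_h_inv[OF levy T(1) second x] by blast
  let ?H = "LINT u|\<nu>. exp_remainder s u" and ?m = "LINT v|P. G v"
  obtain B where B: "\<And>x. \<bar>G x\<bar> \<le> B" using G by (auto simp: lip1_bounded_def)
  have eB: "norm (exp (s * G v)) \<le> exp (s * B)" for v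
    using B[of v] s by (simp add: abs_le_iff)
  have ie: "integrable P (\<lambda>v. exp (s * G v))"
    by (rule bounded_measurable_integrable[OF id_facts(1,2)[OF id] _ eB]) measurable
  have "exp_conc s ?H P"
    using s by (intro exp_conc_infinitely_divisible[OF id] integrable_exp_remainder[OF levy T(1) second]) auto
  then have conc: "(LINT v|P. exp (s * G v)) \<le> exp (?H + s * ?m)"
    using G unfolding exp_conc_def by blast
  have "x \<le> G v - ?m \<longleftrightarrow> exp (s * (?m + x)) \<le> exp (s * G v)" for v
    unfolding exp_le_cancel_iff mult_le_cancel_left_pos[OF s(1)] by linarith
  then have "{v \<in> space P. G v - ?m \<ge> x} = {v \<in> space P. exp (s * G v) \<ge> exp (s * (?m + x))}"
    by simp
  then have "measure P {v \<in> space P. G v - ?m \<ge> x} = measure P {v \<in> space P. exp (s * G v) \<ge> exp (s * (?m + x))}"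
    by simp
  also have "\<dots> \<le> (LINT v|P. exp (s * G v)) / exp (s * (?m + x))"
    by (rule integral_Markov_inequality_measure[OF ie, of "{}"]) auto
  also have "\<dots> \<le> exp (?H + s * ?m) / exp (s * (?m + x))"
    using conc by (intro divide_right_mono) auto
  also have "\<dots> = exp (- (s * x - ?H))"
    by (simp add: exp_diff[symmetric] algebra_simps)
  finally show ?thesis by (simp add: I)
qed

subsection \<open>Concentration of the spectral measure\<close>

lemma real_params_measurable:
  fixes \<omega> :: "'n::{finite,linorder} \<Rightarrow> 'n \<Rightarrow> 's \<Rightarrow> complex"
  assumes [measurable]: "\<And>i j. \<omega> i j \<in> borel_measurable M"
  shows "(\<lambda>w. real_params (\<lambda>i j. \<omega> i j w)) \<in> borel_measurable M"
proof (subst borel_measurable_euclidean_space, intro ballI)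
  fix b :: "real ^ ('n \<times> 'n)" assume "b \<in> Basis"
  then obtain i j where b: "b = axis (i, j) 1" by (auto simp: Basis_vec_def)
  have "(\<lambda>w. real_params (\<lambda>i j. \<omega> i j w) \<bullet> b) = (\<lambda>w. if i \<le> j then Re (\<omega> i j w) else Im (\<omega> j i w))"
    by (simp add: b real_params_def inner_axis)
  also have "\<dots> \<in> borel_measurable M" by measurable
  finally show "(\<lambda>w. real_params (\<lambda>i j. \<omega> i j w) \<bullet> b) \<in> borel_measurable M" .
qed

theorem proposition1p4:
  fixes M :: "'s measure"
    and \<omega> :: "'n::{finite,linorder} \<Rightarrow> 'n \<Rightarrow> 's \<Rightarrow> complex"
    and A :: "((complex, 'n) vec, 'n) vec"
    and \<beta> :: "real ^ ('n \<times> 'n)"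
    and \<nu> :: "(real ^ ('n \<times> 'n)) measure"
    and \<mu> :: "real measure"
    and a b \<delta> :: real
  defines "N \<equiv> real CARD('n)"
    and "X \<equiv> (\<lambda>w. real_params (\<lambda>i j. \<omega> i j w))"
  defines "T \<equiv> exp_moment_sup M X"
    and "dist_\<mu> \<equiv> (\<lambda>w. wasserstein b
            (empirical_spectral_measure (weighted_matrix A (\<lambda>i j. \<omega> i j w))) \<mu>)"
  assumes "prob_space M"
    and "\<And>i j. \<omega> i j \<in> borel_measurable M"
    and "\<And>i j w. w \<in> space M \<Longrightarrow> \<omega> i j w = cnj (\<omega> j i w)"
    and "\<And>i w. w \<in> space M \<Longrightarrow> Im (\<omega> i i w) = 0"
    and "hermitian_matrix A"
    and "a > 0"
    and "\<And>i j. cmod (A $ i $ j) \<le> a"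
    and "infinitely_divisible_law (distr M borel X) \<beta> \<nu>"
    and "\<exists>t>0. integrable M (\<lambda>w. exp (t * norm (X w)))"
    and "b > 0"
    and "prob_space \<mu>" and "sets \<mu> = sets borel"
    and "0 < \<delta>"
    and "ereal \<delta> < ereal (sqrt 2 * a) * levy_h_left_limit \<nu> T / ereal N"
  shows "measure M {w \<in> space M. dist_\<mu> w - (LINT v|M. dist_\<mu> v) \<ge> \<delta>}
     \<le> exp (- (LBINT s=0..ereal (N * \<delta> / (sqrt 2 * a)). levy_h_inv \<nu> T s))"
proof -
  note [measurable] = assms(6)
  have X [measurable]: "X \<in> borel_measurable M" unfolding X_def by (rule real_params_measurable) (rule assms(6))
  have N: "N > 0" by (simp add: N_def)
  \<comment> \<open>The Lipschitz constant of the distance. Division by \<open>c\<close> makes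
    \<open>G\<close> 1-Lipschitz and turns the level \<open>\<delta>\<close> into the upper limit of
    the integral.\<close>
  define c where "c = sqrt 2 * a / N"
  have c: "c > 0" using \<open>a > 0\<close> N by (simp add: c_def)
  define F where "F v = wasserstein b (empirical_spectral_measure (weighted_matrix A (hermitian_of_params v))) \<mu>"
    for v :: "real ^ ('n \<times> 'n)"
  define G where "G v = F v / c" for v
  \<comment> \<open>On \<open>space M\<close> the entries are Hermitian, so the distance depends on
    the parameter vector alone and the estimate can be moved to its law.\<close>
  have FX: "dist_\<mu> w = F (X w)" if w: "w \<in> space M" for w
  proof -
    have "hermitian_of_params (X w) = (\<lambda>i j. \<omega> i j w)"
      unfolding X_def using assms(7,8)[OF w] by (intro ext hermitian_of_params_real_params) blast+
    then show ?thesis by (simp add: dist_\<mu>_def F_def)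
  qed
  have G: "lip1_bounded G"
    unfolding lip1_bounded_def
  proof (intro conjI allI exI)
    fix x y
    have "\<bar>F x - F y\<bar> \<le> c * norm (x - y)"
      unfolding F_def c_def N_def
      by (rule wasserstein_empirical_spectral_measure_lipschitz[OF assms(9,11,10,14,15,16)])
    then have "\<bar>F x - F y\<bar> / c \<le> norm (x - y)" using c by (simp add: pos_divide_le_eq mult.commute)
    then show "\<bar>G x - G y\<bar> \<le> norm (x - y)" using c by (simp add: G_def diff_divide_distrib[symmetric] abs_div)
  next
    fix x
    note esm = prob_space_empirical_spectral_measure[OF hermitian_weighted_matrix[OF assms(9), of x]]
    have "0 \<le> F x" "F x \<le> 2 * b"
      unfolding F_def using wasserstein_bounded(2,3)[OF assms(14) esm assms(15,16)] by blast+
    then show "\<bar>G x\<bar> \<le> 2 * b / c" using c by (simp add: G_def divide_right_mono)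
  qed
  note [measurable] = lip1_bounded_measurable[OF G]
  have FG: "F v = c * G v" for v using c by (simp add: G_def)
  define P where "P = distr M borel X"
  \<comment> \<open>Any \<open>r\<close> below the supremum lies strictly below an admissible
    exponent, which is the gap that the concentration theorem asks for.\<close>
  have moment: "\<exists>t>r. integrable P (\<lambda>x. exp (t * norm x))" if "ereal r < T" for r
  proof -
    have "ereal r < Sup {ereal t | t. t > 0 \<and> integrable M (\<lambda>w. exp (t * norm (X w)))}"
      using that unfolding T_def exp_moment_sup_def .
    then obtain y where y: "y \<in> {ereal t | t. t > 0 \<and> integrable M (\<lambda>w. exp (t * norm (X w)))}" "ereal r < y"
      by (rule less_Sup_iff[THEN iffD1, THEN bexE])
    from y(1) obtain t where t: "y = ereal t" "integrable M (\<lambda>w. exp (t * norm (X w)))"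
      unfolding mem_Collect_eq by (elim exE conjE)
    from y(2) have "r < t" unfolding t(1) ereal_less_eq less_ereal.simps(1) .
    with t(2) have "r < t \<and> integrable M (\<lambda>w. exp (t * norm (X w)))" by (intro conjI)
    then show ?thesis unfolding P_def by (intro exI[of _ t]) (simp add: integrable_distr_eq[OF X])
  qed
  have "T > 0"
  proof -
    obtain t where t: "t > 0" "integrable M (\<lambda>w. exp (t * norm (X w)))" using assms(13) by blast
    then have "ereal t \<le> T" unfolding T_def exp_moment_sup_def by (intro Sup_upper) auto
    then show ?thesis using t(1) by (auto intro: less_le_trans[of _ "ereal t"])
  qed
  let ?x = "N * \<delta> / (sqrt 2 * a)"
  have x: "0 < ?x" using \<open>a > 0\<close> \<open>0 < \<delta>\<close> N by simp
  \<comment> \<open>The left limit may be infinite, so the constants are cleared from the hypothesis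
    on \<open>\<delta>\<close> case by case; minus infinity would contradict it.\<close>
  have xL: "ereal ?x < levy_h_left_limit \<nu> T"
  proof (cases "levy_h_left_limit \<nu> T")
    case (real r)
    have "\<delta> < sqrt 2 * a * r / N" using assms(18) N by (simp add: real)
    then show ?thesis using \<open>a > 0\<close> N by (simp add: real field_simps)
  next
    case MInf
    then show ?thesis using assms(18) \<open>a > 0\<close> N by (simp add: ereal_divide_ereal)
  qed simp
  have mean: "(LINT v|M. dist_\<mu> v) = c * (LINT v|P. G v)"
  proof -
    have "(LINT v|M. dist_\<mu> v) = (LINT v|M. c * G (X v))"
      by (intro Bochner_Integration.integral_cong refl) (simp add: FX FG)
    also have "\<dots> = c * (LINT v|P. G v)" unfolding P_def by (simp add: integral_distr)
    finally show ?thesis .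
  qed
  have cx: "c * ?x = \<delta>" using \<open>a > 0\<close> N by (simp add: c_def)
  have "(\<delta> \<le> dist_\<mu> w - (LINT v|M. dist_\<mu> v)) = (?x \<le> G (X w) - (LINT v|P. G v))" if "w \<in> space M" for w
    unfolding mean FX[OF that] FG right_diff_distrib[symmetric]
    by (subst cx[symmetric]) (rule mult_le_cancel_left_pos[OF c])
  then have "{w \<in> space M. dist_\<mu> w - (LINT v|M. dist_\<mu> v) \<ge> \<delta>}
      = X -` {v \<in> space P. G v - (LINT v|P. G v) \<ge> ?x} \<inter> space M"
    by (auto simp: P_def)
  also have "measure M \<dots> = measure P {v \<in> space P. G v - (LINT v|P. G v) \<ge> ?x}"
    unfolding P_def by (rule measure_distr[symmetric]) measurable
  also have "\<dots> \<le> exp (- (LBINT s=0..ereal ?x. levy_h_inv \<nu> T s))"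
    by (rule infinitely_divisible_concentration[OF _ \<open>T > 0\<close> moment G x xL])
      (use assms(12) in \<open>simp add: P_def\<close>)
  finally show ?thesis .
qed

end
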